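(* Let $J\ge2$, let $k_1,\dots,k_J\ge1$ be integers and let $0<d<1/2$ satisfy $d>\frac12(1-\frac1{k_j})$ for $j=1,\dots,J$. Let $W$ be a complex Hermitian Gaussian random measure on $\mathbb{R}$ with Lebesgue control measure and let $$Z^{(k_j)}_d(t)=I_{k_j}(f^{(t)}_{k_j,d}),\qquad t>0,\ j=1,\dots,J,$$ be the Hermite processes defined by Wiener–Itô integrals with respect to this same $W$, where $$f^{(t)}_{k,d}(x_1,\dots,x_k)=b_{k,d}\,\frac{e^{it(x_1+\dots+x_k)}-1}{i(x_1+\dots+x_k)}\,|x_1|^{-d}\cdots|x_k|^{-d},\qquad b_{k,d}=\left(\frac{(k(d-1/2)+1)(2k(d-1/2)+1)}{k!\,(2\Gamma(1-2d)\sin(d\pi))^k}\right)^{1/2}.$$ Then the processes $Z_d^{(k_1)},\dots,Z_d^{(k_J)}$ are dependent (i.e. they are not independent).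
   Context: A complex Hermitian Gaussian random measure $W$ on $\mathbb{R}$ with Lebesgue control measure satisfies $W(A)=\overline{W(-A)}$ and $\mathbb{E}W(A)\overline{W(B)}=|A\cap B|$. $I_m(K)=\int''_{\mathbb{R}^m}K(x_1,\dots,x_m)\,dW(x_1)\cdots dW(x_m)$ is the $m$-tuple Wiener–Itô integral for square-integrable $K$ with $K(-\mathbf{x})=\overline{K(\mathbf{x})}$, where $''$ means the hyper-diagonals $x_j=\pm x_k$, $j\neq k$, are excluded. *)

theory Defs
  imports "HOL-Probability.Probability"
begin

section \<open>Hermitian Gaussian random measures\<close>

text \<open>The degenerate law \<open>N(0,0)\<close> counts as Gaussian.\<close>

definition centered_gaussian :: "'a measure \<Rightarrow> ('a \<Rightarrow> real) \<Rightarrow> bool" where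
  "centered_gaussian M X \<longleftrightarrow>
     (\<exists>\<sigma>>0. distributed M lborel X (normal_density 0 \<sigma>)) \<or>
     (X \<in> borel_measurable M \<and> (AE \<omega> in M. X \<omega> = 0))"

text \<open>The control measure is Lebesgue measure; \<open>W A\<close> is only meaningful for Borel sets \<open>A\<close> of
  finite measure. Joint Gaussianity of the real and imaginary parts is expressed by real linear
  combinations: with complex \<open>c\<close>, the number \<open>Re (c * w)\<close> ranges over all real linear combinations
  of \<open>Re w\<close> and \<open>Im w\<close>.\<close>

definition fin_borel :: "real set set" where
  "fin_borel = {A \<in> sets borel. emeasure lborel A < \<infinity>}"

locale hermitian_gaussian_random_measure = prob_space M
  for M :: "'a measure" +
  fixes W :: "real set \<Rightarrow> 'a \<Rightarrow> complex"
  assumes W_measurable: "\<And>A. A \<in> fin_borel \<Longrightarrow> W A \<in> borel_measurable M"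
    and W_gaussian: "\<And>(n::nat) A c. (\<And>i. i < n \<Longrightarrow> A i \<in> fin_borel) \<Longrightarrow>
      centered_gaussian M (\<lambda>\<omega>. Re (\<Sum>i<n. c i * W (A i) \<omega>))"
    and W_additive: "\<And>A :: nat \<Rightarrow> real set.
      range A \<subseteq> fin_borel \<Longrightarrow> disjoint_family A \<Longrightarrow> (\<Union>i. A i) \<in> fin_borel \<Longrightarrow>
      AE \<omega> in M. (\<lambda>i. W (A i) \<omega>) sums W (\<Union>i. A i) \<omega>"
    and W_hermitian: "\<And>A. A \<in> fin_borel \<Longrightarrow> AE \<omega> in M. W A \<omega> = cnj (W (uminus ` A) \<omega>)"
    and W_covariance: "\<And>A B. A \<in> fin_borel \<Longrightarrow> B \<in> fin_borel \<Longrightarrow>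
      expectation (\<lambda>\<omega>. W A \<omega> * cnj (W B \<omega>)) = complex_of_real (measure lborel (A \<inter> B))"

section \<open>Multiple Wiener-Ito integrals\<close>

text \<open>Points of \<open>\<real>\<^sup>m\<close> are extensional functions on \<open>{..<m}\<close>.\<close>

abbreviation lborel_pow :: "nat \<Rightarrow> (nat \<Rightarrow> real) measure" where
  "lborel_pow m \<equiv> Pi\<^sub>M {..<m} (\<lambda>_. lborel)"

definition hermitian_L2_kernel :: "nat \<Rightarrow> ((nat \<Rightarrow> real) \<Rightarrow> complex) \<Rightarrow> bool" where
  "hermitian_L2_kernel m K \<longleftrightarrow>
     K \<in> borel_measurable (lborel_pow m) \<and>
     (\<integral>\<^sup>+ x. ennreal ((cmod (K x))\<^sup>2) \<partial>lborel_pow m) < \<infinity> \<and>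
     (\<forall>x \<in> space (lborel_pow m). K (\<lambda>p\<in>{..<m}. - x p) = cnj (K x))"

text \<open>Elementary kernels are built on a symmetric system of disjoint sets \<open>A j = - A (-j)\<close>, where
  \<open>j = \<plusminus>1, \<dots>, \<plusminus>N\<close>. They vanish on every block \<open>A (u 0) \<times> \<dots> \<times> A (u (m - 1))\<close> in which
  \<open>u p = \<plusminus> u q\<close> for some \<open>p \<noteq> q\<close>; this is the exclusion of the hyper-diagonals
  \<open>x\<^sub>p = \<plusminus> x\<^sub>q\<close>.\<close>

definition sym_idx :: "nat \<Rightarrow> int set" where
  "sym_idx N = {- int N..int N} - {0}"

definition symmetric_system :: "nat \<Rightarrow> (int \<Rightarrow> real set) \<Rightarrow> bool" where
  "symmetric_system N A \<longleftrightarrow>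
     (\<forall>j \<in> sym_idx N. A j \<in> fin_borel \<and> A (- j) = uminus ` A j) \<and>
     disjoint_family_on A (sym_idx N)"

definition offdiag :: "nat \<Rightarrow> nat \<Rightarrow> (nat \<Rightarrow> int) set" where
  "offdiag m N = {u \<in> {..<m} \<rightarrow>\<^sub>E sym_idx N.
     \<forall>p<m. \<forall>q<m. p \<noteq> q \<longrightarrow> u p \<noteq> u q \<and> u p \<noteq> - u q}"

definition hermitian_coeffs :: "nat \<Rightarrow> nat \<Rightarrow> ((nat \<Rightarrow> int) \<Rightarrow> complex) \<Rightarrow> bool" where
  "hermitian_coeffs m N c \<longleftrightarrow> (\<forall>u \<in> offdiag m N. c (\<lambda>p\<in>{..<m}. - u p) = cnj (c u))"

definition elementary_kernel ::
  "nat \<Rightarrow> nat \<Rightarrow> (int \<Rightarrow> real set) \<Rightarrow> ((nat \<Rightarrow> int) \<Rightarrow> complex) \<Rightarrow> (nat \<Rightarrow> real) \<Rightarrow> complex" where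
  "elementary_kernel m N A c x =
     (\<Sum>u\<in>offdiag m N. c u * (\<Prod>p<m. indicator (A (u p)) (x p)))"

definition elementary_integral ::
  "(real set \<Rightarrow> 'a \<Rightarrow> complex) \<Rightarrow> nat \<Rightarrow> nat \<Rightarrow> (int \<Rightarrow> real set) \<Rightarrow> ((nat \<Rightarrow> int) \<Rightarrow> complex) \<Rightarrow>
    'a \<Rightarrow> complex" where
  "elementary_integral W m N A c \<omega> =
     (\<Sum>u\<in>offdiag m N. c u * (\<Prod>p<m. W (A (u p)) \<omega>))"

text \<open>\<open>X\<close> is a version of \<open>I\<^sub>m(K)\<close>: the \<open>L\<^sup>2\<close> extension of the elementary integral. The
  integral is determined up to almost sure equality, hence a relation rather than a function.\<close>

definition has_wiener_ito_integral ::
  "'a measure \<Rightarrow> (real set \<Rightarrow> 'a \<Rightarrow> complex) \<Rightarrow> nat \<Rightarrow> ((nat \<Rightarrow> real) \<Rightarrow> complex) \<Rightarrow>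
    ('a \<Rightarrow> complex) \<Rightarrow> bool" where
  "has_wiener_ito_integral M W m K X \<longleftrightarrow>
     hermitian_L2_kernel m K \<and> X \<in> borel_measurable M \<and>
     (\<exists>N A c.
        (\<forall>n. symmetric_system (N n) (A n) \<and> hermitian_coeffs m (N n) (c n)) \<and>
        (\<lambda>n. \<integral>\<^sup>+ x. ennreal ((cmod (elementary_kernel m (N n) (A n) (c n) x - K x))\<^sup>2)
               \<partial>lborel_pow m) \<longlonglongrightarrow> 0 \<and>
        (\<lambda>n. \<integral>\<^sup>+ \<omega>. ennreal ((cmod (elementary_integral W m (N n) (A n) (c n) \<omega> - X \<omega>))\<^sup>2)
               \<partial>M) \<longlonglongrightarrow> 0)"

section \<open>Hermite processes\<close>

definition hermite_const :: "nat \<Rightarrow> real \<Rightarrow> real" where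
  "hermite_const k d =
     sqrt ((real k * (d - 1/2) + 1) * (2 * real k * (d - 1/2) + 1) /
           (fact k * (2 * Gamma (1 - 2 * d) * sin (d * pi)) ^ k))"

text \<open>The formula is only meaningful off the null set where \<open>x\<^sub>0 + \<dots> + x\<^sub>k\<^sub>-\<^sub>1 = 0\<close> or some
  \<open>x\<^sub>p = 0\<close>; there the conventions \<open>z / 0 = 0\<close> and \<open>0 powr a = 0\<close> make the kernel vanish.\<close>

definition hermite_kernel :: "nat \<Rightarrow> real \<Rightarrow> real \<Rightarrow> (nat \<Rightarrow> real) \<Rightarrow> complex" where
  "hermite_kernel k d t x =
     complex_of_real (hermite_const k d) *
     ((exp (\<i> * complex_of_real (t * (\<Sum>p<k. x p))) - 1) / (\<i> * complex_of_real (\<Sum>p<k. x p))) *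
     complex_of_real (\<Prod>p<k. \<bar>x p\<bar> powr (- d))"

definition hermite_process ::
  "'a measure \<Rightarrow> (real set \<Rightarrow> 'a \<Rightarrow> complex) \<Rightarrow> nat \<Rightarrow> real \<Rightarrow> (real \<Rightarrow> 'a \<Rightarrow> complex) \<Rightarrow> bool" where
  "hermite_process M W k d Z \<longleftrightarrow>
     (\<forall>t>0. has_wiener_ito_integral M W k (hermite_kernel k d t) (Z t))"

text \<open>Independence of processes indexed by \<open>t > 0\<close>, each seen as a single random element of the
  path space with the product \<open>\<sigma>\<close>-algebra.\<close>

definition independent_processes ::
  "'a measure \<Rightarrow> ('i \<Rightarrow> real \<Rightarrow> 'a \<Rightarrow> complex) \<Rightarrow> 'i set \<Rightarrow> bool" where
  "independent_processes M Z I \<longleftrightarrow>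
     prob_space.indep_vars M (\<lambda>_. Pi\<^sub>M {0<..} (\<lambda>_. borel)) (\<lambda>j \<omega>. \<lambda>t\<in>{0<..}. Z j t \<omega>) I"

end

theory Submission
  imports Defs "HOL-Computational_Algebra.Polynomial" "HOL-Combinatorics.Permutations"
begin

text \<open>
  Only \<open>F = Z 1 1\<close> and \<open>G = Z 2 1\<close> matter. Put \<open>p = k 1\<close>, \<open>q = k 2\<close>, let \<open>f\<close>, \<open>g\<close> be their kernels and
  \<open>T = f \<otimes> g\<close>. The projection of \<open>F G\<close> onto the chaos of order \<open>p + q\<close> is the multiple integral of
  the symmetrization of \<open>T\<close>, so the second moment of \<open>F G\<close> is at least the sum of the inner products
  \<open>(T \<circ> \<pi>, T)\<close> over all permutations \<open>\<pi>\<close> of the \<open>p + q\<close> variables. The permutations that preserve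
  the two blocks contribute exactly the product of the second moments of \<open>F\<close> and \<open>G\<close>. Every other
  inner product is the squared norm of a contraction of \<open>f\<close> with \<open>g\<close>, hence nonnegative, and it is
  positive for the transposition of two variables from different blocks, because the contraction over
  one variable is continuous and nonzero near the origin. Under independence the two second moments
  would agree.

  The projection is tested against integrals of explicit approximations of \<open>T\<close> that vanish near the
  hyper-diagonals. Passing to the limit in a product of approximants needs their fourth moments
  to be bounded; this follows from Wick's formula by pairing off variables and applying the
  Cauchy-Schwarz inequality.
\<close>

section \<open>Square-integrable functions\<close>

text \<open>The projection is never constructed. Test integrals \<open>X l\<close> with kernels
  tending to the tensor product have inner products with F G tending to Q, the sum over
  permutations, and second moments tending to Q as well, so Cauchy-Schwarz gives |Q|^2 \<le> E|F
  G|^2 * Re Q. The approximants of F and of G live on unrelated symmetric systems, so their product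
  need not be an elementary integral. No common refinement is needed: in the pairing formula both
  products have the same number of factors, so if no two factors of the test side can be paired with
  each other, every factor of the other side is used up as well. Only the test kernel has to avoid
  reflected coordinates. F G lies in L2 because independence factorizes its second moment, which
  replaces a hypercontractive estimate for the limits F and G. Fourth moments are bounded only for
  the approximants.\<close>

lemma borel_measurable_cnj[measurable (raw)]:
  "f \<in> borel_measurable \<mu> \<Longrightarrow> (\<lambda>x. cnj (f x)) \<in> borel_measurable \<mu>"
  using borel_measurable_continuous_on[OF continuous_on_cnj[OF continuous_on_id], of f \<mu>] by simp

text \<open>The squared norm with values in \<open>ennreal\<close> makes sense before square
  integrability is known; the real-valued \<open>nrm\<close> serves for limits and the triangle
  inequality.\<close>

definition sqn :: "'b measure \<Rightarrow> ('b \<Rightarrow> complex) \<Rightarrow> ennreal" where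
  "sqn \<mu> f = (\<integral>\<^sup>+ x. ennreal ((cmod (f x))\<^sup>2) \<partial>\<mu>)"

definition L2 :: "'b measure \<Rightarrow> ('b \<Rightarrow> complex) \<Rightarrow> bool" where
  "L2 \<mu> f \<longleftrightarrow> f \<in> borel_measurable \<mu> \<and> sqn \<mu> f < \<infinity>"

definition ip :: "'b measure \<Rightarrow> ('b \<Rightarrow> complex) \<Rightarrow> ('b \<Rightarrow> complex) \<Rightarrow> complex" where
  "ip \<mu> f g = (\<integral>x. f x * cnj (g x) \<partial>\<mu>)"

definition nrm :: "'b measure \<Rightarrow> ('b \<Rightarrow> complex) \<Rightarrow> real" where
  "nrm \<mu> f = sqrt (\<integral>x. (cmod (f x))\<^sup>2 \<partial>\<mu>)"

definition L2conv :: "'b measure \<Rightarrow> (nat \<Rightarrow> 'b \<Rightarrow> complex) \<Rightarrow> ('b \<Rightarrow> complex) \<Rightarrow> bool" where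
  "L2conv \<mu> F f \<longleftrightarrow> (\<forall>n. L2 \<mu> (F n)) \<and> L2 \<mu> f \<and> (\<lambda>n. nrm \<mu> (\<lambda>x. F n x - f x)) \<longlonglongrightarrow> 0"

lemma L2_iff: "L2 \<mu> f \<longleftrightarrow> f \<in> borel_measurable \<mu> \<and> integrable \<mu> (\<lambda>x. (cmod (f x))\<^sup>2)"
  by (auto simp: L2_def sqn_def integrable_iff_bounded)

lemma L2_measurable[measurable_dest]: "L2 \<mu> f \<Longrightarrow> f \<in> borel_measurable \<mu>"
  by (simp add: L2_def)

lemma sqn_eq_nrm: "L2 \<mu> f \<Longrightarrow> sqn \<mu> f = ennreal ((nrm \<mu> f)\<^sup>2)"
  unfolding sqn_def nrm_def L2_iff by (subst nn_integral_eq_integral) auto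

lemma nrm_nonneg[simp]: "0 \<le> nrm \<mu> f"
  by (simp add: nrm_def)

lemma nrm_power2: "(nrm \<mu> f)\<^sup>2 = (\<integral>x. (cmod (f x))\<^sup>2 \<partial>\<mu>)"
  by (simp add: nrm_def)

lemma ip_self: "ip \<mu> f f = complex_of_real ((nrm \<mu> f)\<^sup>2)"
  unfolding ip_def nrm_power2 by (simp add: complex_norm_square[symmetric] flip: of_real_power)

lemma L2_prod_integrable:
  assumes f: "L2 \<mu> f" and g: "L2 \<mu> g"
  shows "integrable \<mu> (\<lambda>x. f x * g x)" "integrable \<mu> (\<lambda>x. f x * cnj (g x))"
    "integrable \<mu> (\<lambda>x. cmod (f x) * cmod (g x))"
proof -
  have [measurable]: "f \<in> borel_measurable \<mu>" "g \<in> borel_measurable \<mu>"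
    using f g by (auto simp: L2_def)
  have i: "integrable \<mu> (\<lambda>x. (cmod (f x))\<^sup>2 + (cmod (g x))\<^sup>2)"
    using f g by (auto simp: L2_iff)
  have b: "cmod (f x) * cmod (g x) \<le> (cmod (f x))\<^sup>2 + (cmod (g x))\<^sup>2" for x
  proof -
    have "0 \<le> cmod (f x) * cmod (g x)" by simp
    then show ?thesis using sum_squares_bound[of "cmod (f x)" "cmod (g x)"] by linarith
  qed
  show "integrable \<mu> (\<lambda>x. f x * g x)"
    by (rule Bochner_Integration.integrable_bound[OF i]) (use b in \<open>auto simp: norm_mult\<close>)
  show "integrable \<mu> (\<lambda>x. f x * cnj (g x))"
    by (rule Bochner_Integration.integrable_bound[OF i]) (use b in \<open>auto simp: norm_mult\<close>)
  show "integrable \<mu> (\<lambda>x. cmod (f x) * cmod (g x))"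
    by (rule Bochner_Integration.integrable_bound[OF i]) (use b in \<open>auto simp: norm_mult\<close>)
qed

text \<open>Optimizing over the scaling \<open>s\<close> turns the elementary bound 2xy \<le> s x^2
  + y^2 / s, integrated, into the Cauchy-Schwarz inequality.\<close>

lemma real_opt_bound:
  fixes I a b :: real
  assumes "\<And>s. s > 0 \<Longrightarrow> 2 * I \<le> s * a\<^sup>2 + b\<^sup>2 / s" and a: "a \<ge> 0" and b: "b \<ge> 0"
  shows "I \<le> a * b"
proof (rule field_le_epsilon)
  fix e :: real assume e: "e > 0"
  have "((\<lambda>\<delta>. (a + \<delta>) * (b + \<delta>)) \<longlongrightarrow> (a + 0) * (b + 0)) (at_right 0)"
    by (intro tendsto_intros)
  then have "\<forall>\<^sub>F \<delta> in at_right 0. (a + \<delta>) * (b + \<delta>) < a * b + e"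
    using e by (intro order_tendstoD(2)[where a = "a * b + e"]) auto
  moreover have "\<forall>\<^sub>F \<delta> in at_right (0::real). \<delta> > 0"
    by (rule eventually_at_right_less)
  ultimately have "\<forall>\<^sub>F \<delta> in at_right 0. \<delta> > 0 \<and> (a + \<delta>) * (b + \<delta>) < a * b + e"
    by (simp add: eventually_conj_iff)
  then obtain \<delta> where d: "\<delta> > 0" "(a + \<delta>) * (b + \<delta>) < a * b + e"
    using eventually_happens'[OF trivial_limit_at_right_real] by blast
  \<comment> \<open>The minimizer for \<open>a + \<delta>\<close> and \<open>b + \<delta>\<close>.
    The shift by \<delta> keeps it positive and finite when a or b is zero.\<close>
  define s where "s = (b + \<delta>) / (a + \<delta>)"
  have s: "s > 0" using a b d by (simp add: s_def)
  have "2 * I \<le> s * a\<^sup>2 + b\<^sup>2 / s" by (rule assms(1)[OF s])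
  also have "\<dots> \<le> s * (a + \<delta>)\<^sup>2 + (b + \<delta>)\<^sup>2 / s"
    using s a b d by (intro add_mono mult_left_mono divide_right_mono power_mono) auto
  also have "\<dots> = 2 * ((a + \<delta>) * (b + \<delta>))"
  proof -
    have nz: "a + \<delta> \<noteq> 0" "b + \<delta> \<noteq> 0" using a b d by auto
    have "s * (a + \<delta>)\<^sup>2 = (a + \<delta>) * (b + \<delta>)"
      using nz(1) by (simp add: s_def power2_eq_square)
    moreover have "(b + \<delta>)\<^sup>2 / s = (a + \<delta>) * (b + \<delta>)"
      using nz(2) by (simp add: s_def power2_eq_square)
    ultimately show ?thesis by linarith
  qed
  finally show "I \<le> a * b + e" using d by linarith
qed

lemma L2_Cauchy_Schwarz_abs:
  assumes f: "L2 \<mu> f" and g: "L2 \<mu> g"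
  shows "(\<integral>x. cmod (f x) * cmod (g x) \<partial>\<mu>) \<le> nrm \<mu> f * nrm \<mu> g"
proof (rule real_opt_bound)
  fix s :: real assume s: "s > 0"
  have i: "integrable \<mu> (\<lambda>x. (cmod (f x))\<^sup>2)" "integrable \<mu> (\<lambda>x. (cmod (g x))\<^sup>2)"
    using f g by (auto simp: L2_iff)
  have *: "2 * (cmod (f x) * cmod (g x)) \<le> s * (cmod (f x))\<^sup>2 + (cmod (g x))\<^sup>2 / s" for x
  proof -
    have "0 \<le> (s * cmod (f x) - cmod (g x))\<^sup>2 / s" using s by simp
    also have "\<dots> = s * (cmod (f x))\<^sup>2 + (cmod (g x))\<^sup>2 / s - 2 * (cmod (f x) * cmod (g x))"
      using s by (simp add: power2_eq_square field_simps)
    finally show ?thesis by simp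
  qed
  have "2 * (\<integral>x. cmod (f x) * cmod (g x) \<partial>\<mu>) = (\<integral>x. 2 * (cmod (f x) * cmod (g x)) \<partial>\<mu>)"
    by simp
  also have "\<dots> \<le> (\<integral>x. s * (cmod (f x))\<^sup>2 + (cmod (g x))\<^sup>2 / s \<partial>\<mu>)"
    using L2_prod_integrable(3)[OF f g] i * by (intro integral_mono) auto
  also have "\<dots> = s * (nrm \<mu> f)\<^sup>2 + (nrm \<mu> g)\<^sup>2 / s"
    using i by (simp add: nrm_power2)
  finally show "2 * (\<integral>x. cmod (f x) * cmod (g x) \<partial>\<mu>) \<le> s * (nrm \<mu> f)\<^sup>2 + (nrm \<mu> g)\<^sup>2 / s" .
qed auto

lemma L2_Cauchy_Schwarz:
  assumes f: "L2 \<mu> f" and g: "L2 \<mu> g"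
  shows "cmod (ip \<mu> f g) \<le> nrm \<mu> f * nrm \<mu> g"
proof -
  have "cmod (ip \<mu> f g) \<le> (\<integral>x. cmod (f x * cnj (g x)) \<partial>\<mu>)"
    unfolding ip_def by (rule integral_norm_bound)
  also have "\<dots> = (\<integral>x. cmod (f x) * cmod (g x) \<partial>\<mu>)"
    by (simp add: norm_mult)
  finally show ?thesis using L2_Cauchy_Schwarz_abs[OF f g] by linarith
qed

lemma L2_add:
  assumes f: "L2 \<mu> f" and g: "L2 \<mu> g"
  shows "L2 \<mu> (\<lambda>x. f x + g x)"
proof -
  have [measurable]: "f \<in> borel_measurable \<mu>" "g \<in> borel_measurable \<mu>"
    using f g by (auto simp: L2_def)
  have i: "integrable \<mu> (\<lambda>x. 2 * (cmod (f x))\<^sup>2 + 2 * (cmod (g x))\<^sup>2)"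
    using f g by (auto simp: L2_iff)
  have "(cmod (f x + g x))\<^sup>2 \<le> 2 * (cmod (f x))\<^sup>2 + 2 * (cmod (g x))\<^sup>2" for x
  proof -
    have "(cmod (f x + g x))\<^sup>2 \<le> (cmod (f x) + cmod (g x))\<^sup>2"
      by (intro power_mono norm_triangle_ineq) auto
    also have "\<dots> \<le> 2 * (cmod (f x))\<^sup>2 + 2 * (cmod (g x))\<^sup>2"
      using sum_squares_bound[of "cmod (f x)" "cmod (g x)"] by (simp add: power2_sum)
    finally show ?thesis .
  qed
  then show ?thesis
    unfolding L2_iff by (intro conjI Bochner_Integration.integrable_bound[OF i]) auto
qed

lemma L2_cmult: "L2 \<mu> f \<Longrightarrow> L2 \<mu> (\<lambda>x. c * f x)"
  by (auto simp: L2_iff norm_mult power_mult_distrib)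

lemma L2_diff: "L2 \<mu> f \<Longrightarrow> L2 \<mu> g \<Longrightarrow> L2 \<mu> (\<lambda>x. f x - g x)"
  using L2_add[of \<mu> f "\<lambda>x. - 1 * g x"] L2_cmult[of \<mu> g "-1"] by simp

lemma L2_sum: "finite I \<Longrightarrow> (\<And>i. i \<in> I \<Longrightarrow> L2 \<mu> (f i)) \<Longrightarrow> L2 \<mu> (\<lambda>x. \<Sum>i\<in>I. f i x)"
  by (induction I rule: finite_induct) (auto intro!: L2_add simp: L2_iff[of _ "\<lambda>x. 0"])

lemma nrm_triangle:
  assumes f: "L2 \<mu> f" and g: "L2 \<mu> g"
  shows "nrm \<mu> (\<lambda>x. f x + g x) \<le> nrm \<mu> f + nrm \<mu> g"
proof (rule power2_le_imp_le)
  have i: "integrable \<mu> (\<lambda>x. (cmod (f x))\<^sup>2)" "integrable \<mu> (\<lambda>x. (cmod (g x))\<^sup>2)"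
    "integrable \<mu> (\<lambda>x. (cmod (f x + g x))\<^sup>2)"
    using f g L2_add[OF f g] by (auto simp: L2_iff)
  have "(nrm \<mu> (\<lambda>x. f x + g x))\<^sup>2 = (\<integral>x. (cmod (f x + g x))\<^sup>2 \<partial>\<mu>)" by (rule nrm_power2)
  also have "\<dots> \<le> (\<integral>x. (cmod (f x))\<^sup>2 + 2 * (cmod (f x) * cmod (g x)) + (cmod (g x))\<^sup>2 \<partial>\<mu>)"
  proof (intro integral_mono)
    fix x
    have "(cmod (f x + g x))\<^sup>2 \<le> (cmod (f x) + cmod (g x))\<^sup>2"
      by (intro power_mono norm_triangle_ineq) auto
    then show "(cmod (f x + g x))\<^sup>2 \<le> (cmod (f x))\<^sup>2 + 2 * (cmod (f x) * cmod (g x)) + (cmod (g x))\<^sup>2"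
      by (simp add: power2_sum)
  qed (use i L2_prod_integrable(3)[OF f g] in auto)
  also have "\<dots> = (nrm \<mu> f)\<^sup>2 + 2 * (\<integral>x. cmod (f x) * cmod (g x) \<partial>\<mu>) + (nrm \<mu> g)\<^sup>2"
    using i L2_prod_integrable(3)[OF f g] by (simp add: nrm_power2)
  also have "\<dots> \<le> (nrm \<mu> f + nrm \<mu> g)\<^sup>2"
    using L2_Cauchy_Schwarz_abs[OF f g] by (simp add: power2_sum)
  finally show "(nrm \<mu> (\<lambda>x. f x + g x))\<^sup>2 \<le> (nrm \<mu> f + nrm \<mu> g)\<^sup>2" .
qed simp

lemma ip_diff_left:
  "L2 \<mu> f \<Longrightarrow> L2 \<mu> f' \<Longrightarrow> L2 \<mu> g \<Longrightarrow> ip \<mu> (\<lambda>x. f x - f' x) g = ip \<mu> f g - ip \<mu> f' g"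
  unfolding ip_def left_diff_distrib by (intro Bochner_Integration.integral_diff L2_prod_integrable)

lemma ip_diff_right:
  "L2 \<mu> f \<Longrightarrow> L2 \<mu> g' \<Longrightarrow> L2 \<mu> g \<Longrightarrow> ip \<mu> f (\<lambda>x. g x - g' x) = ip \<mu> f g - ip \<mu> f g'"
  unfolding ip_def complex_cnj_diff right_diff_distrib
  by (intro Bochner_Integration.integral_diff L2_prod_integrable)

lemma L2conv_nrm_bound:
  assumes "L2conv \<mu> F f"
  shows "nrm \<mu> (F n) \<le> nrm \<mu> (\<lambda>x. F n x - f x) + nrm \<mu> f"
  using nrm_triangle[of \<mu> "\<lambda>x. F n x - f x" f] assms
  by (auto simp: L2conv_def intro: L2_diff)

lemma L2conv_ip:
  assumes F: "L2conv \<mu> F f" and G: "L2conv \<mu> G g"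
  shows "(\<lambda>n. ip \<mu> (F n) (G n)) \<longlonglongrightarrow> ip \<mu> f g"
proof (rule Lim_transform2[OF tendsto_const])
  have L: "\<And>n. L2 \<mu> (F n)" "L2 \<mu> f" "\<And>n. L2 \<mu> (G n)" "L2 \<mu> g"
    using F G by (auto simp: L2conv_def)
  have c: "(\<lambda>n. nrm \<mu> (\<lambda>x. F n x - f x)) \<longlonglongrightarrow> 0" "(\<lambda>n. nrm \<mu> (\<lambda>x. G n x - g x)) \<longlonglongrightarrow> 0"
    using F G by (auto simp: L2conv_def)
  have "(\<lambda>n. nrm \<mu> (\<lambda>x. F n x - f x) * (nrm \<mu> (\<lambda>x. G n x - g x) + nrm \<mu> g)
           + nrm \<mu> f * nrm \<mu> (\<lambda>x. G n x - g x)) \<longlonglongrightarrow> 0 * (0 + nrm \<mu> g) + nrm \<mu> f * 0"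
    by (intro tendsto_intros c)
  then have lim: "(\<lambda>n. nrm \<mu> (\<lambda>x. F n x - f x) * (nrm \<mu> (\<lambda>x. G n x - g x) + nrm \<mu> g)
           + nrm \<mu> f * nrm \<mu> (\<lambda>x. G n x - g x)) \<longlonglongrightarrow> 0" by simp
  show "(\<lambda>n. ip \<mu> f g - ip \<mu> (F n) (G n)) \<longlonglongrightarrow> 0"
  proof (rule Lim_null_comparison[OF _ lim], rule always_eventually, rule allI)
    fix n
    have "ip \<mu> (F n) (G n) - ip \<mu> f g
        = ip \<mu> (\<lambda>x. F n x - f x) (G n) + ip \<mu> f (\<lambda>x. G n x - g x)"
      using L by (simp add: ip_diff_left ip_diff_right)
    then have "cmod (ip \<mu> f g - ip \<mu> (F n) (G n))
       \<le> cmod (ip \<mu> (\<lambda>x. F n x - f x) (G n)) + cmod (ip \<mu> f (\<lambda>x. G n x - g x))"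
      by (metis norm_minus_commute norm_triangle_ineq)
    also have "\<dots> \<le> nrm \<mu> (\<lambda>x. F n x - f x) * nrm \<mu> (G n) + nrm \<mu> f * nrm \<mu> (\<lambda>x. G n x - g x)"
      by (intro add_mono L2_Cauchy_Schwarz L2_diff L)
    also have "\<dots> \<le> nrm \<mu> (\<lambda>x. F n x - f x) * (nrm \<mu> (\<lambda>x. G n x - g x) + nrm \<mu> g)
           + nrm \<mu> f * nrm \<mu> (\<lambda>x. G n x - g x)"
      by (intro add_mono mult_left_mono L2conv_nrm_bound G) auto
    finally show "cmod (ip \<mu> f g - ip \<mu> (F n) (G n)) \<le> \<dots>" .
  qed
qed

lemma L2conv_const: "L2 \<mu> f \<Longrightarrow> L2conv \<mu> (\<lambda>_. f) f"
  by (simp add: L2conv_def nrm_def)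

lemma L2conv_nrm:
  assumes F: "L2conv \<mu> F f"
  shows "(\<lambda>n. nrm \<mu> (F n)) \<longlonglongrightarrow> nrm \<mu> f"
proof -
  have "(\<lambda>n. sqrt (Re (ip \<mu> (F n) (F n)))) \<longlonglongrightarrow> sqrt (Re (ip \<mu> f f))"
    by (intro tendsto_real_sqrt tendsto_Re L2conv_ip[OF F F])
  then show ?thesis by (simp add: ip_self)
qed

lemma L2convI_sqn:
  assumes L: "\<And>n. L2 \<mu> (F n)" "L2 \<mu> f" and c: "(\<lambda>n. sqn \<mu> (\<lambda>x. F n x - f x)) \<longlonglongrightarrow> 0"
  shows "L2conv \<mu> F f"
proof -
  have "(\<lambda>n. ennreal ((nrm \<mu> (\<lambda>x. F n x - f x))\<^sup>2)) \<longlonglongrightarrow> ennreal 0"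
    using c by (simp add: sqn_eq_nrm L2_diff L)
  then have "(\<lambda>n. (nrm \<mu> (\<lambda>x. F n x - f x))\<^sup>2) \<longlonglongrightarrow> 0"
    by (subst (asm) tendsto_ennreal_iff) auto
  then have "(\<lambda>n. sqrt ((nrm \<mu> (\<lambda>x. F n x - f x))\<^sup>2)) \<longlonglongrightarrow> sqrt 0"
    by (rule tendsto_real_sqrt)
  then show ?thesis using L by (simp add: L2conv_def)
qed

section \<open>Variables with moments of all orders\<close>

definition allmom :: "'b measure \<Rightarrow> ('b \<Rightarrow> complex) \<Rightarrow> bool" where
  "allmom \<mu> X \<longleftrightarrow> X \<in> borel_measurable \<mu> \<and> (\<forall>n. integrable \<mu> (\<lambda>x. cmod (X x) ^ n))"

lemma allmom_measurable[measurable_dest]: "allmom \<mu> X \<Longrightarrow> X \<in> borel_measurable \<mu>"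
  by (simp add: allmom_def)

text \<open>Closure under products, which square integrability lacks, makes every polynomial in
  values of the random measure integrable without further estimates.\<close>

lemma allmom_mult:
  assumes X: "allmom \<mu> X" and Y: "allmom \<mu> Y"
  shows "allmom \<mu> (\<lambda>x. X x * Y x)"
  unfolding allmom_def
proof (intro conjI allI)
  have [measurable]: "X \<in> borel_measurable \<mu>" "Y \<in> borel_measurable \<mu>"
    using X Y by (auto simp: allmom_def)
  show "(\<lambda>x. X x * Y x) \<in> borel_measurable \<mu>" by measurable
  fix n
  have i: "integrable \<mu> (\<lambda>x. cmod (X x) ^ (2*n) + cmod (Y x) ^ (2*n))"
    using X Y by (auto simp: allmom_def)
  show "integrable \<mu> (\<lambda>x. cmod (X x * Y x) ^ n)"
  proof (rule Bochner_Integration.integrable_bound[OF i])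
    have "cmod (X x * Y x) ^ n \<le> cmod (X x) ^ (2*n) + cmod (Y x) ^ (2*n)" for x
    proof -
      have "cmod (X x * Y x) ^ n = cmod (X x) ^ n * cmod (Y x) ^ n"
        by (simp add: norm_mult power_mult_distrib)
      moreover have "0 \<le> cmod (X x) ^ n * cmod (Y x) ^ n" by simp
      ultimately show ?thesis
        using sum_squares_bound[of "cmod (X x)^n" "cmod (Y x)^n"]
        unfolding power_mult[symmetric] mult.commute[of n 2] by linarith
    qed
    then show "AE x in \<mu>. norm (cmod (X x * Y x) ^ n) \<le> norm (cmod (X x) ^ (2*n) + cmod (Y x) ^ (2*n))"
      by auto
  qed measurable
qed

lemma allmom_add:
  assumes X: "allmom \<mu> X" and Y: "allmom \<mu> Y"
  shows "allmom \<mu> (\<lambda>x. X x + Y x)"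
  unfolding allmom_def
proof (intro conjI allI)
  have [measurable]: "X \<in> borel_measurable \<mu>" "Y \<in> borel_measurable \<mu>"
    using X Y by (auto simp: allmom_def)
  show "(\<lambda>x. X x + Y x) \<in> borel_measurable \<mu>" by measurable
  fix n
  have i: "integrable \<mu> (\<lambda>x. 2^n * (cmod (X x) ^ n + cmod (Y x) ^ n))"
    using X Y by (auto simp: allmom_def)
  show "integrable \<mu> (\<lambda>x. cmod (X x + Y x) ^ n)"
  proof (rule Bochner_Integration.integrable_bound[OF i])
    have "cmod (X x + Y x) ^ n \<le> 2^n * (cmod (X x) ^ n + cmod (Y x) ^ n)" for x
    proof -
      have "cmod (X x + Y x) \<le> 2 * max (cmod (X x)) (cmod (Y x))"
        using norm_triangle_ineq[of "X x" "Y x"] by linarith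
      then have "cmod (X x + Y x) ^ n \<le> (2 * max (cmod (X x)) (cmod (Y x))) ^ n"
        by (intro power_mono) auto
      also have "\<dots> = 2^n * (max (cmod (X x)) (cmod (Y x))) ^ n" by (simp add: power_mult_distrib)
      also have "\<dots> \<le> 2^n * (cmod (X x) ^ n + cmod (Y x) ^ n)"
        by (intro mult_left_mono) (auto simp: max_def)
      finally show ?thesis .
    qed
    then show "AE x in \<mu>. norm (cmod (X x + Y x) ^ n) \<le> norm (2^n * (cmod (X x) ^ n + cmod (Y x) ^ n))"
      by auto
  qed measurable
qed

lemma allmom_cnj: "allmom \<mu> X \<Longrightarrow> allmom \<mu> (\<lambda>x. cnj (X x))"
  by (auto simp: allmom_def)

lemma (in finite_measure) allmom_const: "allmom M (\<lambda>_. c)"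
  by (auto simp: allmom_def)

lemma (in finite_measure) allmom_cmult: "allmom M X \<Longrightarrow> allmom M (\<lambda>x. c * X x)"
  using allmom_mult[OF allmom_const] .

lemma (in finite_measure) allmom_sum:
  "(\<And>i. i \<in> I \<Longrightarrow> allmom M (X i)) \<Longrightarrow> allmom M (\<lambda>x. \<Sum>i\<in>I. X i x)"
  by (induction I rule: infinite_finite_induct) (auto intro: allmom_add allmom_const)

lemma (in finite_measure) allmom_prod:
  "(\<And>i. i \<in> I \<Longrightarrow> allmom M (X i)) \<Longrightarrow> allmom M (\<lambda>x. \<Prod>i\<in>I. X i x)"
  by (induction I rule: infinite_finite_induct) (auto intro: allmom_mult allmom_const)

lemma (in finite_measure) allmom_power: "allmom M X \<Longrightarrow> allmom M (\<lambda>x. X x ^ n)"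
  by (induction n) (auto intro: allmom_mult allmom_const)

lemma allmom_integrable:
  assumes "allmom \<mu> X"
  shows "integrable \<mu> X"
proof -
  have "integrable \<mu> (\<lambda>x. cmod (X x) ^ 1)" "X \<in> borel_measurable \<mu>"
    using assms unfolding allmom_def by blast+
  then show ?thesis by (simp add: integrable_norm_iff)
qed

lemma allmom_L2: "allmom \<mu> X \<Longrightarrow> L2 \<mu> X"
  by (auto simp: allmom_def L2_iff)

section \<open>Gaussian moments and Wick's formula\<close>

text \<open>The moments of the standard normal law: (n - 1)!! for even n and 0 for odd n.\<close>

definition normal_moment_coeff :: "nat \<Rightarrow> real" where
  "normal_moment_coeff n = (if even n then fact n / (2 ^ (n div 2) * fact (n div 2)) else 0)"

lemma normal_moment_coeff_Suc_Suc: "normal_moment_coeff (Suc (Suc n)) = real (Suc n) * normal_moment_coeff n"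
proof (cases "even n")
  case True
  then obtain m where n: "n = 2 * m" by auto
  have "fact (2 * m + 2) = (real (2*m+2)) * (real (2*m+1)) * (fact (2 * m) :: real)"
    by simp
  then show ?thesis
    by (simp add: normal_moment_coeff_def n divide_simps) 
next
  case False
  then show ?thesis by (simp add: normal_moment_coeff_def)
qed

lemma (in prob_space) centered_gaussian_moments:
  assumes "centered_gaussian M X"
  shows "X \<in> borel_measurable M" "\<And>n. integrable M (\<lambda>\<omega>. \<bar>X \<omega>\<bar> ^ n)"
    "\<And>n. expectation (\<lambda>\<omega>. X \<omega> ^ n) = normal_moment_coeff n * expectation (\<lambda>\<omega>. (X \<omega>)\<^sup>2) ^ (n div 2)"
proof -
  have "X \<in> borel_measurable M \<and> (\<forall>n. integrable M (\<lambda>\<omega>. \<bar>X \<omega>\<bar> ^ n)) \<and>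
    (\<forall>n. expectation (\<lambda>\<omega>. X \<omega> ^ n) = normal_moment_coeff n * expectation (\<lambda>\<omega>. (X \<omega>)\<^sup>2) ^ (n div 2))"
    using assms unfolding centered_gaussian_def
  proof
    assume "\<exists>\<sigma>>0. distributed M lborel X (normal_density 0 \<sigma>)"
    then obtain \<sigma> where s: "\<sigma> > 0" and d: "distributed M lborel X (normal_density 0 \<sigma>)" by auto
    have e: "expectation (\<lambda>\<omega>. X \<omega> ^ n) = (\<integral>x. normal_density 0 \<sigma> x * x ^ n \<partial>lborel)" for n
      by (rule distributed_integral[OF d, symmetric]) auto
    have even: "expectation (\<lambda>\<omega>. X \<omega> ^ (2 * k)) = fact (2 * k) / (2^k * fact k) * \<sigma> ^ (2 * k)" for k
    proof -
      have "(2 / \<sigma>\<^sup>2) ^ k = 2 ^ k / \<sigma> ^ (2 * k)"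
        by (simp add: power_divide power_mult)
      then show ?thesis
        using e[of "2*k"] integral_normal_moment_even[OF s, of 0 k] by simp
    qed
    have two: "expectation (\<lambda>\<omega>. (X \<omega>)\<^sup>2) = \<sigma>\<^sup>2"
      using even[of 1] by simp
    have odd: "expectation (\<lambda>\<omega>. X \<omega> ^ (2 * k + 1)) = 0" for k
      using e[of "2*k+1"] integral_normal_moment_odd[OF s, of 0 k] by simp
    show ?thesis
    proof (intro conjI allI)
      show "X \<in> borel_measurable M" using distributed_measurable[OF d] by simp
      fix n
      have "integrable lborel (\<lambda>x. normal_density 0 \<sigma> x * \<bar>x\<bar> ^ n)"
        using integrable_normal_moment_abs[OF s, of 0 n] by simp
      then show "integrable M (\<lambda>\<omega>. \<bar>X \<omega>\<bar> ^ n)"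
        by (subst (asm) distributed_integrable[OF d]) auto
      show "expectation (\<lambda>\<omega>. X \<omega> ^ n) = normal_moment_coeff n * expectation (\<lambda>\<omega>. (X \<omega>)\<^sup>2) ^ (n div 2)"
      proof (cases "even n")
        case True
        then obtain k where n: "n = 2 * k" by auto
        show ?thesis unfolding n even two normal_moment_coeff_def by (simp add: power_mult)
      next
        case False
        then obtain k where n: "n = 2 * k + 1" by (auto elim: oddE)
        show ?thesis unfolding n odd normal_moment_coeff_def by simp
      qed
    qed
  next
    assume X: "X \<in> borel_measurable M \<and> (AE \<omega> in M. X \<omega> = 0)"
    then have [measurable]: "X \<in> borel_measurable M" by simp
    have e: "expectation (\<lambda>\<omega>. X \<omega> ^ n) = (if n = 0 then 1 else 0)" for n
    proof -
      have "expectation (\<lambda>\<omega>. X \<omega> ^ n) = expectation (\<lambda>\<omega>. 0 ^ n)"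
        using X by (intro integral_cong_AE) auto
      then show ?thesis by (simp add: power_0_left prob_space)
    qed
    show ?thesis
    proof (intro conjI allI)
      fix n
      have "integrable M (\<lambda>\<omega>. 0 ^ n :: real)" by simp
      then show "integrable M (\<lambda>\<omega>. \<bar>X \<omega>\<bar> ^ n)"
        by (rule integrable_cong_AE_imp) (use X in auto)
      \<comment> \<open>The degenerate law satisfies the same formula: for n = 1 the coefficient
        vanishes, and for n at least 2 a positive power of the zero variance occurs.\<close>
      have "n = 0 \<or> n = 1 \<or> n div 2 \<noteq> 0" by auto
      then show "expectation (\<lambda>\<omega>. X \<omega> ^ n) = normal_moment_coeff n * expectation (\<lambda>\<omega>. (X \<omega>)\<^sup>2) ^ (n div 2)"
        unfolding e by (auto simp: normal_moment_coeff_def)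
    qed simp
  qed
  then show "X \<in> borel_measurable M" "\<And>n. integrable M (\<lambda>\<omega>. \<bar>X \<omega>\<bar> ^ n)"
    "\<And>n. expectation (\<lambda>\<omega>. X \<omega> ^ n) = normal_moment_coeff n * expectation (\<lambda>\<omega>. (X \<omega>)\<^sup>2) ^ (n div 2)"
    by blast+
qed

text \<open>Joint Gaussianity of real and imaginary part, without circular symmetry: the
  pseudo-variance E Z^2 need not vanish, and it is this quantity, not E |Z|^2, that governs the
  moments E Z^n.\<close>

definition gauss_cx :: "'a measure \<Rightarrow> ('a \<Rightarrow> complex) \<Rightarrow> bool" where
  "gauss_cx M Z \<longleftrightarrow> (\<forall>w. centered_gaussian M (\<lambda>\<omega>. Re (w * Z \<omega>)))"

lemma poly_eq_if_real:
  fixes p q :: "complex poly"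
  assumes "\<And>t::real. poly p (of_real t) = poly q (of_real t)"
  shows "p = q"
proof (rule ccontr)
  assume "p \<noteq> q"
  then have "finite {x. poly (p - q) x = 0}"
    by (intro poly_roots_finite) simp
  moreover have "range complex_of_real \<subseteq> {x. poly (p - q) x = 0}"
    using assms by auto
  ultimately have "finite (range complex_of_real)"
    by (rule finite_subset[rotated])
  then have "finite (UNIV :: real set)"
    by (rule finite_imageD) (auto intro: inj_onI)
  then show False by (simp add: infinite_UNIV_char_0)
qed

text \<open>E (X + s Y)^n as a formal polynomial in s, so that identities known for real s extend to
  complex s and can be compared coefficientwise.\<close>

definition mom_poly :: "'a measure \<Rightarrow> ('a \<Rightarrow> complex) \<Rightarrow> ('a \<Rightarrow> complex) \<Rightarrow> nat \<Rightarrow> complex poly" where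
  "mom_poly M X Y n =
     (\<Sum>j\<le>n. monom (of_nat (n choose j) * (\<integral>\<omega>. Y \<omega> ^ j * X \<omega> ^ (n - j) \<partial>M)) j)"

lemma (in finite_measure) poly_mom_poly:
  assumes X: "allmom M X" and Y: "allmom M Y"
  shows "poly (mom_poly M X Y n) s = (\<integral>\<omega>. (X \<omega> + s * Y \<omega>) ^ n \<partial>M)"
proof -
  have i: "integrable M (\<lambda>\<omega>. Y \<omega> ^ j * X \<omega> ^ k)" for j k
    by (intro allmom_integrable allmom_mult allmom_power X Y)
  have "(\<integral>\<omega>. (X \<omega> + s * Y \<omega>) ^ n \<partial>M)
      = (\<integral>\<omega>. (\<Sum>j\<le>n. (of_nat (n choose j) * s ^ j) * (Y \<omega> ^ j * X \<omega> ^ (n - j))) \<partial>M)"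
    by (subst add.commute, subst binomial_ring) (simp add: power_mult_distrib mult_ac)
  also have "\<dots> = (\<Sum>j\<le>n. (of_nat (n choose j) * s ^ j) * (\<integral>\<omega>. Y \<omega> ^ j * X \<omega> ^ (n - j) \<partial>M))"
    by (subst Bochner_Integration.integral_sum) (auto intro: i)
  finally show ?thesis
    by (simp add: mom_poly_def poly_sum poly_monom mult_ac)
qed

lemma coeff_mom_poly:
  "coeff (mom_poly M X Y n) k =
    (if k \<le> n then of_nat (n choose k) * (\<integral>\<omega>. Y \<omega> ^ k * X \<omega> ^ (n - k) \<partial>M) else 0)"
  by (simp add: mom_poly_def coeff_sum sum.delta)

section \<open>Moments of complex Gaussian variables\<close>

context prob_space begin

lemma gauss_cx_allmom:
  assumes "gauss_cx M Z"
  shows "allmom M (\<lambda>\<omega>. of_real (Re (w * Z \<omega>)))" "allmom M Z"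
proof -
  have *: "allmom M (\<lambda>\<omega>. of_real (Re (w * Z \<omega>)))" for w
  proof -
    have "centered_gaussian M (\<lambda>\<omega>. Re (w * Z \<omega>))"
      using assms unfolding gauss_cx_def by blast
    note centered_gaussian_moments(1,2)[OF this]
    then show ?thesis
      unfolding allmom_def norm_of_real
      by (intro conjI allI measurable_compose[OF _ borel_measurable_continuous_onI[OF continuous_on_of_real_id]])
  qed
  show "allmom M (\<lambda>\<omega>. of_real (Re (w * Z \<omega>)))" by (rule *)
  have "allmom M (\<lambda>\<omega>. of_real (Re (1 * Z \<omega>)) + \<i> * of_real (Re (-\<i> * Z \<omega>)))"
    by (intro allmom_add allmom_cmult *)
  then show "allmom M Z" by (simp add: complex_eq[symmetric])
qed

text \<open>With X and Y the real and imaginary part, X + t Y is a real centered Gaussian for real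
  t, and the classical moment formula is an identity of polynomials in t. Evaluation at t = i gives
  X + i Y = Z.\<close>

lemma gauss_cx_moment:
  assumes Z: "gauss_cx M Z"
  shows "expectation (\<lambda>\<omega>. Z \<omega> ^ n) = of_real (normal_moment_coeff n) * expectation (\<lambda>\<omega>. (Z \<omega>)\<^sup>2) ^ (n div 2)"
proof -
  define X where "X \<omega> = complex_of_real (Re (1 * Z \<omega>))" for \<omega>
  define Y where "Y \<omega> = complex_of_real (Re (-\<i> * Z \<omega>))" for \<omega>
  have X: "allmom M X" and Y: "allmom M Y"
    unfolding X_def Y_def by (rule gauss_cx_allmom[OF Z])+
  have "mom_poly M X Y n = smult (of_real (normal_moment_coeff n)) (mom_poly M X Y 2 ^ (n div 2))"
  proof (rule poly_eq_if_real)
    fix t :: real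
    have cg: "centered_gaussian M (\<lambda>\<omega>. Re ((1 - \<i> * of_real t) * Z \<omega>))"
      using Z unfolding gauss_cx_def by blast
    have eq: "X \<omega> + of_real t * Y \<omega> = of_real (Re ((1 - \<i> * of_real t) * Z \<omega>))" for \<omega>
      by (simp add: X_def Y_def)
    show "poly (mom_poly M X Y n) (of_real t)
        = poly (smult (of_real (normal_moment_coeff n)) (mom_poly M X Y 2 ^ (n div 2))) (of_real t)"
      unfolding poly_smult poly_power poly_mom_poly[OF X Y] eq of_real_power[symmetric]
        integral_complex_of_real centered_gaussian_moments(3)[OF cg, of n]
      by simp
  qed
  then have "poly (mom_poly M X Y n) \<i> = poly (smult (of_real (normal_moment_coeff n)) (mom_poly M X Y 2 ^ (n div 2))) \<i>"
    by simp
  moreover have "X \<omega> + \<i> * Y \<omega> = Z \<omega>" for \<omega>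
    by (simp add: X_def Y_def complex_eq[symmetric])
  ultimately show ?thesis
    by (simp add: poly_mom_poly[OF X Y])
qed

text \<open>Gaussian integration by parts without densities: compare the coefficients of s in the
  formula expressing E (Z + s X)^(n + 1) through a power of E (Z + s X)^2.\<close>

lemma gauss_cx_by_parts:
  assumes G: "\<And>s. gauss_cx M (\<lambda>\<omega>. Z \<omega> + s * X \<omega>)" and X: "gauss_cx M X"
  shows "expectation (\<lambda>\<omega>. X \<omega> * Z \<omega> ^ n)
    = of_nat n * expectation (\<lambda>\<omega>. X \<omega> * Z \<omega>) * expectation (\<lambda>\<omega>. Z \<omega> ^ (n - 1))"
proof -
  have Zg: "gauss_cx M Z" using G[of 0] by simp
  have aZ: "allmom M Z" and aX: "allmom M X"
    using gauss_cx_allmom(2) Zg X by auto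
  have "mom_poly M Z X (Suc n) = smult (of_real (normal_moment_coeff (Suc n))) (mom_poly M Z X 2 ^ (Suc n div 2))"
    by (rule poly_eq_if_real, unfold poly_smult poly_power poly_mom_poly[OF aZ aX],
        rule gauss_cx_moment[OF G])
  then have "coeff (mom_poly M Z X (Suc n)) 1
      = of_real (normal_moment_coeff (Suc n)) * coeff (mom_poly M Z X 2 ^ (Suc n div 2)) 1" by simp
  moreover have "coeff (r ^ m) 1 = of_nat m * coeff r 0 ^ (m - 1) * coeff r 1" for r :: "complex poly" and m
  proof -
    have "coeff (r ^ m) 1 = poly (pderiv (r ^ m)) 0"
      by (simp add: poly_0_coeff_0 coeff_pderiv)
    also have "\<dots> = of_nat m * poly r 0 ^ (m - 1) * poly (pderiv r) 0"
      by (simp add: pderiv_power)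
    finally show ?thesis by (simp add: poly_0_coeff_0 coeff_pderiv)
  qed
  ultimately have main: "of_nat (Suc n) * expectation (\<lambda>\<omega>. X \<omega> * Z \<omega> ^ n)
     = of_real (normal_moment_coeff (Suc n)) * (of_nat (Suc n div 2) * expectation (\<lambda>\<omega>. (Z \<omega>)\<^sup>2) ^ (Suc n div 2 - 1)
         * (2 * expectation (\<lambda>\<omega>. X \<omega> * Z \<omega>)))"
    by (simp add: coeff_mom_poly)
  show ?thesis
  \<comment> \<open>For even n both sides vanish: the moment of order n - 1 is odd, or n = 0, where
    truncated subtraction is harmless because of the factor \<open>of_nat n\<close>.\<close>
  proof (cases "even n")
    case True
    then have "normal_moment_coeff (Suc n) = 0" by (simp add: normal_moment_coeff_def)
    with main have "expectation (\<lambda>\<omega>. X \<omega> * Z \<omega> ^ n) = 0"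
      by (simp del: of_nat_Suc)
    moreover have "of_nat n * expectation (\<lambda>\<omega>. Z \<omega> ^ (n - 1)) = 0"
      unfolding gauss_cx_moment[OF Zg, of "n - 1"] using True by (auto simp: normal_moment_coeff_def)
    ultimately show ?thesis by auto
  next
    case False
    then obtain m where n: "n = Suc (2 * m)" by (auto elim: oddE)
    have 1: "Suc n div 2 = Suc m" "n - 1 = 2 * m" by (auto simp: n)
    have 2: "normal_moment_coeff (Suc n) = real n * normal_moment_coeff (2 * m)" unfolding n by (rule normal_moment_coeff_Suc_Suc)
    have 3: "of_nat (Suc n) = 2 * (of_nat (Suc m) :: complex)" by (simp add: n)
    have "expectation (\<lambda>\<omega>. X \<omega> * Z \<omega> ^ n) = of_real (normal_moment_coeff (Suc n)) * (expectation (\<lambda>\<omega>. (Z \<omega>)\<^sup>2) ^ m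
         * expectation (\<lambda>\<omega>. X \<omega> * Z \<omega>))"
      using main unfolding 1 3 by (simp del: of_nat_Suc)
    then show ?thesis
      using gauss_cx_moment[OF Zg, of "2 * m"] unfolding 2 1 by simp
  qed
qed

end

text \<open>Polarization: an iterated finite difference of order \<open>card S\<close> kills lower
  powers and turns the power of that order into a product. The base point \<open>a\<close> is free
  because the Wick formula uses it both at 0 and at one of the variables.\<close>

lemma finite_difference_power:
  fixes y :: "'i \<Rightarrow> complex"
  assumes "finite S" "n \<le> card S"
  shows "(\<Sum>T\<in>Pow S. (-1) ^ card (S - T) * (a + sum y T) ^ n)
    = (if n = card S then fact n * prod y S else 0)"
  using assms
proof (induction S arbitrary: n a rule: finite_induct)
  case empty
  then show ?case by simp
next
  case (insert x S)
  let ?D = "\<lambda>k. \<Sum>T\<in>Pow S. (-1) ^ card (S - T) * (a + sum y T) ^ k"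
  have dj: "Pow S \<inter> insert x ` Pow S = {}" using insert.hyps by auto
  have inj: "inj_on (insert x) (Pow S)" using insert.hyps by (auto simp: inj_on_def)
  have expand: "(b + z) ^ n - b ^ n = (\<Sum>k<n. of_nat (n choose k) * b ^ k * z ^ (n - k))"
    for b z :: complex
    by (subst binomial_ring) (simp add: lessThan_Suc_atMost[symmetric])
  have "(\<Sum>T\<in>Pow (insert x S). (-1) ^ card (insert x S - T) * (a + sum y T) ^ n)
      = (\<Sum>T\<in>Pow S. (-1) ^ card (insert x S - T) * (a + sum y T) ^ n)
        + (\<Sum>T\<in>Pow S. (-1) ^ card (insert x S - insert x T) * (a + sum y (insert x T)) ^ n)"
    using insert.hyps dj unfolding Pow_insert
    by (subst sum.union_disjoint) (auto simp: sum.reindex[OF inj])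
  also have "(\<Sum>T\<in>Pow S. (-1) ^ card (insert x S - T) * (a + sum y T) ^ n)
      = (\<Sum>T\<in>Pow S. - ((-1) ^ card (S - T) * (a + sum y T) ^ n))"
  proof (rule sum.cong[OF refl])
    fix T assume "T \<in> Pow S"
    then have "insert x S - T = insert x (S - T)" "x \<notin> S - T" "finite (S - T)"
      using insert.hyps by auto
    then show "(-1) ^ card (insert x S - T) * (a + sum y T) ^ n
        = - ((-1) ^ card (S - T) * (a + sum y T) ^ n)" by simp
  qed
  also have "(\<Sum>T\<in>Pow S. (-1) ^ card (insert x S - insert x T) * (a + sum y (insert x T)) ^ n)
      = (\<Sum>T\<in>Pow S. (-1) ^ card (S - T) * ((a + sum y T) + y x) ^ n)"
  proof (rule sum.cong[OF refl])
    fix T assume T: "T \<in> Pow S"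
    then have "insert x S - insert x T = S - T" "x \<notin> T" "finite T"
      using insert.hyps by (auto intro: finite_subset)
    then show "(-1) ^ card (insert x S - insert x T) * (a + sum y (insert x T)) ^ n
        = (-1) ^ card (S - T) * ((a + sum y T) + y x) ^ n" by (simp add: add_ac)
  qed
  also have "(\<Sum>T\<in>Pow S. - ((-1) ^ card (S - T) * (a + sum y T) ^ n))
      + (\<Sum>T\<in>Pow S. (-1) ^ card (S - T) * ((a + sum y T) + y x) ^ n)
      = (\<Sum>T\<in>Pow S. (-1) ^ card (S - T) * (((a + sum y T) + y x) ^ n - (a + sum y T) ^ n))"
    by (simp add: sum.distrib[symmetric] algebra_simps)
  also have "\<dots> = (\<Sum>T\<in>Pow S. \<Sum>k<n. of_nat (n choose k) * y x ^ (n - k)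
      * ((-1) ^ card (S - T) * (a + sum y T) ^ k))"
    unfolding expand by (simp add: sum_distrib_left mult_ac)
  also have "\<dots> = (\<Sum>k<n. of_nat (n choose k) * y x ^ (n - k) * ?D k)"
    by (subst sum.swap) (simp add: sum_distrib_left)
  also have "\<dots> = (\<Sum>k<n. if k = card S then of_nat (n choose k) * y x ^ (n - k) * (fact k * prod y S) else 0)"
    using insert by (intro sum.cong) auto
  also have "\<dots> = (if n = card (insert x S) then fact n * prod y (insert x S) else 0)"
    using insert.hyps insert.prems by (auto simp: sum.delta not_less)
  finally show ?case .
qed

text \<open>The product is polarized into powers of the subset sums \<open>Y T\<close>, integration
  by parts is applied to each power, and the result is regrouped by the element \<open>i\<close> of
  \<open>T\<close> paired with \<open>X\<close>. For fixed \<open>i\<close> the remaining sum is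
  again a polarization, of one order less.\<close>

lemma (in prob_space) gauss_cx_wick:
  fixes y :: "'i \<Rightarrow> 'a \<Rightarrow> complex"
  assumes S: "finite S"
    and G: "\<And>c0 c. gauss_cx M (\<lambda>\<omega>. c0 * X \<omega> + (\<Sum>i\<in>S. c i * y i \<omega>))"
  shows "expectation (\<lambda>\<omega>. X \<omega> * (\<Prod>i\<in>S. y i \<omega>))
    = (\<Sum>i\<in>S. expectation (\<lambda>\<omega>. X \<omega> * y i \<omega>) * expectation (\<lambda>\<omega>. \<Prod>j\<in>S-{i}. y j \<omega>))"
proof -
  define Y where "Y T \<omega> = (\<Sum>i\<in>T. y i \<omega>)" for T \<omega>
  have X: "gauss_cx M X" using G[of 1 "\<lambda>_. 0"] by simp
  have GY: "gauss_cx M (\<lambda>\<omega>. Y T \<omega> + s * X \<omega>)" if "T \<subseteq> S" for T s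
  proof -
    have "(\<Sum>i\<in>S. (if i \<in> T then 1 else 0) * y i \<omega>) = Y T \<omega>" for \<omega>
      unfolding Y_def using that S by (intro sum.mono_neutral_cong_right) auto
    then show ?thesis using G[of s "\<lambda>i. if i \<in> T then 1 else 0"] by (simp add: add.commute)
  qed
  have y: "gauss_cx M (y i)" if "i \<in> S" for i
    using GY[of "{i}" 0] that by (simp add: Y_def)
  have a: "allmom M X" "\<And>i. i \<in> S \<Longrightarrow> allmom M (y i)" "\<And>T. T \<subseteq> S \<Longrightarrow> allmom M (Y T)"
    using gauss_cx_allmom(2)[OF X] gauss_cx_allmom(2)[OF y] gauss_cx_allmom(2)[OF GY[of _ 0]] by auto
  have i0: "integrable M (\<lambda>\<omega>. c * (X \<omega> * Y T \<omega> ^ n))" if "T \<subseteq> S" for T n c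
    by (intro allmom_integrable allmom_cmult allmom_mult allmom_power a that)
  have i1: "integrable M (\<lambda>\<omega>. c * Y T \<omega> ^ n)" if "T \<subseteq> S" for T n c
    by (intro allmom_integrable allmom_cmult allmom_power a that)
  let ?n = "card S"
  let ?e = "\<lambda>T. (-1) ^ card (S - T) * expectation (\<lambda>\<omega>. Y T \<omega> ^ (?n - 1))"
  let ?r = "\<lambda>i. expectation (\<lambda>\<omega>. X \<omega> * y i \<omega>)"
  let ?q = "\<lambda>i. expectation (\<lambda>\<omega>. \<Prod>j\<in>S-{i}. y j \<omega>)"
  have "fact ?n * expectation (\<lambda>\<omega>. X \<omega> * (\<Prod>i\<in>S. y i \<omega>))
      = expectation (\<lambda>\<omega>. X \<omega> * (\<Sum>T\<in>Pow S. (-1) ^ card (S - T) * (0 + Y T \<omega>) ^ ?n))"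
  proof -
    have "X \<omega> * (\<Sum>T\<in>Pow S. (-1) ^ card (S - T) * (0 + Y T \<omega>) ^ ?n)
        = fact ?n * (X \<omega> * (\<Prod>i\<in>S. y i \<omega>))" for \<omega>
      unfolding Y_def using S by (subst finite_difference_power) simp_all
    then show ?thesis by (simp only: integral_mult_right_zero)
  qed
  also have "\<dots> = expectation (\<lambda>\<omega>. (\<Sum>T\<in>Pow S. (-1) ^ card (S - T) * (X \<omega> * Y T \<omega> ^ ?n)))"
    by (simp only: sum_distrib_left mult.left_commute[of "X _"] add_0)
  also have "\<dots> = (\<Sum>T\<in>Pow S. (-1) ^ card (S - T) * expectation (\<lambda>\<omega>. X \<omega> * Y T \<omega> ^ ?n))"
    by (subst Bochner_Integration.integral_sum) (auto intro!: i0)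
  also have "\<dots> = (\<Sum>T\<in>Pow S. \<Sum>i\<in>T. of_nat ?n * ?r i
       * ?e T)"
  proof (rule sum.cong[OF refl])
    fix T assume "T \<in> Pow S"
    then have T: "T \<subseteq> S" "finite T" using S by (auto intro: finite_subset)
    have "expectation (\<lambda>\<omega>. X \<omega> * Y T \<omega>) = expectation (\<lambda>\<omega>. \<Sum>i\<in>T. X \<omega> * y i \<omega>)"
      by (simp add: Y_def sum_distrib_left)
    also have "\<dots> = (\<Sum>i\<in>T. ?r i)"
      using T by (intro Bochner_Integration.integral_sum allmom_integrable allmom_mult a) auto
    finally show "(-1) ^ card (S - T) * expectation (\<lambda>\<omega>. X \<omega> * Y T \<omega> ^ ?n)
       = (\<Sum>i\<in>T. of_nat ?n * ?r i
       * ?e T)"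
      unfolding gauss_cx_by_parts[OF GY[OF T(1)] X, of ?n]
      by (simp add: sum_distrib_left sum_distrib_right mult_ac)
  qed
  also have "\<dots> = (\<Sum>i\<in>S. \<Sum>T\<in>{T\<in>Pow S. i \<in> T}. of_nat ?n * ?r i
       * ?e T)"
    (is "(\<Sum>T\<in>Pow S. \<Sum>i\<in>T. ?f T i) = _")
  proof -
    have "(\<Sum>T\<in>Pow S. \<Sum>i\<in>T. ?f T i) = (\<Sum>T\<in>Pow S. \<Sum>i\<in>{i\<in>S. i \<in> T}. ?f T i)"
      by (intro sum.cong arg_cong2[where f = sum]) auto
    also have "\<dots> = (\<Sum>i\<in>S. \<Sum>T\<in>{T\<in>Pow S. i \<in> T}. ?f T i)"
      using S by (intro sum.swap_restrict) auto
    finally show ?thesis .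
  qed
  also have "\<dots> = (\<Sum>i\<in>S. fact ?n * (?r i
       * ?q i))"
  proof (rule sum.cong[OF refl])
    fix i assume i: "i \<in> S"
    have eq: "{T\<in>Pow S. i \<in> T} = insert i ` Pow (S - {i})"
    proof
      show "{T\<in>Pow S. i \<in> T} \<subseteq> insert i ` Pow (S - {i})"
      proof
        fix T assume "T \<in> {T\<in>Pow S. i \<in> T}"
        then have "T = insert i (T - {i})" "T - {i} \<in> Pow (S - {i})" by auto
        then show "T \<in> insert i ` Pow (S - {i})" by blast
      qed
    qed (use i in auto)
    have inj: "inj_on (insert i) (Pow (S - {i}))" by (auto simp: inj_on_def)
    have n: "?n - 1 = card (S - {i})" "?n > 0" using i S by (auto simp: card_gt_0_iff)
    have "(\<Sum>T\<in>{T\<in>Pow S. i \<in> T}. ?e T)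
        = expectation (\<lambda>\<omega>. \<Sum>T\<in>{T\<in>Pow S. i \<in> T}. (-1) ^ card (S - T) * Y T \<omega> ^ (?n - 1))"
      by (subst Bochner_Integration.integral_sum) (auto intro!: i1)
    \<comment> \<open>Subsets containing \<open>i\<close> correspond to subsets of
      \<open>S - {i}\<close> with base point \<open>y i\<close>. The order of the difference equals
      the exponent, so the base point disappears and the product of the remaining variables is
      left.\<close>
    also have "\<dots> = expectation (\<lambda>\<omega>. \<Sum>T\<in>Pow (S - {i}). (-1) ^ card ((S - {i}) - T)
         * (y i \<omega> + (\<Sum>j\<in>T. y j \<omega>)) ^ (?n - 1))"
    proof (rule Bochner_Integration.integral_cong[OF refl])
      fix \<omega>
      show "(\<Sum>T\<in>{T\<in>Pow S. i \<in> T}. (-1) ^ card (S - T) * Y T \<omega> ^ (?n - 1))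
        = (\<Sum>T\<in>Pow (S - {i}). (-1) ^ card ((S - {i}) - T) * (y i \<omega> + (\<Sum>j\<in>T. y j \<omega>)) ^ (?n - 1))"
        unfolding eq sum.reindex[OF inj] comp_def
      proof (rule sum.cong[OF refl])
        fix T assume "T \<in> Pow (S - {i})"
        then have "S - insert i T = S - {i} - T" "i \<notin> T" "finite T"
          using S by (auto intro: finite_subset)
        then show "(-1) ^ card (S - insert i T) * Y (insert i T) \<omega> ^ (?n - 1)
          = (-1) ^ card (S - {i} - T) * (y i \<omega> + (\<Sum>j\<in>T. y j \<omega>)) ^ (?n - 1)"
          by (simp add: Y_def)
      qed
    qed
    also have "\<dots> = expectation (\<lambda>\<omega>. fact (?n - 1) * (\<Prod>j\<in>S-{i}. y j \<omega>))"
      using S n by (subst finite_difference_power) auto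
    finally have "(\<Sum>T\<in>{T\<in>Pow S. i \<in> T}. ?e T)
       = fact (?n - 1) * ?q i" by simp
    then show "(\<Sum>T\<in>{T\<in>Pow S. i \<in> T}. of_nat ?n * ?r i
       * ?e T)
       = fact ?n * (?r i * ?q i)"
      using n by (simp add: sum_distrib_left[symmetric] fact_reduce[of ?n])
  qed
  also have "\<dots> = fact ?n * (\<Sum>i\<in>S. ?r i
       * ?q i)"
    by (simp add: sum_distrib_left)
  finally show ?thesis by simp
qed

section \<open>Pairings of a Hermitian Gaussian random measure\<close>

lemma fin_borel_uminus: "A \<in> fin_borel \<Longrightarrow> uminus ` A \<in> fin_borel"
  and measure_uminus_image: "A \<in> sets borel \<Longrightarrow> measure lborel (uminus ` A) = measure lborel (A :: real set)"
proof -
  have vim: "uminus ` A = uminus -` A" for A :: "real set"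
    by (auto simp: image_iff) (metis minus_minus)
  have s: "uminus ` A \<in> sets borel" if "A \<in> sets borel" for A :: "real set"
    using measurable_sets[OF borel_measurable_uminus[OF measurable_ident_sets[OF refl]] that]
    by (simp add: vim)
  have e: "emeasure lborel (uminus ` A) = emeasure lborel A" if "A \<in> sets borel" for A :: "real set"
  proof -
    have "emeasure lborel A = emeasure (distr lborel borel uminus) A"
      by (simp add: lborel_distr_uminus)
    also have "\<dots> = emeasure lborel (uminus -` A \<inter> space lborel)"
      using that by (intro emeasure_distr) auto
    finally show ?thesis by (simp add: vim)
  qed
  show "uminus ` A \<in> fin_borel" if "A \<in> fin_borel"
    using that s e by (auto simp: fin_borel_def)
  show "measure lborel (uminus ` A) = measure lborel A" if "A \<in> sets borel"
    using e[OF that] by (simp add: measure_def)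
qed

lemma fin_borel_sets[measurable_dest]: "A \<in> fin_borel \<Longrightarrow> A \<in> sets borel"
  by (simp add: fin_borel_def)

lemma uminus_uminus_image: "uminus ` uminus ` A = (A :: real set)"
  by (simp add: image_image)

context hermitian_gaussian_random_measure begin

lemma W_gauss_cx:
  assumes S: "finite S" and A: "\<And>i. i \<in> S \<Longrightarrow> A i \<in> fin_borel"
  shows "gauss_cx M (\<lambda>\<omega>. \<Sum>i\<in>S. c i * W (A i) \<omega>)"
  unfolding gauss_cx_def
proof
  fix w
  obtain h where h: "bij_betw h {..<card S} S"
    using ex_bij_betw_nat_finite[OF S] by (auto simp: atLeast0LessThan)
  have "centered_gaussian M (\<lambda>\<omega>. Re (\<Sum>i<card S. (w * c (h i)) * W (A (h i)) \<omega>))"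
    using h A by (intro W_gaussian) (auto simp: bij_betw_def)
  also have "(\<lambda>\<omega>. \<Sum>i<card S. (w * c (h i)) * W (A (h i)) \<omega>)
      = (\<lambda>\<omega>. w * (\<Sum>i\<in>S. c i * W (A i) \<omega>))"
    by (subst sum.reindex_bij_betw[OF h, symmetric]) (simp add: sum_distrib_left mult.assoc)
  finally show "centered_gaussian M (\<lambda>\<omega>. Re (w * (\<Sum>i\<in>S. c i * W (A i) \<omega>)))" .
qed

lemma W_allmom: "A \<in> fin_borel \<Longrightarrow> allmom M (W A)"
  using gauss_cx_allmom(2)[OF W_gauss_cx[of "{()}" "\<lambda>_. A" "\<lambda>_. 1"]] by simp

lemma W_cnj: "A \<in> fin_borel \<Longrightarrow> AE \<omega> in M. cnj (W A \<omega>) = W (uminus ` A) \<omega>"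
  using W_hermitian[OF fin_borel_uminus, of A, simplified uminus_uminus_image]
  by (auto elim!: eventually_mono)

text \<open>Wick's formula needs the bilinear covariance. Hermitian symmetry obtains it from the
  sesquilinear one at the price of reflecting a set: a set is correlated with another exactly
  through the mirror image of the latter.\<close>

lemma W_second_moment:
  assumes B: "B \<in> fin_borel" and A: "A \<in> fin_borel"
  shows "expectation (\<lambda>\<omega>. W B \<omega> * W A \<omega>) = of_real (measure lborel (B \<inter> uminus ` A))"
proof -
  note [measurable] = W_measurable[OF B] W_measurable[OF A] W_measurable[OF fin_borel_uminus[OF A]]
  have "expectation (\<lambda>\<omega>. W B \<omega> * W A \<omega>) = expectation (\<lambda>\<omega>. W B \<omega> * cnj (W (uminus ` A) \<omega>))"
    using W_hermitian[OF A] by (intro integral_cong_AE) auto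
  also have "\<dots> = of_real (measure lborel (B \<inter> uminus ` A))"
    by (rule W_covariance[OF B fin_borel_uminus[OF A]])
  finally show ?thesis .
qed

lemma W_wick:
  assumes S: "finite S" and B: "B \<in> fin_borel" and A: "\<And>i. i \<in> S \<Longrightarrow> A i \<in> fin_borel"
  shows "expectation (\<lambda>\<omega>. W B \<omega> * (\<Prod>i\<in>S. W (A i) \<omega>))
    = (\<Sum>i\<in>S. of_real (measure lborel (B \<inter> uminus ` A i)) * expectation (\<lambda>\<omega>. \<Prod>j\<in>S-{i}. W (A j) \<omega>))"
proof -
  have "gauss_cx M (\<lambda>\<omega>. c0 * W B \<omega> + (\<Sum>i\<in>S. c i * W (A i) \<omega>))" for c0 c
  proof -
    define S' where "S' = insert None (Some ` S)"
    define A' where "A' i = (case i of None \<Rightarrow> B | Some i \<Rightarrow> A i)" for i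
    define c' where "c' i = (case i of None \<Rightarrow> c0 | Some i \<Rightarrow> c i)" for i
    have "gauss_cx M (\<lambda>\<omega>. \<Sum>i\<in>S'. c' i * W (A' i) \<omega>)"
      by (rule W_gauss_cx) (use S A B in \<open>auto simp: S'_def A'_def\<close>)
    also have "(\<lambda>\<omega>. \<Sum>i\<in>S'. c' i * W (A' i) \<omega>) = (\<lambda>\<omega>. c0 * W B \<omega> + (\<Sum>i\<in>S. c i * W (A i) \<omega>))"
      unfolding S'_def using S by (subst sum.insert) (auto simp: A'_def c'_def sum.reindex)
    finally show ?thesis .
  qed
  from gauss_cx_wick[OF S this] show ?thesis
    using W_second_moment[OF B A] by (simp cong: sum.cong)
qed

text \<open>Wick's formula is expanded at the reflected set of \<open>D z\<close>. Its partners
  among the other reflected sets contribute nothing by the null hypothesis, so it is paired with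
  some \<open>A a\<close>. Moving \<open>A z\<close> into the vacant place \<open>a\<close> by a
  transposition makes both products run over \<open>Q\<close> again, which is the recursive
  description of the permutations of \<open>insert z Q\<close>; hence \<open>A\<close> is
  generalized in the induction.\<close>

lemma W_pairing_uminus:
  assumes "finite Q"
    and "\<And>b. b \<in> Q \<Longrightarrow> A b \<in> fin_borel" "\<And>b. b \<in> Q \<Longrightarrow> D b \<in> fin_borel"
    and "\<And>b b'. b \<in> Q \<Longrightarrow> b' \<in> Q \<Longrightarrow> b \<noteq> b' \<Longrightarrow> measure lborel (D b \<inter> uminus ` D b') = 0"
  shows "expectation (\<lambda>\<omega>. (\<Prod>b\<in>Q. W (A b) \<omega>) * (\<Prod>b\<in>Q. W (uminus ` D b) \<omega>))
    = of_real (\<Sum>\<pi> | \<pi> permutes Q. \<Prod>b\<in>Q. measure lborel (A (\<pi> b) \<inter> D b))"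
  using assms
proof (induction Q arbitrary: A rule: finite_induct)
  case empty
  then show ?case by (simp add: prob_space)
next
  case (insert z Q)
  let ?S = "insert z Q <+> Q"
  define E where "E = case_sum A (\<lambda>b. uminus ` D b)"
  let ?e = "\<lambda>i. expectation (\<lambda>\<omega>. \<Prod>j\<in>?S - {i}. W (E j) \<omega>)"
  let ?d = "\<lambda>a q. \<Prod>b\<in>Q. measure lborel (A (Transposition.transpose z a (q b)) \<inter> D b)"
  have E: "E i \<in> fin_borel" if "i \<in> ?S" for i
    using that
  proof (cases i)
    case (Inl a)
    then show ?thesis using that insert.prems(1)[of a] by (auto simp: E_def)
  next
    case (Inr b)
    then show ?thesis using that fin_borel_uminus[OF insert.prems(2)[of b]] by (auto simp: E_def)
  qed
  have fin: "finite ?S" using insert.hyps by simp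
  have zQ: "z \<notin> Q" "finite Q" by fact+
  have IH: "?e (Inl a)
     = of_real (\<Sum>q | q permutes Q. ?d a q)"
    if a: "a \<in> insert z Q" for a
  proof -
    have "?S - {Inl a} = (insert z Q - {a}) <+> Q" by auto
    then have 1: "(\<Prod>j\<in>?S - {Inl a}. W (E j) \<omega>)
        = (\<Prod>j\<in>insert z Q - {a}. W (A j) \<omega>) * (\<Prod>b\<in>Q. W (uminus ` D b) \<omega>)" for \<omega>
      using insert.hyps by (simp add: prod.Plus E_def comp_def)
    have 2: "(\<Prod>j\<in>insert z Q - {a}. W (A j) \<omega>) = (\<Prod>b\<in>Q. W (A (Transposition.transpose z a b)) \<omega>)" for \<omega>
      by (rule prod.reindex_bij_witness[of _ "Transposition.transpose z a" "Transposition.transpose z a"])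
        (use a zQ in \<open>auto simp: Transposition.transpose_def\<close>)
    have "expectation (\<lambda>\<omega>. (\<Prod>b\<in>Q. W (A (Transposition.transpose z a b)) \<omega>) * (\<Prod>b\<in>Q. W (uminus ` D b) \<omega>))
      = of_real (\<Sum>q | q permutes Q. ?d a q)"
      by (rule insert.IH) (use insert.prems a in \<open>auto simp: Transposition.transpose_def\<close>)
    then show ?thesis by (simp only: 1 2)
  qed
  have cL: "measure lborel (uminus ` D z \<inter> uminus ` A a) = measure lborel (A a \<inter> D z)" if "a \<in> insert z Q" for a
  proof -
    have "uminus ` D z \<inter> uminus ` A a = uminus ` (A a \<inter> D z)" by auto
    moreover have "A a \<inter> D z \<in> sets borel"
      using insert.prems(1)[OF that] insert.prems(2)[of z] by (auto simp: fin_borel_def)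
    ultimately show ?thesis by (simp add: measure_uminus_image)
  qed
  have cR: "measure lborel (uminus ` D z \<inter> uminus ` uminus ` D b) = 0" if "b \<in> Q" for b
    using insert.prems(3)[of b z] that zQ by (auto simp: uminus_uminus_image Int_commute)
  have "expectation (\<lambda>\<omega>. (\<Prod>b\<in>insert z Q. W (A b) \<omega>) * (\<Prod>b\<in>insert z Q. W (uminus ` D b) \<omega>))
     = expectation (\<lambda>\<omega>. W (uminus ` D z) \<omega> * (\<Prod>i\<in>?S. W (E i) \<omega>))"
    using zQ by (simp add: prod.Plus E_def comp_def mult_ac)
  also have "\<dots> = (\<Sum>i\<in>?S. of_real (measure lborel (uminus ` D z \<inter> uminus ` E i))
      * ?e i)"
    using insert.prems by (intro W_wick fin E fin_borel_uminus) auto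
  also have "\<dots> = (\<Sum>a\<in>insert z Q. of_real (measure lborel (uminus ` D z \<inter> uminus ` A a))
      * ?e (Inl a))
      + (\<Sum>b\<in>Q. of_real (measure lborel (uminus ` D z \<inter> uminus ` uminus ` D b))
      * ?e (Inr b))"
    using zQ by (subst sum.Plus) (simp_all add: E_def comp_def)
  also have "(\<Sum>b\<in>Q. of_real (measure lborel (uminus ` D z \<inter> uminus ` uminus ` D b))
      * ?e (Inr b)) = 0"
    by (rule sum.neutral) (simp add: cR)
  also have "(\<Sum>a\<in>insert z Q. of_real (measure lborel (uminus ` D z \<inter> uminus ` A a))
      * ?e (Inl a))
      = of_real (\<Sum>a\<in>insert z Q. \<Sum>q | q permutes Q. measure lborel (A a \<inter> D z)
          * ?d a q)"
    unfolding of_real_sum[of _ "insert z Q"]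
    by (rule sum.cong[OF refl]) (simp only: cL IH sum_distrib_left of_real_mult[symmetric])
  also have "(\<Sum>a\<in>insert z Q. \<Sum>q | q permutes Q. measure lborel (A a \<inter> D z)
          * ?d a q)
      = (\<Sum>\<pi> | \<pi> permutes insert z Q. \<Prod>b\<in>insert z Q. measure lborel (A (\<pi> b) \<inter> D b))"
  proof (subst sum_over_permutations_insert[OF zQ(2,1)], intro sum.cong refl)
    fix a q assume "q \<in> {q. q permutes Q}"
    then have "q z = z" using zQ by (auto simp: permutes_def)
    then show "measure lborel (A a \<inter> D z) * ?d a q
       = (\<Prod>b\<in>insert z Q. measure lborel (A ((Transposition.transpose z a \<circ> q) b) \<inter> D b))"
      using zQ by simp
  qed
  finally show ?case by simp
qed

text \<open>Every \<open>D b\<close> has to be paired with some \<open>A b'\<close>, which leaves no room for pairings inside the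
  first product.\<close>

lemma W_pairing:
  assumes Q: "finite Q"
    and A: "\<And>b. b \<in> Q \<Longrightarrow> A b \<in> fin_borel" and D: "\<And>b. b \<in> Q \<Longrightarrow> D b \<in> fin_borel"
    and "\<And>b b'. b \<in> Q \<Longrightarrow> b' \<in> Q \<Longrightarrow> b \<noteq> b' \<Longrightarrow> measure lborel (D b \<inter> uminus ` D b') = 0"
  shows "expectation (\<lambda>\<omega>. (\<Prod>b\<in>Q. W (A b) \<omega>) * cnj (\<Prod>b\<in>Q. W (D b) \<omega>))
    = of_real (\<Sum>\<pi> | \<pi> permutes Q. \<Prod>b\<in>Q. measure lborel (A (\<pi> b) \<inter> D b))"
proof -
  have [measurable]: "(\<lambda>\<omega>. \<Prod>b\<in>Q. W (A b) \<omega>) \<in> borel_measurable M"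
    "(\<lambda>\<omega>. \<Prod>b\<in>Q. W (D b) \<omega>) \<in> borel_measurable M"
    "(\<lambda>\<omega>. \<Prod>b\<in>Q. W (uminus ` D b) \<omega>) \<in> borel_measurable M"
    by (intro borel_measurable_prod W_measurable A D fin_borel_uminus; assumption)+
  have "AE \<omega> in M. \<forall>b\<in>Q. cnj (W (D b) \<omega>) = W (uminus ` D b) \<omega>"
    using Q D by (intro AE_finite_allI W_cnj) auto
  then have "AE \<omega> in M. cnj (\<Prod>b\<in>Q. W (D b) \<omega>) = (\<Prod>b\<in>Q. W (uminus ` D b) \<omega>)"
    by eventually_elim (simp add: cnj_prod)
  then have "expectation (\<lambda>\<omega>. (\<Prod>b\<in>Q. W (A b) \<omega>) * cnj (\<Prod>b\<in>Q. W (D b) \<omega>))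
      = expectation (\<lambda>\<omega>. (\<Prod>b\<in>Q. W (A b) \<omega>) * (\<Prod>b\<in>Q. W (uminus ` D b) \<omega>))"
    by (intro integral_cong_AE) (measurable, auto)
  also have "\<dots> = of_real (\<Sum>\<pi> | \<pi> permutes Q. \<Prod>b\<in>Q. measure lborel (A (\<pi> b) \<inter> D b))"
    by (rule W_pairing_uminus) fact+
  finally show ?thesis .
qed

end

section \<open>A diagram estimate\<close>

text \<open>The squared L2 norm of a step kernel with coefficients \<open>c\<close> on blocks whose
  sides have length \<open>a j\<close>. The arguments form an arbitrary set because the diagram
  induction deletes them in pairs.\<close>

definition wnorm2 :: "int set \<Rightarrow> (int \<Rightarrow> real) \<Rightarrow> 'x set \<Rightarrow> (('x \<Rightarrow> int) \<Rightarrow> complex) \<Rightarrow> real" where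
  "wnorm2 L a B c = (\<Sum>u\<in>B \<rightarrow>\<^sub>E L. (cmod (c u))\<^sup>2 * (\<Prod>x\<in>B. a (u x)))"

lemma wnorm2_nonneg: "(\<And>j. j \<in> L \<Longrightarrow> a j \<ge> 0) \<Longrightarrow> wnorm2 L a B c \<ge> 0"
  unfolding wnorm2_def by (intro sum_nonneg mult_nonneg_nonneg prod_nonneg) auto

lemma sum_PiE_insert:
  fixes g :: "('x \<Rightarrow> 'y) \<Rightarrow> 'z::comm_monoid_add"
  assumes "x \<notin> B"
  shows "(\<Sum>u\<in>insert x B \<rightarrow>\<^sub>E L. g u) = (\<Sum>j\<in>L. \<Sum>u\<in>B \<rightarrow>\<^sub>E L. g (u(x := j)))"
proof -
  have "(\<Sum>u\<in>insert x B \<rightarrow>\<^sub>E L. g u) = (\<Sum>(j, u)\<in>L \<times> (B \<rightarrow>\<^sub>E L). g (u(x := j)))"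
    unfolding PiE_insert_eq
    by (subst sum.reindex[OF inj_combinator[OF assms]]) (simp add: case_prod_unfold)
  then show ?thesis by (simp add: sum.cartesian_product)
qed

lemma wnorm2_insert:
  assumes "x \<notin> B" "finite B"
  shows "wnorm2 L a (insert x B) c = (\<Sum>j\<in>L. a j * wnorm2 L a B (\<lambda>v. c (v(x := j))))"
proof -
  have "(\<Prod>y\<in>B. a ((u(x := j)) y)) = (\<Prod>y\<in>B. a (u y))" for u j
    using assms by (intro prod.cong) auto
  then show ?thesis
    unfolding wnorm2_def sum_PiE_insert[OF assms(1)] using assms
    by (simp add: sum_distrib_left mult_ac)
qed

text \<open>Every term of the Wick expansion pairs two arguments, and summing over the common index of the pair costs one Cauchy-Schwarz inequality.\<close>

lemma diagram_bound:
  fixes m :: "'x set \<Rightarrow> ('x \<Rightarrow> int) \<Rightarrow> complex" and \<beta> :: "'x \<Rightarrow> 'i"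
    and c :: "'i \<Rightarrow> ('x \<Rightarrow> int) \<Rightarrow> complex"
  assumes L: "finite L" "\<And>j. j \<in> L \<Longrightarrow> - j \<in> L"
    and a: "\<And>j. j \<in> L \<Longrightarrow> a j \<ge> 0" "\<And>j. j \<in> L \<Longrightarrow> a (- j) = a j"
    and m_empty: "\<And>u. m {} u = 1"
    and m_cong: "\<And>P u v. (\<And>x. x \<in> P \<Longrightarrow> u x = v x) \<Longrightarrow> m P u = m P v"
    and m_rec: "\<And>P x u. finite P \<Longrightarrow> x \<in> P \<Longrightarrow> u \<in> P \<rightarrow> L \<Longrightarrow>
      m P u = (\<Sum>y\<in>P-{x}. (if u y = - u x then of_real (a (u x)) else 0) * m (P - {x, y}) u)"
    and I: "finite I"
    and P: "finite P" "\<beta> ` P \<subseteq> I"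
    and off: "\<And>i u x y. i \<in> I \<Longrightarrow> u \<in> {x\<in>P. \<beta> x = i} \<rightarrow>\<^sub>E L \<Longrightarrow> x \<in> P \<Longrightarrow> y \<in> P \<Longrightarrow>
      \<beta> x = i \<Longrightarrow> \<beta> y = i \<Longrightarrow> x \<noteq> y \<Longrightarrow> u y = - u x \<Longrightarrow> c i u = 0"
  shows "cmod (\<Sum>u\<in>P \<rightarrow>\<^sub>E L. (\<Prod>i\<in>I. c i (restrict u {x\<in>P. \<beta> x = i})) * m P u)
    \<le> fact (card P) * (\<Prod>i\<in>I. sqrt (wnorm2 L a {x\<in>P. \<beta> x = i} (c i)))"
  using P off
proof (induction "card P" arbitrary: P c rule: less_induct)
  case less
  show ?case
  proof (cases "P = {}")
    case True
    have "cmod (\<Prod>i\<in>I. c i (\<lambda>x. undefined)) = (\<Prod>i\<in>I. cmod (c i (\<lambda>x. undefined)))"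
      by (rule prod_norm[symmetric])
    then show ?thesis
      by (simp add: True m_empty wnorm2_def restrict_def)
  next
    case False
    then obtain x where x: "x \<in> P" by auto
    let ?blk = "\<lambda>P i. {x\<in>P. \<beta> x = i}"
    let ?N = "\<lambda>P c i. sqrt (wnorm2 L a (?blk P i) (c i))"
    \<comment> \<open>The contribution of all pairings in which the fixed argument \<open>x\<close>
      is matched with \<open>y\<close>.\<close>
    define S where "S y = (\<Sum>u\<in>P \<rightarrow>\<^sub>E L. (\<Prod>i\<in>I. c i (restrict u (?blk P i))) *
      ((if u y = - u x then of_real (a (u x)) else 0) * m (P - {x, y}) u))" for y
    have finP: "finite P" using less.prems by simp
    have N0: "0 \<le> ?N P c i" for i
      using wnorm2_nonneg[OF a(1)] by simp
    have "(\<Sum>u\<in>P \<rightarrow>\<^sub>E L. (\<Prod>i\<in>I. c i (restrict u (?blk P i))) * m P u)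
       = (\<Sum>u\<in>P \<rightarrow>\<^sub>E L. \<Sum>y\<in>P-{x}. (\<Prod>i\<in>I. c i (restrict u (?blk P i))) *
           ((if u y = - u x then of_real (a (u x)) else 0) * m (P - {x, y}) u))"
    proof (rule sum.cong[OF refl])
      fix u assume "u \<in> P \<rightarrow>\<^sub>E L"
      then have "u \<in> P \<rightarrow> L" by auto
      from m_rec[OF finP x this]
      show "(\<Prod>i\<in>I. c i (restrict u (?blk P i))) * m P u = (\<Sum>y\<in>P-{x}. (\<Prod>i\<in>I. c i (restrict u (?blk P i))) *
           ((if u y = - u x then of_real (a (u x)) else 0) * m (P - {x, y}) u))"
        by (simp add: sum_distrib_left)
    qed
    also have "\<dots> = (\<Sum>y\<in>P-{x}. S y)"
      unfolding S_def by (rule sum.swap)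
    finally have split: "(\<Sum>u\<in>P \<rightarrow>\<^sub>E L. (\<Prod>i\<in>I. c i (restrict u (?blk P i))) * m P u) = (\<Sum>y\<in>P-{x}. S y)" .
    have Sy: "cmod (S y) \<le> fact (card P - 2) * (\<Prod>i\<in>I. ?N P c i)" if y: "y \<in> P" "y \<noteq> x" for y
    proof (cases "\<beta> y = \<beta> x")
      case True
      \<comment> \<open>A pair inside one block needs opposite indices, and there the coefficient of
        that block vanishes by the exclusion of hyper-diagonals.\<close>
      have "S y = 0" unfolding S_def
      proof (rule sum.neutral, rule ballI)
        fix u assume u: "u \<in> P \<rightarrow>\<^sub>E L"
        show "(\<Prod>i\<in>I. c i (restrict u (?blk P i))) *
           ((if u y = - u x then of_real (a (u x)) else 0) * m (P - {x, y}) u) = 0"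
        proof (cases "u y = - u x")
          case eq: True
          have "\<beta> x \<in> I" using less.prems x by auto
          moreover have "c (\<beta> x) (restrict u (?blk P (\<beta> x))) = 0"
            by (rule less.prems(3)[of "\<beta> x" _ x y]) (use less.prems x y True eq u in auto)
          ultimately have "(\<Prod>i\<in>I. c i (restrict u (?blk P i))) = 0"
            using I by (intro prod_zero) auto
          then show ?thesis by simp
        qed simp
      qed
      then show ?thesis using N0 by (simp add: prod_nonneg)
    next
      case False
      define i0 where "i0 = \<beta> x"
      define l where "l = \<beta> y"
      have il: "i0 \<in> I" "l \<in> I" "i0 \<noteq> l" using less.prems x y False by (auto simp: i0_def l_def)
      define P' where "P' = P - {x, y}"
      have P': "finite P'" "x \<notin> insert y P'" "y \<notin> P'" "P = insert x (insert y P')"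
        using finP x y by (auto simp: P'_def)
      have cP': "card P = Suc (Suc (card P'))" using P' by simp
      \<comment> \<open>The paired arguments are frozen at \<open>j\<close> and \<open>- j\<close>,
        each in its own block. What remains is a sum of the same kind over \<open>P'\<close>, to
        which the induction hypothesis applies for every \<open>j\<close>.\<close>
      define c' where "c' j i v = (if i = i0 then c i0 (v(x := j)) else if i = l then c l (v(y := -j)) else c i v)" for j i v
      have c'0: "c' j i0 = (\<lambda>v. c i0 (v(x := j)))" and c'l: "c' j l = (\<lambda>v. c l (v(y := -j)))" for j
        using il by (auto simp: c'_def fun_eq_iff)
      let ?m = "\<lambda>j. wnorm2 L a (?blk P' i0) (c' j i0)" and ?n = "\<lambda>j. wnorm2 L a (?blk P' l) (c' j l)"
      let ?s = "\<lambda>j. sqrt (a j * ?m j)" and ?t = "\<lambda>j. sqrt (a j * ?n j)"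
      have blk: "?blk P i0 = insert x (?blk P' i0)" "?blk P l = insert y (?blk P' l)"
        "\<And>i. i \<noteq> i0 \<Longrightarrow> i \<noteq> l \<Longrightarrow> ?blk P i = ?blk P' i"
        using P' il by (auto simp: i0_def l_def)
      have "S y = (\<Sum>j\<in>L. \<Sum>k\<in>L. \<Sum>u\<in>P' \<rightarrow>\<^sub>E L. (\<Prod>i\<in>I. c i (restrict (u(y := k, x := j)) (?blk P i))) *
           ((if k = - j then of_real (a j) else 0) * m P' (u(y := k, x := j))))"
        unfolding S_def P'_def[symmetric] using P'(2,3) y
        by (subst P'(4), subst sum_PiE_insert[OF P'(2)], subst sum_PiE_insert[OF P'(3)]) (simp cong: if_cong)
      also have "\<dots> = (\<Sum>j\<in>L. \<Sum>k\<in>L. if k = - j then of_real (a j) * (\<Sum>u\<in>P' \<rightarrow>\<^sub>E L. (\<Prod>i\<in>I. c i (restrict (u(y := -j, x := j)) (?blk P i))) *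
           m P' (u(y := -j, x := j))) else 0)"
        by (intro sum.cong refl) (auto simp: sum_distrib_left mult_ac)
      also have "\<dots> = (\<Sum>j\<in>L. of_real (a j) * (\<Sum>u\<in>P' \<rightarrow>\<^sub>E L. (\<Prod>i\<in>I. c i (restrict (u(y := -j, x := j)) (?blk P i))) *
           m P' (u(y := -j, x := j))))"
        using L by (simp add: sum.delta')
      also have "\<dots> = (\<Sum>j\<in>L. of_real (a j) * (\<Sum>u\<in>P' \<rightarrow>\<^sub>E L. (\<Prod>i\<in>I. c' j i (restrict u (?blk P' i))) * m P' u))"
      proof (intro sum.cong refl arg_cong2[where f = "(*)"] prod.cong)
        fix j u i assume i: "i \<in> I"
        show "c i (restrict (u(y := -j, x := j)) (?blk P i)) = c' j i (restrict u (?blk P' i))"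
        proof -
          have r1: "restrict (u(y := -j, x := j)) (insert x (?blk P' i0)) = (restrict u (?blk P' i0))(x := j)"
            using P' by (auto simp: fun_eq_iff restrict_def)
          have r2: "restrict (u(y := -j, x := j)) (insert y (?blk P' l)) = (restrict u (?blk P' l))(y := -j)"
            using P' by (auto simp: fun_eq_iff restrict_def)
          have r3: "restrict (u(y := -j, x := j)) (?blk P' i) = restrict u (?blk P' i)"
            using P' by (auto simp: fun_eq_iff restrict_def)
          show ?thesis
            using il r1 r2 r3 blk unfolding c'_def by auto
        qed
      next
        fix j u
        show "m P' (u(y := -j, x := j)) = m P' u"
          using P' by (intro m_cong) auto
      qed
      finally have "cmod (S y) \<le> (\<Sum>j\<in>L. a j * cmod (\<Sum>u\<in>P' \<rightarrow>\<^sub>E L. (\<Prod>i\<in>I. c' j i (restrict u (?blk P' i))) * m P' u))"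
        using a by (simp, intro sum_norm_le) (simp add: norm_mult)
      also have "\<dots> \<le> (\<Sum>j\<in>L. a j * (fact (card P') * (\<Prod>i\<in>I. ?N P' (c' j) i)))"
      proof (intro sum_mono mult_left_mono a)
        fix j assume j: "j \<in> L"
        show "cmod (\<Sum>u\<in>P' \<rightarrow>\<^sub>E L. (\<Prod>i\<in>I. c' j i (restrict u (?blk P' i))) * m P' u)
          \<le> fact (card P') * (\<Prod>i\<in>I. ?N P' (c' j) i)"
        proof (rule less.hyps)
          show "card P' < card P" using cP' by simp
          show "finite P'" by fact
          show "\<beta> ` P' \<subseteq> I" using less.prems(2) by (auto simp: P'_def)
          fix i u z w
          assume h: "i \<in> I" "u \<in> ?blk P' i \<rightarrow>\<^sub>E L" "z \<in> P'" "w \<in> P'" "\<beta> z = i" "\<beta> w = i" "z \<noteq> w" "u w = - u z"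
          have zw: "z \<in> P" "w \<in> P" "z \<noteq> x" "z \<noteq> y" "w \<noteq> x" "w \<noteq> y" using h by (auto simp: P'_def)
          consider "i = i0" | "i = l" "i \<noteq> i0" | "i \<noteq> i0" "i \<noteq> l" by blast
          then show "c' j i u = 0"
          proof cases
            case 1
            have "u(x := j) \<in> ?blk P i0 \<rightarrow>\<^sub>E L"
              unfolding blk using h(2) j unfolding 1 by (rule PiE_fun_upd[rotated])
            then have "c i0 (u(x := j)) = 0"
              by (rule less.prems(3)[rotated, of _ _ z w]) (use h zw 1 in auto)
            then show ?thesis by (simp add: c'_def 1)
          next
            case 2
            have "u(y := -j) \<in> ?blk P l \<rightarrow>\<^sub>E L"
              unfolding blk using h(2) L(2)[OF j] unfolding 2 by (rule PiE_fun_upd[rotated])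
            then have "c l (u(y := -j)) = 0"
              by (rule less.prems(3)[rotated, of _ _ z w]) (use h zw 2 in auto)
            then show ?thesis using 2 by (simp add: c'_def)
          next
            case 3
            then have "u \<in> ?blk P i \<rightarrow>\<^sub>E L" using h blk by auto
            then have "c i u = 0"
              by (rule less.prems(3)[rotated, of _ _ z w]) (use h zw 3 in auto)
            then show ?thesis using 3 by (simp add: c'_def)
          qed
        qed
      qed
      also have "\<dots> = fact (card P') * (\<Prod>i\<in>I-{i0,l}. ?N P c i) *
          (\<Sum>j\<in>L. \<bar>?s j\<bar> * \<bar>?t j\<bar>)"
        unfolding sum_distrib_left
      proof (rule sum.cong[OF refl])
        fix j assume j: "j \<in> L"
        have "(\<Prod>i\<in>I. ?N P' (c' j) i) = ?N P' (c' j) i0 * (?N P' (c' j) l * (\<Prod>i\<in>I-{i0,l}. ?N P' (c' j) i))"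
        proof -
          have "I - {i0} - {l} = I - {i0, l}" by auto
          then show ?thesis
            using I il by (simp add: prod.remove[of I i0] prod.remove[of "I - {i0}" l])
        qed
        also have "(\<Prod>i\<in>I-{i0,l}. ?N P' (c' j) i) = (\<Prod>i\<in>I-{i0,l}. ?N P c i)"
        proof (rule prod.cong[OF refl])
          fix i assume "i \<in> I - {i0, l}"
          then have "i \<noteq> i0" "i \<noteq> l" by auto
          then have "?blk P i = ?blk P' i" "c' j i = c i"
            using blk(3) by (auto simp: c'_def fun_eq_iff)
          then show "?N P' (c' j) i = ?N P c i" by simp
        qed
        finally have 1: "(\<Prod>i\<in>I. ?N P' (c' j) i) = ?N P' (c' j) i0 * (?N P' (c' j) l * (\<Prod>i\<in>I-{i0,l}. ?N P c i))" .
        have 2: "\<bar>?s j\<bar> * \<bar>?t j\<bar>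
          = a j * (?N P' (c' j) i0 * ?N P' (c' j) l)"
        proof -
          have sq: "\<bar>sqrt (r * p)\<bar> * \<bar>sqrt (r * q)\<bar> = r * (sqrt p * sqrt q)"
            if "r \<ge> 0" "p \<ge> 0" "q \<ge> 0" for r p q :: real
          proof -
            have "\<bar>sqrt (r * p)\<bar> * \<bar>sqrt (r * q)\<bar> = (sqrt r * sqrt r) * (sqrt p * sqrt q)"
              using that by (simp add: real_sqrt_mult)
            then show ?thesis using that by simp
          qed
          show ?thesis
            by (rule sq[OF a(1)[OF j] wnorm2_nonneg[OF a(1)] wnorm2_nonneg[OF a(1)]])
        qed
        show "a j * (fact (card P') * (\<Prod>i\<in>I. ?N P' (c' j) i)) = fact (card P') * (\<Prod>i\<in>I-{i0,l}. ?N P c i) *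
          (\<bar>?s j\<bar> * \<bar>?t j\<bar>)"
          unfolding 1 2 by (simp only: mult_ac)
      qed
      also have "\<dots> \<le> fact (card P') * (\<Prod>i\<in>I-{i0,l}. ?N P c i) * (?N P c i0 * ?N P c l)"
      proof (intro mult_left_mono)
        have "(\<Sum>j\<in>L. \<bar>?s j\<bar> * \<bar>?t j\<bar>)
         \<le> L2_set ?s L * L2_set ?t L"
          by (rule L2_set_mult_ineq)
        also have "L2_set ?s L = ?N P c i0"
        proof -
          have "wnorm2 L a (?blk P i0) (c i0) = (\<Sum>j\<in>L. a j * ?m j)"
            unfolding blk using P'(1,2) by (subst wnorm2_insert) (auto simp: c'0)
          moreover have "(\<Sum>j\<in>L. (?s j)\<^sup>2) = (\<Sum>j\<in>L. a j * ?m j)"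
            by (intro sum.cong refl real_sqrt_pow2 mult_nonneg_nonneg a(1) wnorm2_nonneg)
          ultimately show ?thesis by (simp add: L2_set_def)
        qed
        also have "L2_set ?t L = ?N P c l"
        proof -
          have "wnorm2 L a (?blk P l) (c l) = (\<Sum>k\<in>L. a k * wnorm2 L a (?blk P' l) (\<lambda>v. c l (v(y := k))))"
            unfolding blk using P'(1,3) by (subst wnorm2_insert) auto
          also have "\<dots> = (\<Sum>j\<in>L. a j * ?n j)"
            by (rule sum.reindex_bij_witness[of _ uminus uminus]) (use L a(2) in \<open>auto simp: c'l\<close>)
          finally have "wnorm2 L a (?blk P l) (c l) = (\<Sum>j\<in>L. a j * ?n j)" .
          moreover have "(\<Sum>j\<in>L. (?t j)\<^sup>2) = (\<Sum>j\<in>L. a j * ?n j)"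
            by (intro sum.cong refl real_sqrt_pow2 mult_nonneg_nonneg a(1) wnorm2_nonneg)
          ultimately show ?thesis by (simp add: L2_set_def)
        qed
        finally show "(\<Sum>j\<in>L. \<bar>?s j\<bar> * \<bar>?t j\<bar>)
          \<le> ?N P c i0 * ?N P c l" .
        show "0 \<le> fact (card P') * (\<Prod>i\<in>I-{i0,l}. ?N P c i)"
          using N0 by (intro mult_nonneg_nonneg prod_nonneg) auto
      qed
      also have "\<dots> = fact (card P') * (\<Prod>i\<in>I. ?N P c i)"
      proof -
        have "I - {i0} - {l} = I - {i0, l}" by auto
        then have "(\<Prod>i\<in>I. ?N P c i) = ?N P c i0 * (?N P c l * (\<Prod>i\<in>I-{i0,l}. ?N P c i))"
          using I il by (simp add: prod.remove[of I i0] prod.remove[of "I - {i0}" l])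
        then show ?thesis by (simp only: mult_ac)
      qed
      finally show ?thesis using cP' by simp
    qed
    have "cmod (\<Sum>y\<in>P-{x}. S y) \<le> (\<Sum>y\<in>P-{x}. fact (card P - 2) * (\<Prod>i\<in>I. ?N P c i))"
      using Sy by (intro sum_norm_le) auto
    also have "\<dots> = (real (card P - 1) * fact (card P - 2)) * (\<Prod>i\<in>I. ?N P c i)"
      using x finP by simp
    \<comment> \<open>There are \<open>card P - 1\<close> partners for \<open>x\<close>, and (n - 1)
      (n - 2)! is at most n!. The factorial is a crude count of pairings, but it depends only on the
      number of arguments.\<close>
    also have "\<dots> \<le> fact (card P) * (\<Prod>i\<in>I. ?N P c i)"
    proof (intro mult_right_mono prod_nonneg N0)
      have "card P \<noteq> 0" using x finP by auto
      then obtain n where n: "card P = Suc n" using not0_implies_Suc by blast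
      show "real (card P - 1) * fact (card P - 2) \<le> fact (card P)"
      proof (cases n)
        case 0
        then show ?thesis by (simp add: n)
      next
        case (Suc k)
        have "real (Suc k) * fact k = fact (Suc k)" by (rule fact_Suc[symmetric])
        also have "\<dots> \<le> fact (Suc (Suc k))" by (rule fact_mono) simp
        finally show ?thesis by (simp only: n Suc diff_Suc_1 numeral_2_eq_2 diff_Suc_Suc diff_zero)
      qed
    qed
    finally show ?thesis unfolding split .
  qed
qed

section \<open>Tensor products on powers of the line\<close>

interpretation lborel_product: product_sigma_finite "\<lambda>_. lborel :: real measure" ..

abbreviation lborel_on :: "'i set \<Rightarrow> ('i \<Rightarrow> real) measure" where
  "lborel_on I \<equiv> Pi\<^sub>M I (\<lambda>_. lborel)"

lemma distr_lborel_on_reindex: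
  fixes t :: "'j \<Rightarrow> 'i"
  assumes t: "bij_betw t J I" and fin: "finite I"
  shows "distr (lborel_on I) (lborel_on J) (\<lambda>x. \<lambda>j\<in>J. x (t j)) = lborel_on J"
proof (rule lborel_product.PiM_eqI)
  have finJ: "finite J" using bij_betw_finite[OF t] fin by simp
  show "finite J" by fact
  show "sets (distr (lborel_on I) (lborel_on J) (\<lambda>x. \<lambda>j\<in>J. x (t j))) = sets (lborel_on J)" by simp
  have tI: "t j \<in> I" if "j \<in> J" for j using t that by (auto simp: bij_betw_def)
  have meas: "(\<lambda>x. \<lambda>j\<in>J. x (t j)) \<in> lborel_on I \<rightarrow>\<^sub>M lborel_on J"
    by (intro measurable_restrict measurable_component_singleton tI)
  fix A :: "'j \<Rightarrow> real set" assume A: "\<And>i. i \<in> J \<Longrightarrow> A i \<in> sets lborel"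
  let ?s = "inv_into J t"
  have s: "?s (t j) = j" if "j \<in> J" for j using t that by (auto simp: bij_betw_def)
  have "(\<lambda>x. \<lambda>j\<in>J. x (t j)) -` Pi\<^sub>E J A \<inter> space (lborel_on I) = Pi\<^sub>E I (\<lambda>i. A (?s i))"
    using t by (auto simp: space_PiM PiE_def Pi_def bij_betw_def) 
  then have "emeasure (distr (lborel_on I) (lborel_on J) (\<lambda>x. \<lambda>j\<in>J. x (t j))) (Pi\<^sub>E J A)
     = emeasure (lborel_on I) (Pi\<^sub>E I (\<lambda>i. A (?s i)))"
    using A finJ by (subst emeasure_distr[OF meas]) (auto intro!: sets_PiM_I_finite)
  also have "\<dots> = (\<Prod>i\<in>I. emeasure lborel (A (?s i)))"
    using fin A bij_betw_inv_into[OF t] by (intro lborel_product.emeasure_PiM) (auto simp: bij_betw_def)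
  also have "\<dots> = (\<Prod>j\<in>J. emeasure lborel (A j))"
    by (subst prod.reindex_bij_betw[OF t, symmetric]) (simp add: s cong: prod.cong)
  finally show "emeasure (distr (lborel_on I) (lborel_on J) (\<lambda>x. \<lambda>j\<in>J. x (t j))) (Pi\<^sub>E J A)
     = (\<Prod>j\<in>J. emeasure lborel (A j))" .
qed

lemma measurable_reindex:
  assumes "t ` J \<subseteq> I"
  shows "(\<lambda>x. \<lambda>j\<in>J. x (t j)) \<in> lborel_on I \<rightarrow>\<^sub>M lborel_on J"
  using assms by (intro measurable_restrict measurable_component_singleton) auto

lemma nn_integral_lborel_on_reindex:
  assumes t: "bij_betw t J I" "finite I" and f: "f \<in> borel_measurable (lborel_on J)"
  shows "(\<integral>\<^sup>+ x. f (\<lambda>j\<in>J. x (t j)) \<partial>lborel_on I) = (\<integral>\<^sup>+ x. f x \<partial>lborel_on J)"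
proof -
  have "(\<integral>\<^sup>+ x. f x \<partial>lborel_on J) = (\<integral>\<^sup>+ x. f x \<partial>distr (lborel_on I) (lborel_on J) (\<lambda>x. \<lambda>j\<in>J. x (t j)))"
    by (simp add: distr_lborel_on_reindex[OF t])
  also have "\<dots> = (\<integral>\<^sup>+ x. f (\<lambda>j\<in>J. x (t j)) \<partial>lborel_on I)"
    using t f by (intro nn_integral_distr measurable_reindex) (auto simp: bij_betw_def)
  finally show ?thesis by simp
qed

lemma integral_lborel_on_reindex:
  fixes f :: "('j \<Rightarrow> real) \<Rightarrow> complex"
  assumes t: "bij_betw t J I" "finite I" and f: "f \<in> borel_measurable (lborel_on J)"
  shows "(\<integral>x. f (\<lambda>j\<in>J. x (t j)) \<partial>lborel_on I) = (\<integral>x. f x \<partial>lborel_on J)"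
proof -
  have "(\<integral>x. f x \<partial>lborel_on J) = (\<integral>x. f x \<partial>distr (lborel_on I) (lborel_on J) (\<lambda>x. \<lambda>j\<in>J. x (t j)))"
    by (simp add: distr_lborel_on_reindex[OF t])
  also have "\<dots> = (\<integral>x. f (\<lambda>j\<in>J. x (t j)) \<partial>lborel_on I)"
    using t f by (intro integral_distr measurable_reindex) (auto simp: bij_betw_def)
  finally show ?thesis by simp
qed

text \<open>A permutation of \<open>{..<m}\<close> fixes all other indices, so
  \<open>x \<circ> \<pi>\<close> stays extensional and permutations may act by plain
  composition.\<close>

lemma restrict_comp_permutes:
  assumes "\<pi> permutes {..<m}" "x \<in> space (lborel_pow m)"
  shows "(\<lambda>j\<in>{..<m}. x (\<pi> j)) = x \<circ> \<pi>"
  using assms by (auto simp: fun_eq_iff space_PiM PiE_def extensional_def restrict_def permutes_def)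

lemma measurable_permute:
  assumes "\<pi> permutes {..<m}"
  shows "(\<lambda>x. x \<circ> \<pi>) \<in> lborel_pow m \<rightarrow>\<^sub>M lborel_pow m"
proof -
  have "(\<lambda>x. \<lambda>j\<in>{..<m}. x (\<pi> j)) \<in> lborel_pow m \<rightarrow>\<^sub>M lborel_pow m"
    using assms by (intro measurable_reindex) (auto simp: permutes_image)
  then show ?thesis
    by (rule measurable_cong[THEN iffD1, rotated]) (simp add: restrict_comp_permutes[OF assms])
qed

lemma nn_integral_permute:
  assumes \<pi>: "\<pi> permutes {..<m}" and f: "f \<in> borel_measurable (lborel_pow m)"
  shows "(\<integral>\<^sup>+ x. f (x \<circ> \<pi>) \<partial>lborel_pow m) = (\<integral>\<^sup>+ x. f x \<partial>lborel_pow m)"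
  unfolding nn_integral_lborel_on_reindex[OF permutes_imp_bij[OF \<pi>] finite_lessThan f, symmetric]
  by (intro nn_integral_cong) (simp add: restrict_comp_permutes[OF \<pi>])

lemma sqn_permute:
  assumes \<pi>: "\<pi> permutes {..<m}" and f: "f \<in> borel_measurable (lborel_pow m)"
  shows "sqn (lborel_pow m) (\<lambda>x. f (x \<circ> \<pi>)) = sqn (lborel_pow m) f"
proof -
  note f[measurable]
  show ?thesis unfolding sqn_def by (rule nn_integral_permute[OF \<pi>]) measurable
qed

lemma L2_permute: "\<pi> permutes {..<m} \<Longrightarrow> L2 (lborel_pow m) f \<Longrightarrow> L2 (lborel_pow m) (\<lambda>x. f (x \<circ> \<pi>))"
  using sqn_permute[of \<pi> m f] measurable_compose[OF measurable_permute, of \<pi> m f borel]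
  by (auto simp: L2_def)

lemma nrm_eq_sqn: "L2 \<mu> f \<Longrightarrow> nrm \<mu> f = sqrt (enn2real (sqn \<mu> f))"
  by (simp add: sqn_eq_nrm)

lemma L2conv_permute:
  assumes \<pi>: "\<pi> permutes {..<m}" and F: "L2conv (lborel_pow m) F f"
  shows "L2conv (lborel_pow m) (\<lambda>n x. F n (x \<circ> \<pi>)) (\<lambda>x. f (x \<circ> \<pi>))"
proof -
  have L: "\<And>n. L2 (lborel_pow m) (F n)" "L2 (lborel_pow m) f" using F by (auto simp: L2conv_def)
  have "nrm (lborel_pow m) (\<lambda>x. F n (x \<circ> \<pi>) - f (x \<circ> \<pi>)) = nrm (lborel_pow m) (\<lambda>x. F n x - f x)" for n
    using sqn_permute[OF \<pi>, of "\<lambda>x. F n x - f x"] L2_diff[OF L(1)[of n] L(2)]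
      L2_permute[OF \<pi> L2_diff[OF L(1)[of n] L(2)]]
    by (simp add: nrm_eq_sqn L2_measurable)
  then show ?thesis using F by (simp add: L2conv_def L2_permute[OF \<pi>])
qed

definition tens :: "nat \<Rightarrow> nat \<Rightarrow> ((nat \<Rightarrow> real) \<Rightarrow> complex) \<Rightarrow> ((nat \<Rightarrow> real) \<Rightarrow> complex) \<Rightarrow> (nat \<Rightarrow> real) \<Rightarrow> complex" where
  "tens p q f g x = f (restrict x {..<p}) * g (\<lambda>b\<in>{..<q}. x (p + b))"

lemma nn_integral_tens:
  assumes [measurable]: "f \<in> borel_measurable (lborel_pow p)" "g \<in> borel_measurable (lborel_pow q)"
  shows "(\<integral>\<^sup>+ x. f (restrict x {..<p}) * g (\<lambda>b\<in>{..<q}. x (p + b)) \<partial>lborel_pow (p + q))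
    = (\<integral>\<^sup>+ x. f x \<partial>lborel_pow p) * (\<integral>\<^sup>+ x. g x \<partial>lborel_pow q)"
proof -
  have U: "{..<p + q} = {..<p} \<union> {p..<p+q}" by auto
  have bij: "bij_betw ((+) p) {..<q} {p..<p+q}"
    by (rule bij_betw_byWitness[where f' = "\<lambda>x. x - p"]) auto
  have [measurable]: "(\<lambda>x. restrict x {..<p}) \<in> lborel_pow (p + q) \<rightarrow>\<^sub>M lborel_pow p"
    "(\<lambda>x. \<lambda>b\<in>{..<q}. x (p + b)) \<in> lborel_pow (p + q) \<rightarrow>\<^sub>M lborel_pow q"
    by (intro measurable_restrict measurable_component_singleton; simp)+
  have [measurable]: "(\<lambda>x. \<lambda>b\<in>{..<q}. x (p + b)) \<in> lborel_on {p..<p+q} \<rightarrow>\<^sub>M lborel_pow q"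
    by (intro measurable_restrict measurable_component_singleton) auto
  have "(\<integral>\<^sup>+ x. f (restrict x {..<p}) * g (\<lambda>b\<in>{..<q}. x (p + b)) \<partial>lborel_pow (p + q))
     = (\<integral>\<^sup>+ x. \<integral>\<^sup>+ y. f (restrict (merge {..<p} {p..<p+q} (x, y)) {..<p})
          * g (\<lambda>b\<in>{..<q}. merge {..<p} {p..<p+q} (x, y) (p + b)) \<partial>lborel_on {p..<p+q} \<partial>lborel_pow p)"
    unfolding U by (rule lborel_product.product_nn_integral_fold) (auto simp: U[symmetric])
  also have "\<dots> = (\<integral>\<^sup>+ x. \<integral>\<^sup>+ y. f x * g (\<lambda>b\<in>{..<q}. y (p + b)) \<partial>lborel_on {p..<p+q} \<partial>lborel_pow p)"
  proof (intro nn_integral_cong)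
    fix x y assume x: "x \<in> space (lborel_pow p)"
    have "restrict (merge {..<p} {p..<p+q} (x, y)) {..<p} = x"
      using x by (auto simp: merge_def fun_eq_iff space_PiM PiE_def extensional_def)
    moreover have "(\<lambda>b\<in>{..<q}. merge {..<p} {p..<p+q} (x, y) (p + b)) = (\<lambda>b\<in>{..<q}. y (p + b))"
      by (auto simp: merge_def fun_eq_iff)
    ultimately show "f (restrict (merge {..<p} {p..<p+q} (x, y)) {..<p})
          * g (\<lambda>b\<in>{..<q}. merge {..<p} {p..<p+q} (x, y) (p + b)) = f x * g (\<lambda>b\<in>{..<q}. y (p + b))" by simp
  qed
  also have "\<dots> = (\<integral>\<^sup>+ x. f x * (\<integral>\<^sup>+ y. g y \<partial>lborel_pow q) \<partial>lborel_pow p)"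
    by (subst nn_integral_cmult, measurable)
       (simp add: nn_integral_lborel_on_reindex[OF bij _ assms(2)])
  also have "\<dots> = (\<integral>\<^sup>+ x. f x \<partial>lborel_pow p) * (\<integral>\<^sup>+ x. g x \<partial>lborel_pow q)"
    by (rule nn_integral_multc) measurable
  finally show ?thesis .
qed

lemma sqn_tens:
  assumes [measurable]: "f \<in> borel_measurable (lborel_pow p)" "g \<in> borel_measurable (lborel_pow q)"
  shows "sqn (lborel_pow (p + q)) (tens p q f g) = sqn (lborel_pow p) f * sqn (lborel_pow q) g"
  unfolding sqn_def tens_def norm_mult power_mult_distrib
  by (subst nn_integral_tens[symmetric]) (auto simp: ennreal_mult)

lemma measurable_tens:
  assumes [measurable]: "f \<in> borel_measurable (lborel_pow p)" "g \<in> borel_measurable (lborel_pow q)"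
  shows "tens p q f g \<in> borel_measurable (lborel_pow (p + q))"
proof -
  have [measurable]: "(\<lambda>x. restrict x {..<p}) \<in> lborel_pow (p + q) \<rightarrow>\<^sub>M lborel_pow p"
    "(\<lambda>x. \<lambda>b\<in>{..<q}. x (p + b)) \<in> lborel_pow (p + q) \<rightarrow>\<^sub>M lborel_pow q"
    by (intro measurable_restrict measurable_component_singleton; simp)+
  show ?thesis unfolding tens_def by measurable
qed

lemma L2_tens: "L2 (lborel_pow p) f \<Longrightarrow> L2 (lborel_pow q) g \<Longrightarrow> L2 (lborel_pow (p + q)) (tens p q f g)"
  unfolding L2_def by (auto intro!: measurable_tens simp: sqn_tens ennreal_mult_less_top)

lemma nrm_tens:
  assumes f: "L2 (lborel_pow p) f" and g: "L2 (lborel_pow q) g"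
  shows "nrm (lborel_pow (p + q)) (tens p q f g) = nrm (lborel_pow p) f * nrm (lborel_pow q) g"
  using sqn_tens[OF L2_measurable[OF f] L2_measurable[OF g]]
  by (simp add: nrm_eq_sqn f g L2_tens enn2real_mult real_sqrt_mult)

lemma L2conv_tens:
  assumes F: "L2conv (lborel_pow p) F f" and G: "L2conv (lborel_pow q) G g"
  shows "L2conv (lborel_pow (p + q)) (\<lambda>n. tens p q (F n) (G n)) (tens p q f g)"
proof -
  let ?p = "lborel_pow p" and ?q = "lborel_pow q" and ?m = "lborel_pow (p + q)"
  have L: "\<And>n. L2 ?p (F n)" "L2 ?p f" "\<And>n. L2 ?q (G n)" "L2 ?q g"
    using F G by (auto simp: L2conv_def)
  have c: "(\<lambda>n. nrm ?p (\<lambda>x. F n x - f x)) \<longlonglongrightarrow> 0" "(\<lambda>n. nrm ?q (\<lambda>x. G n x - g x)) \<longlonglongrightarrow> 0"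
    using F G by (auto simp: L2conv_def)
  have "(\<lambda>n. nrm ?p (\<lambda>x. F n x - f x) * nrm ?q (G n) + nrm ?p f * nrm ?q (\<lambda>x. G n x - g x))
     \<longlonglongrightarrow> 0 * nrm ?q g + nrm ?p f * 0"
    by (intro tendsto_intros c L2conv_nrm G)
  then have lim: "(\<lambda>n. nrm ?p (\<lambda>x. F n x - f x) * nrm ?q (G n) + nrm ?p f * nrm ?q (\<lambda>x. G n x - g x)) \<longlonglongrightarrow> 0"
    by simp
  have "(\<lambda>n. nrm ?m (\<lambda>x. tens p q (F n) (G n) x - tens p q f g x)) \<longlonglongrightarrow> 0"
  proof (rule Lim_null_comparison[OF _ lim], rule always_eventually, rule allI)
    fix n
    have "(\<lambda>x. tens p q (F n) (G n) x - tens p q f g x)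
       = (\<lambda>x. tens p q (\<lambda>x. F n x - f x) (G n) x + tens p q f (\<lambda>x. G n x - g x) x)"
      by (auto simp: tens_def algebra_simps)
    then have "nrm ?m (\<lambda>x. tens p q (F n) (G n) x - tens p q f g x)
       \<le> nrm ?m (tens p q (\<lambda>x. F n x - f x) (G n)) + nrm ?m (tens p q f (\<lambda>x. G n x - g x))"
      using nrm_triangle[of ?m "tens p q (\<lambda>x. F n x - f x) (G n)" "tens p q f (\<lambda>x. G n x - g x)"]
      by (simp add: L2_tens L2_diff L)
    also have "\<dots> = nrm ?p (\<lambda>x. F n x - f x) * nrm ?q (G n) + nrm ?p f * nrm ?q (\<lambda>x. G n x - g x)"
      by (simp add: nrm_tens L2_diff L)
    finally show "norm (nrm ?m (\<lambda>x. tens p q (F n) (G n) x - tens p q f g x)) \<le> \<dots>"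
      by simp
  qed
  then show ?thesis by (simp add: L2conv_def L2_tens L)
qed

section \<open>Isometry for sums of product kernels\<close>

text \<open>The boxes of different terms may be unrelated and may meet the hyper-diagonals. This
  class, unlike that of elementary kernels, is visibly closed under tensor products and under
  cutting by a grid.\<close>

definition skernel :: "nat \<Rightarrow> 'i set \<Rightarrow> ('i \<Rightarrow> complex) \<Rightarrow> ('i \<Rightarrow> nat \<Rightarrow> real set) \<Rightarrow> (nat \<Rightarrow> real) \<Rightarrow> complex" where
  "skernel m I e D x = (\<Sum>i\<in>I. e i * (\<Prod>b<m. indicator (D i b) (x b)))"

definition sint :: "(real set \<Rightarrow> 'a \<Rightarrow> complex) \<Rightarrow> nat \<Rightarrow> 'i set \<Rightarrow> ('i \<Rightarrow> complex) \<Rightarrow> ('i \<Rightarrow> nat \<Rightarrow> real set) \<Rightarrow> 'a \<Rightarrow> complex" where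
  "sint W m I e D \<omega> = (\<Sum>i\<in>I. e i * (\<Prod>b<m. W (D i b) \<omega>))"

lemma elementary_kernel_skernel: "elementary_kernel m N A c = skernel m (offdiag m N) c (\<lambda>u b. A (u b))"
  by (auto simp: elementary_kernel_def skernel_def)

lemma elementary_integral_sint: "elementary_integral W m N A c = sint W m (offdiag m N) c (\<lambda>u b. A (u b))"
  by (auto simp: elementary_integral_def sint_def)

lemma prod_lessThan_add: "(\<Prod>b<p + q. f b) = (\<Prod>b<p. f b) * (\<Prod>b<q. f (p + b :: nat))"
  for f :: "nat \<Rightarrow> 'b::comm_monoid_mult"
  by (induction q) (auto simp: mult.assoc)

lemma tens_skernel:
  "tens p q (skernel p I e A) (skernel q I' e' B) =
    skernel (p + q) (I \<times> I') (\<lambda>(i, i'). e i * e' i') (\<lambda>(i, i') b. if b < p then A i b else B i' (b - p))"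
proof
  fix x
  have "tens p q (skernel p I e A) (skernel q I' e' B) x =
    (\<Sum>i\<in>I. e i * (\<Prod>b<p. indicator (A i b) (x b))) * (\<Sum>i\<in>I'. e' i * (\<Prod>b<q. indicator (B i b) (x (p + b))))"
    by (simp add: tens_def skernel_def)
  also have "\<dots> = (\<Sum>(i, i')\<in>I \<times> I'. (e i * e' i') * ((\<Prod>b<p. indicator (A i b) (x b)) * (\<Prod>b<q. indicator (B i' b) (x (p + b)))))"
    by (simp add: sum_product sum.cartesian_product mult_ac)
  finally show "tens p q (skernel p I e A) (skernel q I' e' B) x = skernel (p + q) (I \<times> I') (\<lambda>(i, i'). e i * e' i')
     (\<lambda>(i, i') b. if b < p then A i b else B i' (b - p)) x"
    by (simp add: skernel_def prod_lessThan_add case_prod_unfold)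
qed

lemma sint_mult:
  "sint W p I e A \<omega> * sint W q I' e' B \<omega> =
    sint W (p + q) (I \<times> I') (\<lambda>(i, i'). e i * e' i') (\<lambda>(i, i') b. if b < p then A i b else B i' (b - p)) \<omega>"
proof -
  have "sint W p I e A \<omega> * sint W q I' e' B \<omega> =
    (\<Sum>(i, i')\<in>I \<times> I'. (e i * e' i') * ((\<Prod>b<p. W (A i b) \<omega>) * (\<Prod>b<q. W (B i' b) \<omega>)))"
    by (simp add: sint_def sum_product sum.cartesian_product mult_ac)
  then show ?thesis
    by (simp add: sint_def prod_lessThan_add case_prod_unfold)
qed

lemma box_integral:
  assumes C: "\<And>b. b < m \<Longrightarrow> C b \<in> fin_borel"
  shows "integrable (lborel_pow m) (\<lambda>x. \<Prod>b<m. indicator (C b) (x b) :: complex)"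
    and "(\<integral>x. (\<Prod>b<m. indicator (C b) (x b) :: complex) \<partial>lborel_pow m) = of_real (\<Prod>b<m. measure lborel (C b))"
proof -
  have i: "integrable lborel (indicator (C b) :: real \<Rightarrow> complex)"
    and v: "integral\<^sup>L lborel (indicator (C b) :: real \<Rightarrow> complex) = of_real (measure lborel (C b))" if "b < m" for b
  proof -
    have ir: "integrable lborel (indicator (C b) :: real \<Rightarrow> real)"
      using C[OF that] by (auto simp: fin_borel_def)
    have eq: "(indicator (C b) :: real \<Rightarrow> complex) = (\<lambda>x. of_real (indicator (C b) x))"
      by (auto simp: fun_eq_iff indicator_def)
    show "integrable lborel (indicator (C b) :: real \<Rightarrow> complex)"
      unfolding eq using ir by (rule integrable_of_real)
    show "integral\<^sup>L lborel (indicator (C b) :: real \<Rightarrow> complex) = of_real (measure lborel (C b))"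
      unfolding eq by simp
  qed
  show "integrable (lborel_pow m) (\<lambda>x. \<Prod>b<m. indicator (C b) (x b) :: complex)"
    by (rule lborel_product.product_integrable_prod) (use i in auto)
  show "(\<integral>x. (\<Prod>b<m. indicator (C b) (x b) :: complex) \<partial>lborel_pow m) = of_real (\<Prod>b<m. measure lborel (C b))"
    by (subst lborel_product.product_integral_prod) (use i v in auto)
qed

lemma box_L2:
  assumes C: "\<And>b. b < m \<Longrightarrow> C b \<in> fin_borel"
  shows "L2 (lborel_pow m) (\<lambda>x. \<Prod>b<m. indicator (C b) (x b) :: complex)"
proof -
  note i = box_integral(1)[of m C, OF C]
  have "(cmod (\<Prod>b<m. indicator (C b) (x b)))\<^sup>2 = cmod (\<Prod>b<m. indicator (C b) (x b))" for x
  proof -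
    have sq: "(cmod z)\<^sup>2 = cmod z" if "z = 0 \<or> z = 1" for z using that by auto
    have "(\<Prod>b<m. indicator (C b) (x b) :: complex) = 0 \<or> (\<Prod>b<m. indicator (C b) (x b) :: complex) = 1"
      by (induction m) (auto simp: indicator_def)
    then show ?thesis by (rule sq)
  qed
  then show ?thesis
    using i integrable_norm[OF i] by (simp add: L2_iff borel_measurable_integrable)
qed

lemma skernel_L2:
  assumes "finite I" "\<And>i b. i \<in> I \<Longrightarrow> b < m \<Longrightarrow> D i b \<in> fin_borel"
  shows "L2 (lborel_pow m) (skernel m I e D)"
  unfolding skernel_def by (intro L2_sum L2_cmult box_L2 assms)

lemma fin_borel_Int: "A \<in> fin_borel \<Longrightarrow> B \<in> sets borel \<Longrightarrow> A \<inter> B \<in> fin_borel"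
  using emeasure_mono[of "A \<inter> B" A lborel] by (auto simp: fin_borel_def intro: le_less_trans)

lemma skernel_permute:
  assumes "\<pi> permutes {..<m}"
  shows "skernel m I e D (x \<circ> \<pi>) = skernel m I e (\<lambda>i b. D i (inv \<pi> b)) x"
proof -
  have "(\<Prod>b<m. indicator (D i b) (x (\<pi> b)) :: complex) = (\<Prod>b<m. indicator (D i (inv \<pi> b)) (x b))" for i
    using prod.permute[OF assms, of "\<lambda>b. indicator (D i (inv \<pi> b)) (x b) :: complex"]
    by (simp add: comp_def permutes_inverses(2)[OF assms])
  then show ?thesis by (simp add: skernel_def)
qed

lemma cnj_indicator: "cnj (indicator A x) = indicator A x"
  by (simp add: indicator_def)

lemma skernel_ip:
  assumes I: "finite I" "finite I'"
    and A: "\<And>i b. i \<in> I \<Longrightarrow> b < m \<Longrightarrow> A i b \<in> fin_borel"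
    and D: "\<And>i b. i \<in> I' \<Longrightarrow> b < m \<Longrightarrow> D i b \<in> fin_borel"
  shows "ip (lborel_pow m) (skernel m I e A) (skernel m I' e' D)
    = (\<Sum>i\<in>I. \<Sum>i'\<in>I'. e i * cnj (e' i') * of_real (\<Prod>b<m. measure lborel (A i b \<inter> D i' b)))"
proof -
  have eq: "skernel m I e A x * cnj (skernel m I' e' D x) =
    (\<Sum>i\<in>I. \<Sum>i'\<in>I'. e i * cnj (e' i') * (\<Prod>b<m. indicator (A i b \<inter> D i' b) (x b)))" for x
    by (simp add: skernel_def sum_product indicator_inter_arith prod.distrib mult_ac cnj_indicator)
  have C: "A i b \<inter> D i' b \<in> fin_borel" if "i \<in> I" "i' \<in> I'" "b < m" for i i' b
    using A[OF that(1,3)] D[OF that(2,3)] by (intro fin_borel_Int) (auto simp: fin_borel_def)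
  note int = box_integral[of m "\<lambda>b. A i b \<inter> D i' b" for i i', OF C]
  show ?thesis
    unfolding ip_def eq
    by (simp add: Bochner_Integration.integral_sum int)
qed

context hermitian_gaussian_random_measure begin

lemma sint_allmom:
  assumes "\<And>i b. i \<in> I \<Longrightarrow> b < m \<Longrightarrow> D i b \<in> fin_borel"
  shows "allmom M (sint W m I e D)"
  unfolding sint_def by (intro allmom_sum allmom_cmult allmom_prod W_allmom assms) auto

text \<open>The sesquilinear expansion of \<open>W_pairing\<close>. Only the second family has to be
  free of internal pairings; the first one is arbitrary, as products of approximants
  require.\<close>

lemma sint_ip:
  assumes I: "finite I" "finite I'"
    and A: "\<And>i b. i \<in> I \<Longrightarrow> b < m \<Longrightarrow> A i b \<in> fin_borel"
    and D: "\<And>i b. i \<in> I' \<Longrightarrow> b < m \<Longrightarrow> D i b \<in> fin_borel"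
    and off: "\<And>i b b'. i \<in> I' \<Longrightarrow> b < m \<Longrightarrow> b' < m \<Longrightarrow> b \<noteq> b' \<Longrightarrow> measure lborel (D i b \<inter> uminus ` D i b') = 0"
  shows "ip M (sint W m I e A) (sint W m I' e' D)
    = (\<Sum>\<pi> | \<pi> permutes {..<m}. ip (lborel_pow m) (\<lambda>x. skernel m I e A (x \<circ> \<pi>)) (skernel m I' e' D))"
proof -
  have eq: "sint W m I e A \<omega> * cnj (sint W m I' e' D \<omega>) =
    (\<Sum>i\<in>I. \<Sum>i'\<in>I'. e i * cnj (e' i') * ((\<Prod>b<m. W (A i b) \<omega>) * cnj (\<Prod>b<m. W (D i' b) \<omega>)))" for \<omega>
    by (simp add: sint_def sum_product mult_ac)
  have int: "integrable M (\<lambda>\<omega>. (\<Prod>b<m. W (A i b) \<omega>) * cnj (\<Prod>b<m. W (D i' b) \<omega>))"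
    if "i \<in> I" "i' \<in> I'" for i i'
    by (intro allmom_integrable allmom_mult allmom_cnj allmom_prod W_allmom A D that) auto
  have "ip M (sint W m I e A) (sint W m I' e' D)
    = (\<Sum>i\<in>I. \<Sum>i'\<in>I'. e i * cnj (e' i') * expectation (\<lambda>\<omega>. (\<Prod>b<m. W (A i b) \<omega>) * cnj (\<Prod>b<m. W (D i' b) \<omega>)))"
    unfolding ip_def eq by (simp add: Bochner_Integration.integral_sum int del: cnj_prod)
  also have "\<dots> = (\<Sum>i\<in>I. \<Sum>i'\<in>I'. e i * cnj (e' i') *
      of_real (\<Sum>\<pi> | \<pi> permutes {..<m}. \<Prod>b<m. measure lborel (A i (\<pi> b) \<inter> D i' b)))"
    by (intro sum.cong refl arg_cong2[where f = "(*)"] W_pairing A D off) auto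
  \<comment> \<open>Permuting the variables by \<pi> permutes the sides of the boxes by its inverse,
    see \<open>skernel_permute\<close>.\<close>
  also have "\<dots> = (\<Sum>i\<in>I. \<Sum>i'\<in>I'. e i * cnj (e' i') *
      of_real (\<Sum>\<pi> | \<pi> permutes {..<m}. \<Prod>b<m. measure lborel (A i (inv \<pi> b) \<inter> D i' b)))"
    by (subst sum_permutations_inverse) simp
  also have "\<dots> = (\<Sum>i\<in>I. \<Sum>\<pi> | \<pi> permutes {..<m}. \<Sum>i'\<in>I'. e i * cnj (e' i') *
      of_real (\<Prod>b<m. measure lborel (A i (inv \<pi> b) \<inter> D i' b)))"
    by (subst sum.swap) (simp add: sum_distrib_left)
  also have "\<dots> = (\<Sum>\<pi> | \<pi> permutes {..<m}. \<Sum>i\<in>I. \<Sum>i'\<in>I'. e i * cnj (e' i') *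
      of_real (\<Prod>b<m. measure lborel (A i (inv \<pi> b) \<inter> D i' b)))"
    by (rule sum.swap)
  also have "\<dots> = (\<Sum>\<pi> | \<pi> permutes {..<m}. ip (lborel_pow m) (\<lambda>x. skernel m I e A (x \<circ> \<pi>)) (skernel m I' e' D))"
  proof (rule sum.cong[OF refl])
    fix \<pi> assume "\<pi> \<in> {\<pi>. \<pi> permutes {..<m}}"
    then have \<pi>: "\<pi> permutes {..<m}" by simp
    have iv: "inv \<pi> b < m" if "b < m" for b
      using permutes_in_image[OF permutes_inv[OF \<pi>], of b] that by simp
    show "(\<Sum>i\<in>I. \<Sum>i'\<in>I'. e i * cnj (e' i') * of_real (\<Prod>b<m. measure lborel (A i (inv \<pi> b) \<inter> D i' b)))
      = ip (lborel_pow m) (\<lambda>x. skernel m I e A (x \<circ> \<pi>)) (skernel m I' e' D)"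
      unfolding skernel_permute[OF \<pi>]
      by (rule skernel_ip[symmetric, OF I]) (use A D iv in auto)
  qed
  finally show ?thesis .
qed

end

section \<open>Fourth moments of elementary integrals\<close>

lemma finite_sym_idx[simp]: "finite (sym_idx N)"
  by (simp add: sym_idx_def)

lemma uminus_sym_idx: "j \<in> sym_idx N \<Longrightarrow> - j \<in> sym_idx N"
  by (auto simp: sym_idx_def)

lemma offdiag_sub: "offdiag m N \<subseteq> {..<m} \<rightarrow>\<^sub>E sym_idx N"
  by (auto simp: offdiag_def)

lemma finite_offdiag[simp]: "finite (offdiag m N)"
  by (rule finite_subset[OF offdiag_sub]) (auto intro: finite_PiE)

lemma offdiag_mem: "u \<in> offdiag m N \<Longrightarrow> p < m \<Longrightarrow> u p \<in> sym_idx N"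
  by (auto simp: offdiag_def PiE_def Pi_def)

text \<open>Extension by zero lets the sums run over all index tuples, as in
  \<open>diagram_bound\<close>, and encodes the exclusion of hyper-diagonals in the
  coefficients.\<close>

definition ext_coeff :: "nat \<Rightarrow> nat \<Rightarrow> ((nat \<Rightarrow> int) \<Rightarrow> complex) \<Rightarrow> (nat \<Rightarrow> int) \<Rightarrow> complex" where
  "ext_coeff N m c u = (if u \<in> offdiag m N then c u else 0)"

context
  fixes N :: nat and A :: "int \<Rightarrow> real set"
  assumes A: "symmetric_system N A"
begin

lemma symmetric_system_fin: "j \<in> sym_idx N \<Longrightarrow> A j \<in> fin_borel"
  and symmetric_system_uminus: "j \<in> sym_idx N \<Longrightarrow> A (- j) = uminus ` A j"
  and symmetric_system_disj: "i \<in> sym_idx N \<Longrightarrow> j \<in> sym_idx N \<Longrightarrow> i \<noteq> j \<Longrightarrow> A i \<inter> A j = {}"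
  using A by (auto simp: symmetric_system_def disjoint_family_on_def)

lemma symmetric_system_measure_uminus:
  "j \<in> sym_idx N \<Longrightarrow> measure lborel (A (- j)) = measure lborel (A j)"
  using symmetric_system_fin[of j]
  by (simp add: symmetric_system_uminus measure_uminus_image fin_borel_def)

lemma symmetric_system_cov:
  assumes "i \<in> sym_idx N" "j \<in> sym_idx N"
  shows "measure lborel (A i \<inter> uminus ` A j) = (if j = - i then measure lborel (A i) else 0)"
proof (cases "j = - i")
  case True
  then show ?thesis using assms(1) by (simp add: symmetric_system_uminus uminus_uminus_image)
next
  case False
  then have "A i \<inter> A (- j) = {}"
    by (intro symmetric_system_disj assms uminus_sym_idx) auto
  then show ?thesis using False assms by (simp add: symmetric_system_uminus[symmetric])
qed

lemma elementary_kernel_L2: "L2 (lborel_pow m) (elementary_kernel m N A c)"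
  unfolding elementary_kernel_skernel
  by (rule skernel_L2) (auto intro: symmetric_system_fin offdiag_mem)

text \<open>Different index tuples belong to disjoint boxes, so only the diagonal terms of the
  double sum survive.\<close>

lemma elementary_kernel_nrm:
  "(nrm (lborel_pow m) (elementary_kernel m N A c))\<^sup>2
    = wnorm2 (sym_idx N) (\<lambda>j. measure lborel (A j)) {..<m} (ext_coeff N m c)"
proof -
  have zero: "(\<Prod>b<m. measure lborel (A (u b) \<inter> A (v b))) = (if u = v then \<Prod>b<m. measure lborel (A (u b)) else 0)"
    if u: "u \<in> offdiag m N" and v: "v \<in> offdiag m N" for u v
  proof (cases "u = v")
    case False
    then obtain b where "u b \<noteq> v b" by auto
    moreover have b: "b < m"
    proof (rule ccontr)
      assume "\<not> b < m"
      then have "u b = undefined" "v b = undefined"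
        using u v by (auto simp: offdiag_def PiE_def extensional_def)
      then show False using \<open>u b \<noteq> v b\<close> by simp
    qed
    ultimately have "A (u b) \<inter> A (v b) = {}"
      using u v by (intro symmetric_system_disj) (auto intro: offdiag_mem)
    then have "measure lborel (A (u b) \<inter> A (v b)) = 0" by simp
    then show ?thesis using False b by (auto intro!: prod_zero)
  qed simp
  have "complex_of_real ((nrm (lborel_pow m) (elementary_kernel m N A c))\<^sup>2)
     = ip (lborel_pow m) (elementary_kernel m N A c) (elementary_kernel m N A c)"
    by (rule ip_self[symmetric])
  also have "\<dots> = (\<Sum>u\<in>offdiag m N. \<Sum>v\<in>offdiag m N. c u * cnj (c v) * of_real (\<Prod>b<m. measure lborel (A (u b) \<inter> A (v b))))"
    unfolding elementary_kernel_skernel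
    by (rule skernel_ip) (auto intro: symmetric_system_fin offdiag_mem)
  also have "\<dots> = (\<Sum>u\<in>offdiag m N. \<Sum>v\<in>offdiag m N. if u = v then c u * cnj (c u) * of_real (\<Prod>b<m. measure lborel (A (u b))) else 0)"
    by (intro sum.cong refl) (simp add: zero)
  also have "\<dots> = (\<Sum>u\<in>offdiag m N. of_real ((cmod (c u))\<^sup>2 * (\<Prod>b<m. measure lborel (A (u b)))))"
    by (intro sum.cong refl) (simp add: sum.delta complex_norm_square[symmetric])
  also have "\<dots> = of_real (\<Sum>u\<in>offdiag m N. (cmod (c u))\<^sup>2 * (\<Prod>b<m. measure lborel (A (u b))))"
    by simp
  also have "(\<Sum>u\<in>offdiag m N. (cmod (c u))\<^sup>2 * (\<Prod>b<m. measure lborel (A (u b))))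
     = wnorm2 (sym_idx N) (\<lambda>j. measure lborel (A j)) {..<m} (ext_coeff N m c)"
    unfolding wnorm2_def ext_coeff_def using offdiag_sub
    by (intro sum.mono_neutral_cong_left) (auto intro: finite_PiE)
  finally show ?thesis using of_real_eq_iff by blast
qed

end

context hermitian_gaussian_random_measure begin

lemma elementary_integral_allmom:
  "symmetric_system N A \<Longrightarrow> allmom M (elementary_integral W m N A c)"
  unfolding elementary_integral_sint
  by (rule sint_allmom) (auto intro: symmetric_system_fin offdiag_mem)

text \<open>Conjugation negates every index, which permutes \<open>offdiag\<close>, and the
  coefficients follow by Hermitian symmetry. Because the integral is almost surely real, its fourth
  absolute moment is a plain fourth moment and Wick's formula applies to it.\<close>

lemma elementary_integral_real:
  assumes A: "symmetric_system N A" and c: "hermitian_coeffs m N c"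
  shows "AE \<omega> in M. cnj (elementary_integral W m N A c \<omega>) = elementary_integral W m N A c \<omega>"
proof -
  have "AE \<omega> in M. \<forall>j\<in>sym_idx N. cnj (W (A j) \<omega>) = W (A (- j)) \<omega>"
    using W_cnj[OF symmetric_system_fin[OF A]]
    by (intro AE_finite_allI) (auto simp: symmetric_system_uminus[OF A])
  then show ?thesis
  proof eventually_elim
    case (elim \<omega>)
    define neg :: "(nat \<Rightarrow> int) \<Rightarrow> nat \<Rightarrow> int" where "neg u = (\<lambda>p\<in>{..<m}. - u p)" for u
    have neg: "neg u \<in> offdiag m N" "neg (neg u) = u" if "u \<in> offdiag m N" for u
    proof -
      have "- u p \<noteq> u q" if "p < m" "q < m" "p \<noteq> q" for p q
      proof -
        have "u q \<noteq> - u p" using \<open>u \<in> offdiag m N\<close> that by (auto simp: offdiag_def)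
        then show ?thesis by simp
      qed
      then show "neg u \<in> offdiag m N"
        using that uminus_sym_idx[OF offdiag_mem[OF that]] by (auto simp: offdiag_def neg_def)
      show "neg (neg u) = u"
        using that by (auto simp: offdiag_def neg_def fun_eq_iff PiE_def extensional_def)
    qed
    have "cnj (elementary_integral W m N A c \<omega>) = (\<Sum>u\<in>offdiag m N. cnj (c u) * (\<Prod>p<m. cnj (W (A (u p)) \<omega>)))"
      by (simp add: elementary_integral_def)
    also have "\<dots> = (\<Sum>u\<in>offdiag m N. c (neg u) * (\<Prod>p<m. W (A (neg u p)) \<omega>))"
    proof (intro sum.cong refl arg_cong2[where f = "(*)"] prod.cong)
      fix u assume u: "u \<in> offdiag m N"
      show "cnj (c u) = c (neg u)" using c u by (auto simp: hermitian_coeffs_def neg_def)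
      fix p assume "p \<in> {..<m}"
      then show "cnj (W (A (u p)) \<omega>) = W (A (neg u p)) \<omega>"
        using elim offdiag_mem[OF u, of p] by (auto simp: neg_def)
    qed
    also have "\<dots> = elementary_integral W m N A c \<omega>"
      unfolding elementary_integral_def
      by (rule sum.reindex_bij_witness[of _ neg neg]) (auto simp: neg)
    finally show ?case .
  qed
qed

text \<open>The fourth power is a sum over 4k arguments in four blocks, one for each copy of the
  integral, and every block norm in \<open>diagram_bound\<close> is the kernel norm. What matters is
  that the constant depends on k alone and not on the symmetric system.\<close>

lemma elementary_integral_fourth_moment:
  assumes A: "symmetric_system N A" and c: "hermitian_coeffs k N c"
  shows "expectation (\<lambda>\<omega>. cmod (elementary_integral W k N A c \<omega>) ^ 4)
    \<le> fact (4 * k) * nrm (lborel_pow k) (elementary_kernel k N A c) ^ 4"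
proof -
  let ?L = "sym_idx N" and ?a = "\<lambda>j. measure lborel (A j)"
  let ?F = "elementary_integral W k N A c"
  let ?c0 = "ext_coeff N k c"
  \<comment> \<open>The pair \<open>(p, i)\<close> stands for the variable \<open>p\<close> of the
    copy \<open>i\<close>, so \<open>snd\<close> is the block map.\<close>
  define P where "P = {..<k} \<times> {..<4::nat}"
  define cc :: "nat \<Rightarrow> (nat \<times> nat \<Rightarrow> int) \<Rightarrow> complex" where "cc i w = ?c0 (\<lambda>p\<in>{..<k}. w (p, i))" for i w
  define m where "m Q u = expectation (\<lambda>\<omega>. \<Prod>x\<in>Q. W (A (u x)) \<omega>)" for Q :: "(nat \<times> nat) set" and u
  have Ffull: "?F \<omega> = (\<Sum>u\<in>{..<k} \<rightarrow>\<^sub>E ?L. ?c0 u * (\<Prod>p<k. W (A (u p)) \<omega>))" for \<omega>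
    unfolding elementary_integral_def ext_coeff_def using offdiag_sub[of k N]
    by (intro sum.mono_neutral_cong_left) (auto intro: finite_PiE)
  have F4: "?F \<omega> ^ 4 = (\<Sum>v\<in>P \<rightarrow>\<^sub>E ?L. (\<Prod>i<4. cc i (restrict v {x\<in>P. snd x = i})) * (\<Prod>x\<in>P. W (A (v x)) \<omega>))" for \<omega>
  proof -
    have "?F \<omega> ^ 4 = (\<Prod>i<4::nat. \<Sum>u\<in>{..<k} \<rightarrow>\<^sub>E ?L. ?c0 u * (\<Prod>p<k. W (A (u p)) \<omega>))"
      by (simp add: Ffull)
    also have "\<dots> = (\<Sum>g\<in>{..<4::nat} \<rightarrow>\<^sub>E ({..<k} \<rightarrow>\<^sub>E ?L). \<Prod>i<4. ?c0 (g i) * (\<Prod>p<k. W (A (g i p)) \<omega>))"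
      by (rule prod_sum_PiE) (auto intro: finite_PiE)
    also have "\<dots> = (\<Sum>v\<in>P \<rightarrow>\<^sub>E ?L. (\<Prod>i<4. cc i (restrict v {x\<in>P. snd x = i})) * (\<Prod>x\<in>P. W (A (v x)) \<omega>))"
    proof (rule sum.reindex_bij_witness[of _ "\<lambda>v. \<lambda>i\<in>{..<4}. \<lambda>p\<in>{..<k}. v (p, i)" "\<lambda>g. \<lambda>(p, i)\<in>P. g i p"])
      fix g assume g: "g \<in> {..<4::nat} \<rightarrow>\<^sub>E ({..<k} \<rightarrow>\<^sub>E ?L)"
      show "(\<lambda>i\<in>{..<4}. \<lambda>p\<in>{..<k}. (\<lambda>(p, i)\<in>P. g i p) (p, i)) = g"
        using g by (auto simp: fun_eq_iff P_def PiE_def extensional_def Pi_def restrict_def)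
      show "(\<lambda>(p, i)\<in>P. g i p) \<in> P \<rightarrow>\<^sub>E ?L"
        using g by (auto simp: P_def PiE_def Pi_def)
      have 1: "(\<lambda>p\<in>{..<k}. restrict (\<lambda>(p, i)\<in>P. g i p) {x\<in>P. snd x = i} (p, i)) = g i" if "i < 4" for i
        using g that by (auto simp: fun_eq_iff P_def PiE_def extensional_def Pi_def)
      have 2: "(\<Prod>x\<in>P. W (A ((\<lambda>(p, i)\<in>P. g i p) x)) \<omega>) = (\<Prod>i<4. \<Prod>p<k. W (A (g i p)) \<omega>)"
        unfolding P_def by (subst prod.swap) (simp add: prod.cartesian_product case_prod_unfold)
      show "(\<Prod>i<4. cc i (restrict (\<lambda>(p, i)\<in>P. g i p) {x\<in>P. snd x = i})) * (\<Prod>x\<in>P. W (A ((\<lambda>(p, i)\<in>P. g i p) x)) \<omega>)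
        = (\<Prod>i<4. ?c0 (g i) * (\<Prod>p<k. W (A (g i p)) \<omega>))"
      proof -
        have "(\<Prod>i<4. cc i (restrict (\<lambda>(p, i)\<in>P. g i p) {x\<in>P. snd x = i})) = (\<Prod>i<4. ?c0 (g i))"
          unfolding cc_def by (intro prod.cong refl) (simp only: 1 lessThan_iff)
        then show ?thesis unfolding 2 prod.distrib by simp
      qed
    next
      fix v assume v: "v \<in> P \<rightarrow>\<^sub>E ?L"
      show "(\<lambda>(p, i)\<in>P. (\<lambda>i\<in>{..<4}. \<lambda>p\<in>{..<k}. v (p, i)) i p) = v"
        using v by (auto simp: fun_eq_iff P_def PiE_def extensional_def)
      show "(\<lambda>i\<in>{..<4}. \<lambda>p\<in>{..<k}. v (p, i)) \<in> {..<4::nat} \<rightarrow>\<^sub>E ({..<k} \<rightarrow>\<^sub>E ?L)"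
        using v by (auto simp: P_def PiE_def Pi_def)
    qed
    finally show ?thesis .
  qed
  have am: "allmom M (\<lambda>\<omega>. \<Prod>x\<in>P. W (A (v x)) \<omega>)" if "v \<in> P \<rightarrow>\<^sub>E ?L" for v
    using that by (intro allmom_prod W_allmom symmetric_system_fin[OF A]) auto
  have E4: "expectation (\<lambda>\<omega>. ?F \<omega> ^ 4)
     = (\<Sum>v\<in>P \<rightarrow>\<^sub>E ?L. (\<Prod>i<4. cc i (restrict v {x\<in>P. snd x = i})) * m P v)"
    unfolding F4 m_def
    by (subst Bochner_Integration.integral_sum) (auto intro!: allmom_integrable allmom_cmult am)
  have a_nn: "?a j \<ge> 0" for j by simp
  have "cmod (expectation (\<lambda>\<omega>. ?F \<omega> ^ 4))
    \<le> fact (card P) * (\<Prod>i<4. sqrt (wnorm2 ?L ?a {x\<in>P. snd x = i} (cc i)))"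
    unfolding E4
  proof (rule diagram_bound)
    fix Q :: "(nat \<times> nat) set" and x and u :: "nat \<times> nat \<Rightarrow> int"
    assume Q: "finite Q" "x \<in> Q" "u \<in> Q \<rightarrow> ?L"
    have "m Q u = expectation (\<lambda>\<omega>. W (A (u x)) \<omega> * (\<Prod>y\<in>Q - {x}. W (A (u y)) \<omega>))"
      unfolding m_def using Q by (simp add: prod.remove)
    also have "\<dots> = (\<Sum>y\<in>Q-{x}. of_real (measure lborel (A (u x) \<inter> uminus ` A (u y)))
         * expectation (\<lambda>\<omega>. \<Prod>j\<in>Q-{x}-{y}. W (A (u j)) \<omega>))"
      using Q by (intro W_wick symmetric_system_fin[OF A]) auto
    also have "\<dots> = (\<Sum>y\<in>Q-{x}. (if u y = - u x then of_real (?a (u x)) else 0) * m (Q - {x, y}) u)"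
    proof (rule sum.cong[OF refl])
      fix y assume y: "y \<in> Q - {x}"
      have "Q - {x} - {y} = Q - {x, y}" by auto
      moreover have "u x \<in> ?L" "u y \<in> ?L" using Q y by auto
      ultimately show "of_real (measure lborel (A (u x) \<inter> uminus ` A (u y)))
         * expectation (\<lambda>\<omega>. \<Prod>j\<in>Q-{x}-{y}. W (A (u j)) \<omega>)
         = (if u y = - u x then of_real (?a (u x)) else 0) * m (Q - {x, y}) u"
        by (simp add: symmetric_system_cov[OF A] m_def)
    qed
    finally show "m Q u = (\<Sum>y\<in>Q-{x}. (if u y = - u x then of_real (?a (u x)) else 0) * m (Q - {x, y}) u)" .
  next
    fix i :: nat and u :: "nat \<times> nat \<Rightarrow> int" and x y :: "nat \<times> nat"
    assume h: "x \<in> P" "y \<in> P" "snd x = i" "snd y = i" "x \<noteq> y" "u y = - u x"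
    obtain p q where pq: "x = (p, i)" "y = (q, i)" using h by (cases x; cases y) auto
    then have "p < k" "q < k" "p \<noteq> q" using h by (auto simp: P_def)
    moreover have "(\<lambda>p\<in>{..<k}. u (p, i)) q = - (\<lambda>p\<in>{..<k}. u (p, i)) p"
      using h pq \<open>p < k\<close> \<open>q < k\<close> by simp
    ultimately have "(\<lambda>p\<in>{..<k}. u (p, i)) \<notin> offdiag k N"
      unfolding offdiag_def by blast
    then show "cc i u = 0" by (simp add: cc_def ext_coeff_def)
  next
    show "m {} u = 1" for u by (simp add: m_def prob_space)
    show "m Q u = m Q v" if "\<And>x. x \<in> Q \<Longrightarrow> u x = v x" for Q u v
      using that by (simp add: m_def cong: prod.cong)
  qed (auto simp: P_def uminus_sym_idx symmetric_system_measure_uminus[OF A])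
  also have "card P = 4 * k" by (simp add: P_def)
  also have "(\<Prod>i<4. sqrt (wnorm2 ?L ?a {x\<in>P. snd x = i} (cc i)))
    = (\<Prod>i<4::nat. sqrt (wnorm2 ?L ?a {..<k} ?c0))"
  proof (intro prod.cong refl arg_cong[where f = sqrt])
    fix i assume i: "i \<in> {..<4::nat}"
    have B: "{x\<in>P. snd x = i} = {..<k} \<times> {i}" using i by (auto simp: P_def)
    show "wnorm2 ?L ?a {x\<in>P. snd x = i} (cc i) = wnorm2 ?L ?a {..<k} ?c0"
      unfolding wnorm2_def B
    proof (rule sum.reindex_bij_witness[of _ "\<lambda>u. \<lambda>x\<in>{..<k} \<times> {i}. u (fst x)" "\<lambda>w. \<lambda>p\<in>{..<k}. w (p, i)"])
      fix w assume w: "w \<in> {..<k} \<times> {i} \<rightarrow>\<^sub>E ?L"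
      show "(\<lambda>x\<in>{..<k} \<times> {i}. (\<lambda>p\<in>{..<k}. w (p, i)) (fst x)) = w"
        using w by (auto simp: fun_eq_iff PiE_def extensional_def)
      show "(\<lambda>p\<in>{..<k}. w (p, i)) \<in> {..<k} \<rightarrow>\<^sub>E ?L" using w by auto
      have "(\<Prod>x\<in>{..<k} \<times> {i}. ?a (w x)) = (\<Prod>p<k. ?a (w (p, i)))"
        by (rule prod.reindex_bij_witness[of _ "\<lambda>p. (p, i)" fst]) auto
      then show "(cmod (?c0 (\<lambda>p\<in>{..<k}. w (p, i))))\<^sup>2 * (\<Prod>x<k. ?a ((\<lambda>p\<in>{..<k}. w (p, i)) x))
         = (cmod (cc i w))\<^sup>2 * (\<Prod>x\<in>{..<k} \<times> {i}. ?a (w x))"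
        by (simp add: cc_def)
    next
      fix u assume u: "u \<in> {..<k} \<rightarrow>\<^sub>E ?L"
      show "(\<lambda>p\<in>{..<k}. (\<lambda>x\<in>{..<k} \<times> {i}. u (fst x)) (p, i)) = u"
        using u by (auto simp: fun_eq_iff PiE_def extensional_def)
      show "(\<lambda>x\<in>{..<k} \<times> {i}. u (fst x)) \<in> {..<k} \<times> {i} \<rightarrow>\<^sub>E ?L"
      proof (rule PiE_I)
        fix x assume "x \<in> {..<k} \<times> {i}"
        then show "(\<lambda>x\<in>{..<k} \<times> {i}. u (fst x)) x \<in> ?L"
          using PiE_mem[OF u, of "fst x"] by (simp add: mem_Times_iff)
      qed simp
    qed
  qed
  also have "(\<Prod>i<4::nat. sqrt (wnorm2 ?L ?a {..<k} ?c0)) = nrm (lborel_pow k) (elementary_kernel k N A c) ^ 4"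
    by (simp add: elementary_kernel_nrm[OF A, symmetric])
  finally have bound: "cmod (expectation (\<lambda>\<omega>. ?F \<omega> ^ 4)) \<le> fact (4 * k) * nrm (lborel_pow k) (elementary_kernel k N A c) ^ 4" .
  have [measurable]: "?F \<in> borel_measurable M"
    using elementary_integral_allmom[OF A] by (rule allmom_measurable)
  have "complex_of_real (expectation (\<lambda>\<omega>. cmod (?F \<omega>) ^ 4)) = expectation (\<lambda>\<omega>. of_real (cmod (?F \<omega>) ^ 4))"
    by (rule integral_complex_of_real[symmetric])
  also have "\<dots> = expectation (\<lambda>\<omega>. ?F \<omega> ^ 4)"
  proof (rule integral_cong_AE)
    show "AE \<omega> in M. complex_of_real (cmod (?F \<omega>) ^ 4) = ?F \<omega> ^ 4"
      using elementary_integral_real[OF A c]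
    proof eventually_elim
      case (elim \<omega>)
      have "complex_of_real (cmod (?F \<omega>) ^ 4) = (of_real ((cmod (?F \<omega>))\<^sup>2))\<^sup>2"
        by (simp only: of_real_power power_mult[symmetric]) simp
      also have "\<dots> = (?F \<omega> * cnj (?F \<omega>))\<^sup>2" by (simp only: complex_norm_square)
      also have "\<dots> = ?F \<omega> ^ 4" unfolding elim by (simp only: power2_eq_square power4_eq_xxxx mult.assoc)
      finally show ?case .
    qed
  qed measurable
  finally have "expectation (\<lambda>\<omega>. cmod (?F \<omega>) ^ 4) \<le> cmod (expectation (\<lambda>\<omega>. ?F \<omega> ^ 4))"
    by (metis abs_ge_self norm_of_real)
  then show ?thesis using bound by linarith
qed

end

section \<open>Weak convergence of products\<close>

text \<open>A single approximant at finite distance already forces the limit to be square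
  integrable.\<close>

lemma L2convI_sqn_measurable:
  assumes F: "\<And>n. L2 \<mu> (F n)" and f: "f \<in> borel_measurable \<mu>"
    and c: "(\<lambda>n. sqn \<mu> (\<lambda>x. F n x - f x)) \<longlonglongrightarrow> 0"
  shows "L2conv \<mu> F f"
proof -
  note f[measurable] F[THEN L2_measurable, measurable]
  have "\<forall>\<^sub>F n in sequentially. sqn \<mu> (\<lambda>x. F n x - f x) < 1"
    using order_tendstoD(2)[OF c, of 1] by simp
  then obtain n where n: "sqn \<mu> (\<lambda>x. F n x - f x) < 1"
    by (auto simp: eventually_sequentially)
  have "L2 \<mu> (\<lambda>x. F n x - f x)"
    unfolding L2_def using n by (auto intro: less_trans)
  from L2_diff[OF F this, of n] have "L2 \<mu> f" by simp
  then show ?thesis by (intro L2convI_sqn F c)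
qed

lemma L2_bounded_mult:
  assumes f: "L2 \<mu> f" and h[measurable]: "h \<in> borel_measurable \<mu>" and b: "\<And>x. cmod (h x) \<le> R"
  shows "L2 \<mu> (\<lambda>x. f x * h x)" "nrm \<mu> (\<lambda>x. f x * h x) \<le> R * nrm \<mu> f"
proof -
  note f[THEN L2_measurable, measurable]
  have R: "0 \<le> R" using b[of undefined] norm_ge_zero order_trans by blast
  have i: "integrable \<mu> (\<lambda>x. R\<^sup>2 * (cmod (f x))\<^sup>2)" using f by (auto simp: L2_iff)
  have le: "(cmod (f x * h x))\<^sup>2 \<le> R\<^sup>2 * (cmod (f x))\<^sup>2" for x
  proof -
    have "cmod (f x * h x) \<le> R * cmod (f x)"
      unfolding norm_mult using b[of x] by (subst mult.commute) (intro mult_right_mono, auto)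
    then have "(cmod (f x * h x))\<^sup>2 \<le> (R * cmod (f x))\<^sup>2" by (intro power_mono) auto
    then show ?thesis by (simp add: power_mult_distrib)
  qed
  show L: "L2 \<mu> (\<lambda>x. f x * h x)"
    unfolding L2_iff
  proof
    show "integrable \<mu> (\<lambda>x. (cmod (f x * h x))\<^sup>2)"
      by (rule Bochner_Integration.integrable_bound[OF i]) (use le in auto)
  qed measurable
  have "(nrm \<mu> (\<lambda>x. f x * h x))\<^sup>2 \<le> (R * nrm \<mu> f)\<^sup>2"
    unfolding nrm_power2 power_mult_distrib
    using L i le by (subst integral_mult_right_zero[symmetric]) (intro integral_mono, auto simp: L2_iff)
  then show "nrm \<mu> (\<lambda>x. f x * h x) \<le> R * nrm \<mu> f"
    by (rule power2_le_imp_le) (simp add: R)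
qed

lemma L2_cnj: "L2 \<mu> f \<Longrightarrow> L2 \<mu> (\<lambda>x. cnj (f x))"
  by (auto simp: L2_iff)

lemma nrm_cutoff_tendsto:
  assumes X: "L2 \<mu> X" and h: "\<And>n. h n \<in> borel_measurable \<mu>" "\<And>n x. cmod (h n x) \<le> 1"
    and lim: "AE x in \<mu>. (\<lambda>n. h n x) \<longlonglongrightarrow> 1"
  shows "(\<lambda>n. nrm \<mu> (\<lambda>x. X x - X x * h n x)) \<longlonglongrightarrow> 0"
proof -
  note X[THEN L2_measurable, measurable] h(1)[measurable]
  have "(\<lambda>n. \<integral>x. (cmod (X x - X x * h n x))\<^sup>2 \<partial>\<mu>) \<longlonglongrightarrow> (\<integral>x. 0 \<partial>\<mu>)"
  proof (rule integral_dominated_convergence[where w = "\<lambda>x. 4 * (cmod (X x))\<^sup>2"])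
    show "integrable \<mu> (\<lambda>x. 4 * (cmod (X x))\<^sup>2)" using X by (auto simp: L2_iff)
    show "AE x in \<mu>. (\<lambda>n. (cmod (X x - X x * h n x))\<^sup>2) \<longlonglongrightarrow> 0"
      using lim
    proof eventually_elim
      case (elim x)
      have "(\<lambda>n. (cmod (X x - X x * h n x))\<^sup>2) \<longlonglongrightarrow> (cmod (X x - X x * 1))\<^sup>2"
        by (intro tendsto_intros elim)
      then show ?case by simp
    qed
    show "AE x in \<mu>. norm ((cmod (X x - X x * h n x))\<^sup>2) \<le> 4 * (cmod (X x))\<^sup>2" for n
    proof (rule AE_I2)
      fix x
      have "cmod (X x - X x * h n x) \<le> cmod (X x) + cmod (X x) * cmod (h n x)"
        by (metis norm_mult norm_triangle_ineq4)
      also have "\<dots> \<le> cmod (X x) + cmod (X x) * 1"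
        by (intro add_left_mono mult_left_mono h) auto
      finally have "(cmod (X x - X x * h n x))\<^sup>2 \<le> (2 * cmod (X x))\<^sup>2"
        by (intro power_mono) auto
      then show "norm ((cmod (X x - X x * h n x))\<^sup>2) \<le> 4 * (cmod (X x))\<^sup>2"
        by (simp add: power_mult_distrib)
    qed
  qed measurable
  then have "(\<lambda>n. sqrt (\<integral>x. (cmod (X x - X x * h n x))\<^sup>2 \<partial>\<mu>)) \<longlonglongrightarrow> sqrt 0"
    by (intro tendsto_real_sqrt) simp
  then show ?thesis by (simp add: nrm_def)
qed

lemma L2_product_fourth:
  assumes F: "F \<in> borel_measurable \<mu>" "integrable \<mu> (\<lambda>x. cmod (F x) ^ 4)" "(\<integral>x. cmod (F x) ^ 4 \<partial>\<mu>) \<le> C"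
    and G: "G \<in> borel_measurable \<mu>" "integrable \<mu> (\<lambda>x. cmod (G x) ^ 4)" "(\<integral>x. cmod (G x) ^ 4 \<partial>\<mu>) \<le> C"
  shows "L2 \<mu> (\<lambda>x. F x * G x)" "nrm \<mu> (\<lambda>x. F x * G x) \<le> sqrt (2 * C)"
proof -
  note F(1)[measurable] G(1)[measurable]
  have i: "integrable \<mu> (\<lambda>x. cmod (F x) ^ 4 + cmod (G x) ^ 4)" using F G by auto
  have le: "(cmod (F x * G x))\<^sup>2 \<le> cmod (F x) ^ 4 + cmod (G x) ^ 4" for x
  proof -
    have "(a * b)\<^sup>2 \<le> a ^ 4 + b ^ 4" for a b :: real
    proof -
      have "2 * (a\<^sup>2 * b\<^sup>2) \<le> (a\<^sup>2)\<^sup>2 + (b\<^sup>2)\<^sup>2"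
        using sum_squares_bound[of "a\<^sup>2" "b\<^sup>2"] by simp
      moreover have "0 \<le> a\<^sup>2 * b\<^sup>2" by simp
      moreover have "(a\<^sup>2)\<^sup>2 = a ^ 4" "(b\<^sup>2)\<^sup>2 = b ^ 4" by (simp_all flip: power_mult)
      ultimately show ?thesis unfolding power_mult_distrib by linarith
    qed
    then show ?thesis unfolding norm_mult .
  qed
  have int: "integrable \<mu> (\<lambda>x. (cmod (F x * G x))\<^sup>2)"
    by (rule Bochner_Integration.integrable_bound[OF i]) (use le in auto)
  then show "L2 \<mu> (\<lambda>x. F x * G x)" by (simp add: L2_iff)
  have "(\<integral>x. (cmod (F x * G x))\<^sup>2 \<partial>\<mu>) \<le> (\<integral>x. cmod (F x) ^ 4 + cmod (G x) ^ 4 \<partial>\<mu>)"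
    using int i le by (intro integral_mono) auto
  also have "\<dots> \<le> 2 * C" using F G by simp
  finally show "nrm \<mu> (\<lambda>x. F x * G x) \<le> sqrt (2 * C)" unfolding nrm_def by simp
qed

text \<open>Uniform fourth moments make the products bounded in \<open>L\<^sup>2\<close>, so that their convergence in
  \<open>L\<^sup>1\<close> is also weak convergence in \<open>L\<^sup>2\<close>.\<close>

lemma ip_product_tendsto:
  assumes F: "L2conv \<mu> F f" and G: "L2conv \<mu> G g" and X: "L2 \<mu> X"
    and F4: "\<And>n. integrable \<mu> (\<lambda>x. cmod (F n x) ^ 4)" "\<And>n. (\<integral>x. cmod (F n x) ^ 4 \<partial>\<mu>) \<le> C"
    and G4: "\<And>n. integrable \<mu> (\<lambda>x. cmod (G n x) ^ 4)" "\<And>n. (\<integral>x. cmod (G n x) ^ 4 \<partial>\<mu>) \<le> C"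
    and fg: "L2 \<mu> (\<lambda>x. f x * g x)"
  shows "(\<lambda>n. ip \<mu> (\<lambda>x. F n x * G n x) X) \<longlonglongrightarrow> ip \<mu> (\<lambda>x. f x * g x) X"
proof (rule LIMSEQ_I)
  fix e :: real assume e: "e > 0"
  have L: "\<And>n. L2 \<mu> (F n)" "L2 \<mu> f" "\<And>n. L2 \<mu> (G n)" "L2 \<mu> g"
    using F G by (auto simp: L2conv_def)
  note [measurable] = L[THEN L2_measurable] X[THEN L2_measurable]
  have FG: "L2 \<mu> (\<lambda>x. F n x * G n x)" "nrm \<mu> (\<lambda>x. F n x * G n x) \<le> sqrt (2 * C)" for n
    using L2_product_fourth[OF _ F4 _ G4, of n n] by auto
  \<comment> \<open>A bound, uniform in n, for the norm of an approximating product plus the norm of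
    the limit product; the added 1 makes it safe to divide by.\<close>
  define K where "K = sqrt (2 * C) + nrm \<mu> (\<lambda>x. f x * g x) + 1"
  have K: "K > 0" using order_trans[OF nrm_nonneg FG(2)] by (simp add: K_def add_nonneg_pos)
  \<comment> \<open>The test function is truncated to a bounded one. The removed part is small in
    norm and is met only by products of norm at most \<open>K\<close>.\<close>
  define h :: "nat \<Rightarrow> _ \<Rightarrow> complex" where "h R x = (if cmod (X x) \<le> real R then 1 else 0)" for R x
  have h: "h R \<in> borel_measurable \<mu>" "cmod (h R x) \<le> 1" "cmod (X x * h R x) \<le> real R" for R x
    unfolding h_def by auto
  have "(\<lambda>R. h R x) \<longlonglongrightarrow> 1" for x
  proof (rule tendsto_eventually)
    obtain N :: nat where "cmod (X x) \<le> real N" using real_arch_simple by blast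
    then show "\<forall>\<^sub>F R in sequentially. h R x = 1"
      unfolding h_def eventually_sequentially by (intro exI[of _ N]) (auto intro: order_trans)
  qed
  then have "(\<lambda>R. nrm \<mu> (\<lambda>x. X x - X x * h R x)) \<longlonglongrightarrow> 0"
    by (intro nrm_cutoff_tendsto X h) auto
  then have "\<forall>\<^sub>F R in sequentially. nrm \<mu> (\<lambda>x. X x - X x * h R x) < e / (2 * K)"
    using e K by (intro order_tendstoD(2)[where a = "e / (2 * K)"]) auto
  then obtain R where R: "nrm \<mu> (\<lambda>x. X x - X x * h R x) < e / (2 * K)"
    by (auto simp: eventually_sequentially)
  define XR where "XR x = X x * h R x" for x
  have XR: "L2 \<mu> XR" unfolding XR_def by (rule L2_bounded_mult(1)[OF X h(1,2)])
  have [measurable]: "XR \<in> borel_measurable \<mu>" using XR by (rule L2_measurable)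
  \<comment> \<open>A bounded factor can be absorbed into \<open>G n\<close>, so the pairing becomes
    an inner product of two strongly convergent sequences.\<close>
  have conv: "L2conv \<mu> (\<lambda>n x. cnj (G n x) * XR x) (\<lambda>x. cnj (g x) * XR x)"
  proof -
    have b: "cmod (XR x) \<le> real R" for x unfolding XR_def by (rule h)
    have *: "nrm \<mu> (\<lambda>x. cnj (G n x) * XR x - cnj (g x) * XR x) \<le> real R * nrm \<mu> (\<lambda>x. G n x - g x)" for n
    proof -
      have "nrm \<mu> (\<lambda>x. cnj (G n x) * XR x - cnj (g x) * XR x) = nrm \<mu> (\<lambda>x. cnj (G n x - g x) * XR x)"
        by (simp add: algebra_simps)
      also have "\<dots> \<le> real R * nrm \<mu> (\<lambda>x. cnj (G n x - g x))"
        by (rule L2_bounded_mult(2)[OF L2_cnj[OF L2_diff[OF L(3,4)]] \<open>XR \<in> borel_measurable \<mu>\<close> b])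
      also have "nrm \<mu> (\<lambda>x. cnj (G n x - g x)) = nrm \<mu> (\<lambda>x. G n x - g x)"
        unfolding nrm_def complex_mod_cnj ..
      finally show ?thesis .
    qed
    have "(\<lambda>n. real R * nrm \<mu> (\<lambda>x. G n x - g x)) \<longlonglongrightarrow> real R * 0"
      using G by (intro tendsto_intros) (simp add: L2conv_def)
    then have lim: "(\<lambda>n. real R * nrm \<mu> (\<lambda>x. G n x - g x)) \<longlonglongrightarrow> 0" by simp
    have "(\<lambda>n. nrm \<mu> (\<lambda>x. cnj (G n x) * XR x - cnj (g x) * XR x)) \<longlonglongrightarrow> 0"
      by (rule Lim_null_comparison[OF always_eventually lim]) (simp add: *)
    moreover have "L2 \<mu> (\<lambda>x. cnj (G n x) * XR x)" for n
      by (rule L2_bounded_mult(1)[OF L2_cnj[OF L(3)] \<open>XR \<in> borel_measurable \<mu>\<close> b])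
    moreover have "L2 \<mu> (\<lambda>x. cnj (g x) * XR x)"
      by (rule L2_bounded_mult(1)[OF L2_cnj[OF L(4)] \<open>XR \<in> borel_measurable \<mu>\<close> b])
    ultimately show ?thesis by (simp add: L2conv_def)
  qed
  have "(\<lambda>n. ip \<mu> (F n) (\<lambda>x. cnj (G n x) * XR x)) \<longlonglongrightarrow> ip \<mu> f (\<lambda>x. cnj (g x) * XR x)"
    by (rule L2conv_ip[OF F conv])
  then have "(\<lambda>n. ip \<mu> (\<lambda>x. F n x * G n x) XR) \<longlonglongrightarrow> ip \<mu> (\<lambda>x. f x * g x) XR"
    by (simp add: ip_def mult.assoc)
  from LIMSEQ_D[OF this, of "e / 2"] e obtain N where
    N: "\<And>n. n \<ge> N \<Longrightarrow> norm (ip \<mu> (\<lambda>x. F n x * G n x) XR - ip \<mu> (\<lambda>x. f x * g x) XR) < e / 2"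
    by auto
  show "\<exists>N. \<forall>n\<ge>N. norm (ip \<mu> (\<lambda>x. F n x * G n x) X - ip \<mu> (\<lambda>x. f x * g x) X) < e"
  proof (intro exI allI impI)
    fix n assume n: "n \<ge> N"
    let ?P = "\<lambda>x. F n x * G n x" and ?p = "\<lambda>x. f x * g x"
    have s: "ip \<mu> h X = ip \<mu> h XR + ip \<mu> h (\<lambda>x. X x - XR x)" if "L2 \<mu> h" for h
      using that by (simp add: ip_diff_right X XR)
    have "norm (ip \<mu> ?P X - ip \<mu> ?p X)
      = norm ((ip \<mu> ?P XR - ip \<mu> ?p XR) + (ip \<mu> ?P (\<lambda>x. X x - XR x) - ip \<mu> ?p (\<lambda>x. X x - XR x)))"
      unfolding s[OF FG(1)] s[OF fg] by (simp add: algebra_simps)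
    also have "\<dots> \<le> norm (ip \<mu> ?P XR - ip \<mu> ?p XR)
        + (norm (ip \<mu> ?P (\<lambda>x. X x - XR x)) + norm (ip \<mu> ?p (\<lambda>x. X x - XR x)))"
      by (rule order_trans[OF norm_triangle_ineq add_left_mono[OF norm_triangle_ineq4]])
    also have "\<dots> \<le> norm (ip \<mu> ?P XR - ip \<mu> ?p XR)
        + (nrm \<mu> ?P * nrm \<mu> (\<lambda>x. X x - XR x) + nrm \<mu> ?p * nrm \<mu> (\<lambda>x. X x - XR x))"
      by (intro add_mono order_refl L2_Cauchy_Schwarz FG fg L2_diff X XR)
    also have "\<dots> \<le> norm (ip \<mu> ?P XR - ip \<mu> ?p XR) + K * nrm \<mu> (\<lambda>x. X x - XR x)"
    proof -
      have "(nrm \<mu> ?P + nrm \<mu> ?p) * nrm \<mu> (\<lambda>x. X x - XR x) \<le> K * nrm \<mu> (\<lambda>x. X x - XR x)"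
        using FG(2)[of n] by (intro mult_right_mono) (auto simp: K_def)
      then show ?thesis by (simp add: distrib_right)
    qed
    also have "\<dots> < e / 2 + K * (e / (2 * K))"
      using N[OF n] R K unfolding XR_def by (intro add_strict_mono mult_strict_left_mono) auto
    also have "\<dots> = e" using K by simp
    finally show "norm (ip \<mu> ?P X - ip \<mu> ?p X) < e" .
  qed
qed

text \<open>With all coordinates but \<open>a\<close> fixed, the exceptional set is the single point
  \<open>- x b\<close>.\<close>

lemma AE_sum_nonzero:
  assumes "finite I" "a \<in> I" "b \<in> I" "a \<noteq> b"
  shows "AE x in lborel_on I. x a + x b \<noteq> 0"
proof -
  define J where "J = I - {a}"
  have J: "finite J" "a \<notin> J" "I = insert a J" "b \<in> J" using assms by (auto simp: J_def)
  have "(\<lambda>x. x a) \<in> lborel_on I \<rightarrow>\<^sub>M lborel" "(\<lambda>x. x b) \<in> lborel_on I \<rightarrow>\<^sub>M lborel"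
    by (rule measurable_component_singleton; fact)+
  then have [measurable]: "(\<lambda>x. x a) \<in> borel_measurable (lborel_on I)" "(\<lambda>x. x b) \<in> borel_measurable (lborel_on I)"
    by simp_all
  let ?f = "\<lambda>x. if x a + x b = 0 then 1 else 0 :: ennreal"
  have fm: "?f \<in> borel_measurable (lborel_on I)" by measurable
  have "(\<integral>\<^sup>+ x. ?f x \<partial>lborel_on I) = (\<integral>\<^sup>+ x. (\<integral>\<^sup>+ y. ?f (x(a := y)) \<partial>lborel) \<partial>lborel_on J)"
    using fm unfolding J(3) by (rule lborel_product.product_nn_integral_insert[OF J(1,2)])
  also have "\<dots> = (\<integral>\<^sup>+ x. (\<integral>\<^sup>+ y. indicator {- x b} y \<partial>lborel) \<partial>lborel_on J)"
    using assms(4) by (intro nn_integral_cong) (auto simp: indicator_def)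
  also have "\<dots> = 0" by simp
  finally have "AE x in lborel_on I. ?f x = 0"
    using nn_integral_0_iff_AE[OF fm] by simp
  then show ?thesis by eventually_elim (auto split: if_splits)
qed

section \<open>Projection of a product of Wiener-Ito integrals\<close>

definition grid_cell :: "nat \<Rightarrow> int \<Rightarrow> real set" where
  "grid_cell l j = {x. \<lfloor>x * 2 ^ l\<rfloor> = j}"

text \<open>Only cells that meet the reflection of another chosen cell are excluded. Factors of the
  random measure can be paired only through a reflected set, so neighbourhoods of x_b = x_b' away
  from 0 may stay. The index range covers [-l, l], so mesh and range improve together.\<close>

definition grid_offdiag :: "nat \<Rightarrow> nat \<Rightarrow> (nat \<Rightarrow> int) set" where
  "grid_offdiag m l = {w \<in> {..<m} \<rightarrow>\<^sub>E {- int (l * 2 ^ l)..int (l * 2 ^ l)}.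
     \<forall>b<m. \<forall>b'<m. b \<noteq> b' \<longrightarrow> grid_cell l (w b) \<inter> uminus ` grid_cell l (w b') = {}}"

text \<open>The indicator function of a union of boxes, written as a sum of products so that
  multiplying an \<open>skernel\<close> by it gives an \<open>skernel\<close> again.\<close>

definition grid_cut :: "nat \<Rightarrow> nat \<Rightarrow> (nat \<Rightarrow> real) \<Rightarrow> complex" where
  "grid_cut m l x = (\<Sum>w\<in>grid_offdiag m l. \<Prod>b<m. indicator (grid_cell l (w b)) (x b))"

lemma grid_cell_sets[measurable]: "grid_cell l j \<in> sets borel"
proof -
  have "{x \<in> space (borel :: real measure). \<lfloor>x * 2 ^ l\<rfloor> = j} \<in> sets borel" by measurable
  then show ?thesis by (simp add: grid_cell_def)
qed

lemma finite_grid_offdiag[simp]: "finite (grid_offdiag m l)"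
  unfolding grid_offdiag_def by (rule finite_subset[OF Collect_restrict]) (auto intro: finite_PiE)

text \<open>The cells of one level partition the line, so the only summand that can be nonzero at x
  is the tuple of cells containing its coordinates.\<close>

lemma grid_cut_eq:
  "grid_cut m l x = (if (\<lambda>b\<in>{..<m}. \<lfloor>x b * 2 ^ l\<rfloor>) \<in> grid_offdiag m l then 1 else 0)"
proof -
  let ?w = "\<lambda>b\<in>{..<m}. \<lfloor>x b * 2 ^ l\<rfloor>"
  have "(\<Prod>b<m. indicator (grid_cell l (w b)) (x b) :: complex) = (if w = ?w then 1 else 0)"
    if w: "w \<in> grid_offdiag m l" for w
  proof (cases "w = ?w")
    case True
    then show ?thesis by (simp add: grid_cell_def indicator_def)
  next
    case False
    have "w \<in> extensional {..<m}" using w by (auto simp: grid_offdiag_def PiE_def)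
    then obtain b where "b < m" "w b \<noteq> \<lfloor>x b * 2 ^ l\<rfloor>"
      using False extensionalityI[of w "{..<m}" ?w] by auto
    then have "\<exists>b\<in>{..<m}. (indicator (grid_cell l (w b)) (x b) :: complex) = 0"
      by (intro bexI[of _ b]) (auto simp: grid_cell_def)
    then show ?thesis using False by (simp add: prod_zero_iff)
  qed
  then show ?thesis unfolding grid_cut_def by (simp add: sum.delta cong: sum.cong)
qed

lemma grid_cut_norm: "cmod (grid_cut m l x) \<le> 1"
  by (simp add: grid_cut_eq)

lemma grid_cut_measurable[measurable]: "grid_cut m l \<in> borel_measurable (lborel_pow m)"
proof -
  have "(\<lambda>x. indicator (grid_cell l j) (x b) :: complex) \<in> borel_measurable (lborel_pow m)" if "b < m" for b j
  proof -
    have "(\<lambda>x. x b) \<in> lborel_pow m \<rightarrow>\<^sub>M lborel"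
      using that by (intro measurable_component_singleton) auto
    then have [measurable]: "(\<lambda>x. x b) \<in> borel_measurable (lborel_pow m)" by simp
    show ?thesis by measurable
  qed
  then show ?thesis
    unfolding grid_cut_def[abs_def] by (intro borel_measurable_sum borel_measurable_prod) auto
qed

lemma grid_cut_tendsto:
  assumes x: "\<And>a b. a < m \<Longrightarrow> b < m \<Longrightarrow> a \<noteq> b \<Longrightarrow> x a + x b \<noteq> 0"
  shows "(\<lambda>l. grid_cut m l x) \<longlonglongrightarrow> 1"
proof -
  have 1: "\<forall>\<^sub>F l in sequentially. \<forall>b\<in>{..<m}. \<bar>x b\<bar> \<le> real l"
  proof (rule eventually_ball_finite, simp, intro ballI)
    fix b
    obtain L :: nat where "\<bar>x b\<bar> \<le> real L" using real_arch_simple by blast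
    then show "\<forall>\<^sub>F l in sequentially. \<bar>x b\<bar> \<le> real l"
      unfolding eventually_sequentially by (intro exI[of _ L]) (auto intro: order_trans)
  qed
  \<comment> \<open>If the cell of \<open>x a\<close> meets the reflection of the cell of
    \<open>x b\<close>, then each coordinate is within one mesh width of a point of a pair summing
    to zero, so |x_a + x_b| is at most twice the mesh width.\<close>
  have 2: "\<forall>\<^sub>F l in sequentially. \<forall>(a, b)\<in>{..<m} \<times> {..<m}. a \<noteq> b \<longrightarrow> 2 * (1/2) ^ l < \<bar>x a + x b\<bar>"
  proof (rule eventually_ball_finite, simp, intro ballI)
    fix ab assume ab: "ab \<in> {..<m} \<times> {..<m}"
    obtain a b where [simp]: "ab = (a, b)" by (cases ab)
    have "(\<lambda>l. 2 * (1/2::real) ^ l) \<longlonglongrightarrow> 2 * 0"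
      by (intro tendsto_mult_left LIMSEQ_realpow_zero) auto
    then have lim: "(\<lambda>l. 2 * (1/2::real) ^ l) \<longlonglongrightarrow> 0" by simp
    show "\<forall>\<^sub>F l in sequentially. case ab of (a, b) \<Rightarrow> a \<noteq> b \<longrightarrow> 2 * (1/2) ^ l < \<bar>x a + x b\<bar>"
    proof (cases "a = b")
      case False
      then have "0 < \<bar>x a + x b\<bar>" using x[of a b] ab by auto
      from order_tendstoD(2)[OF lim this] show ?thesis by (rule eventually_mono) auto
    qed simp
  qed
  have "\<forall>\<^sub>F l in sequentially. grid_cut m l x = 1"
    using 1 2
  proof eventually_elim
    case (elim l)
    let ?w = "\<lambda>b\<in>{..<m}. \<lfloor>x b * 2 ^ l\<rfloor>"
    have "?w \<in> grid_offdiag m l"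
      unfolding grid_offdiag_def mem_Collect_eq
    proof (intro conjI allI impI)
      show "?w \<in> {..<m} \<rightarrow>\<^sub>E {- int (l * 2 ^ l)..int (l * 2 ^ l)}"
      proof (rule restrict_PiE[THEN iffD2], rule Pi_I)
        fix b assume "b \<in> {..<m}"
        then have "\<bar>x b\<bar> \<le> real l" using elim by auto
        then have n: "- real l \<le> x b" "x b \<le> real l" by (simp_all add: abs_le_iff)
        have "- real l * 2 ^ l \<le> x b * 2 ^ l" "x b * 2 ^ l \<le> real l * 2 ^ l"
          by (rule mult_right_mono[OF n(1)], simp) (rule mult_right_mono[OF n(2)], simp)
        moreover have "real_of_int (int (l * 2 ^ l)) = real l * 2 ^ l" by simp
        ultimately have "of_int (- int (l * 2 ^ l)) \<le> x b * 2 ^ l \<and> x b * 2 ^ l < of_int (int (l * 2 ^ l)) + 1"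
          unfolding of_int_minus by linarith
        then show "\<lfloor>x b * 2 ^ l\<rfloor> \<in> {- int (l * 2 ^ l)..int (l * 2 ^ l)}"
          unfolding atLeastAtMost_iff le_floor_iff floor_le_iff by blast
      qed
      fix b b' assume b: "b < m" "b' < m" "b \<noteq> b'"
      have close: "\<bar>y - z\<bar> \<le> (1/2) ^ l" if "\<lfloor>y * 2 ^ l\<rfloor> = \<lfloor>z * 2 ^ l\<rfloor>" for y z :: real
      proof -
        have "\<bar>y * 2 ^ l - z * 2 ^ l\<bar> \<le> 1"
          using that floor_correct[of "y * 2 ^ l"] floor_correct[of "z * 2 ^ l"] by linarith
        then have "\<bar>y - z\<bar> * 2 ^ l \<le> 1"
          by (simp add: left_diff_distrib[symmetric] abs_mult)
        then show ?thesis by (simp add: power_one_over field_simps)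
      qed
      show "grid_cell l (?w b) \<inter> uminus ` grid_cell l (?w b') = {}"
      proof (rule ccontr)
        assume "grid_cell l (?w b) \<inter> uminus ` grid_cell l (?w b') \<noteq> {}"
        then obtain y :: real where "\<lfloor>(- y) * 2 ^ l\<rfloor> = \<lfloor>x b * 2 ^ l\<rfloor>" "\<lfloor>y * 2 ^ l\<rfloor> = \<lfloor>x b' * 2 ^ l\<rfloor>"
          using b by (auto simp: grid_cell_def)
        from this[THEN close] have "\<bar>x b + x b'\<bar> \<le> 2 * (1/2) ^ l" by linarith
        moreover have "2 * (1/2) ^ l < \<bar>x b + x b'\<bar>" using elim(2) b by auto
        ultimately show False by linarith
      qed
    qed
    then show ?case by (simp add: grid_cut_eq)
  qed
  then show ?thesis by (rule tendsto_eventually)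
qed

lemma skernel_grid:
  "skernel m (I \<times> grid_offdiag m l) (\<lambda>(i, w). e i) (\<lambda>(i, w) b. D i b \<inter> grid_cell l (w b)) x
    = skernel m I e D x * grid_cut m l x"
  unfolding skernel_def grid_cut_def sum_product sum.cartesian_product
  by (intro sum.cong refl) (auto simp: indicator_inter_arith prod.distrib)

lemma L2conv_grid_cut:
  assumes T: "L2conv (lborel_pow m) T f"
  shows "L2conv (lborel_pow m) (\<lambda>l x. T l x * grid_cut m l x) f"
proof -
  let ?\<mu> = "lborel_pow m"
  have L: "\<And>n. L2 ?\<mu> (T n)" "L2 ?\<mu> f" using T by (auto simp: L2conv_def)
  have b: "L2 ?\<mu> (\<lambda>x. g x * grid_cut m l x)" "nrm ?\<mu> (\<lambda>x. g x * grid_cut m l x) \<le> nrm ?\<mu> g" if "L2 ?\<mu> g" for g l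
    using L2_bounded_mult[OF that grid_cut_measurable grid_cut_norm, of l] by auto
  have "AE x in ?\<mu>. \<forall>a\<in>{..<m}. \<forall>b\<in>{..<m}. a \<noteq> b \<longrightarrow> x a + x b \<noteq> 0"
    by (intro AE_finite_allI finite_lessThan) (auto intro: AE_sum_nonzero)
  then have "AE x in ?\<mu>. (\<lambda>l. grid_cut m l x) \<longlonglongrightarrow> 1"
    by eventually_elim (auto intro: grid_cut_tendsto)
  then have lim1: "(\<lambda>l. nrm ?\<mu> (\<lambda>x. f x - f x * grid_cut m l x)) \<longlonglongrightarrow> 0"
    by (intro nrm_cutoff_tendsto L grid_cut_measurable grid_cut_norm)
  have "(\<lambda>l. nrm ?\<mu> (\<lambda>x. T l x - f x) + nrm ?\<mu> (\<lambda>x. f x - f x * grid_cut m l x)) \<longlonglongrightarrow> 0 + 0"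
    using T by (intro tendsto_add lim1) (simp add: L2conv_def)
  then have lim: "(\<lambda>l. nrm ?\<mu> (\<lambda>x. T l x - f x) + nrm ?\<mu> (\<lambda>x. f x - f x * grid_cut m l x)) \<longlonglongrightarrow> 0" by simp
  have "(\<lambda>l. nrm ?\<mu> (\<lambda>x. T l x * grid_cut m l x - f x)) \<longlonglongrightarrow> 0"
  proof (rule Lim_null_comparison[OF always_eventually lim], rule allI)
    fix l
    have "nrm ?\<mu> (\<lambda>x. T l x * grid_cut m l x - f x)
       = nrm ?\<mu> (\<lambda>x. (T l x - f x) * grid_cut m l x + (-1) * (f x - f x * grid_cut m l x))"
      by (simp add: algebra_simps)
    also have "\<dots> \<le> nrm ?\<mu> (\<lambda>x. (T l x - f x) * grid_cut m l x) + nrm ?\<mu> (\<lambda>x. (-1) * (f x - f x * grid_cut m l x))"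
      by (intro nrm_triangle L2_cmult L2_diff b L)
    also have "nrm ?\<mu> (\<lambda>x. (-1) * (f x - f x * grid_cut m l x)) = nrm ?\<mu> (\<lambda>x. f x - f x * grid_cut m l x)"
      unfolding nrm_def norm_mult by simp
    also have "nrm ?\<mu> (\<lambda>x. (T l x - f x) * grid_cut m l x) \<le> nrm ?\<mu> (\<lambda>x. T l x - f x)"
      by (intro b L2_diff L)
    finally show "norm (nrm ?\<mu> (\<lambda>x. T l x * grid_cut m l x - f x))
      \<le> nrm ?\<mu> (\<lambda>x. T l x - f x) + nrm ?\<mu> (\<lambda>x. f x - f x * grid_cut m l x)" by simp
  qed
  then show ?thesis using L b(1) by (simp add: L2conv_def)
qed

lemma offdiag_measure_zero:
  assumes A: "symmetric_system N A" and u: "u \<in> offdiag m N" and b: "b < m" "b' < m" "b \<noteq> b'"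
  shows "measure lborel (A (u b) \<inter> uminus ` A (u b')) = 0"
proof -
  have "u b' \<noteq> - u b" using u b by (auto simp: offdiag_def)
  then show ?thesis
    using symmetric_system_cov[OF A offdiag_mem[OF u b(1)] offdiag_mem[OF u b(2)]] by simp
qed

section \<open>Moment formulas for Wiener-Ito integrals in the limit\<close>

context hermitian_gaussian_random_measure begin

lemma has_wiener_ito_integralE:
  assumes "has_wiener_ito_integral M W k f F"
  obtains N A c where "\<And>n. symmetric_system (N n) (A n)" "\<And>n. hermitian_coeffs k (N n) (c n)"
    "L2conv (lborel_pow k) (\<lambda>n. elementary_kernel k (N n) (A n) (c n)) f"
    "L2conv M (\<lambda>n. elementary_integral W k (N n) (A n) (c n)) F"
proof -
  obtain N A c where h: "\<And>n. symmetric_system (N n) (A n)" "\<And>n. hermitian_coeffs k (N n) (c n)"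
    and l: "(\<lambda>n. \<integral>\<^sup>+ x. ennreal ((cmod (elementary_kernel k (N n) (A n) (c n) x - f x))\<^sup>2) \<partial>lborel_pow k) \<longlonglongrightarrow> 0"
      "(\<lambda>n. \<integral>\<^sup>+ \<omega>. ennreal ((cmod (elementary_integral W k (N n) (A n) (c n) \<omega> - F \<omega>))\<^sup>2) \<partial>M) \<longlonglongrightarrow> 0"
    using assms unfolding has_wiener_ito_integral_def by blast
  have m: "f \<in> borel_measurable (lborel_pow k)" "F \<in> borel_measurable M"
    using assms unfolding has_wiener_ito_integral_def hermitian_L2_kernel_def by auto
  have "L2conv (lborel_pow k) (\<lambda>n. elementary_kernel k (N n) (A n) (c n)) f"
    by (rule L2convI_sqn_measurable[OF elementary_kernel_L2[OF h(1)] m(1)]) (use l(1) in \<open>simp add: sqn_def\<close>)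
  moreover have "L2conv M (\<lambda>n. elementary_integral W k (N n) (A n) (c n)) F"
    by (rule L2convI_sqn_measurable[OF allmom_L2[OF elementary_integral_allmom[OF h(1)]] m(2)]) (use l(2) in \<open>simp add: sqn_def\<close>)
  ultimately show ?thesis using that h by blast
qed

text \<open>Kernels are not assumed symmetric, so all rearrangements of the kernel appear instead of
  k! times a squared norm.\<close>

lemma wiener_ito_second_moment:
  assumes "has_wiener_ito_integral M W k f F"
  shows "ip M F F = (\<Sum>\<sigma> | \<sigma> permutes {..<k}. ip (lborel_pow k) (\<lambda>x. f (x \<circ> \<sigma>)) f)"
proof -
  from has_wiener_ito_integralE[OF assms] obtain N A c where
    h: "\<And>n. symmetric_system (N n) (A n)" "\<And>n. hermitian_coeffs k (N n) (c n)"
    and cf: "L2conv (lborel_pow k) (\<lambda>n. elementary_kernel k (N n) (A n) (c n)) f"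
    and cF: "L2conv M (\<lambda>n. elementary_integral W k (N n) (A n) (c n)) F" by blast
  let ?K = "\<lambda>n. elementary_kernel k (N n) (A n) (c n)" and ?I = "\<lambda>n. elementary_integral W k (N n) (A n) (c n)"
  have "ip M (?I n) (?I n) = (\<Sum>\<sigma> | \<sigma> permutes {..<k}. ip (lborel_pow k) (\<lambda>x. ?K n (x \<circ> \<sigma>)) (?K n))" for n
    unfolding elementary_integral_sint elementary_kernel_skernel
    by (intro sint_ip) (auto intro: symmetric_system_fin[OF h(1)] offdiag_mem offdiag_measure_zero[OF h(1)])
  moreover have "(\<lambda>n. ip M (?I n) (?I n)) \<longlonglongrightarrow> ip M F F"
    by (rule L2conv_ip[OF cF cF])
  moreover have "(\<lambda>n. \<Sum>\<sigma> | \<sigma> permutes {..<k}. ip (lborel_pow k) (\<lambda>x. ?K n (x \<circ> \<sigma>)) (?K n))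
      \<longlonglongrightarrow> (\<Sum>\<sigma> | \<sigma> permutes {..<k}. ip (lborel_pow k) (\<lambda>x. f (x \<circ> \<sigma>)) f)"
    by (intro tendsto_sum L2conv_ip L2conv_permute cf) auto
  ultimately show ?thesis using LIMSEQ_unique by simp
qed

lemma elementary_integral_fourth_bounded:
  assumes h: "\<And>n. symmetric_system (N n) (A n)" "\<And>n. hermitian_coeffs k (N n) (c n)"
    and cf: "L2conv (lborel_pow k) (\<lambda>n. elementary_kernel k (N n) (A n) (c n)) f"
  obtains C where "\<And>n. expectation (\<lambda>\<omega>. cmod (elementary_integral W k (N n) (A n) (c n) \<omega>) ^ 4) \<le> C"
proof -
  let ?X = "\<lambda>n. elementary_integral W k (N n) (A n) (c n)"
  let ?b = "\<lambda>n. nrm (lborel_pow k) (elementary_kernel k (N n) (A n) (c n))"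
  have "convergent (\<lambda>n. ?b n)"
    using L2conv_nrm[OF cf] by (auto simp: convergent_def)
  then have "Bseq (\<lambda>n. ?b n)"
    by (rule convergent_imp_Bseq)
  then obtain B where "\<And>n. norm (?b n) \<le> B"
    unfolding Bseq_def by blast
  then have B: "?b n \<le> B" for n
    by simp
  show ?thesis
  proof (rule that)
    fix n
    have "expectation (\<lambda>\<omega>. cmod (?X n \<omega>) ^ 4)
       \<le> fact (4 * k) * ?b n ^ 4"
      by (rule elementary_integral_fourth_moment[OF h])
    also have "\<dots> \<le> fact (4 * k) * B ^ 4"
      by (intro mult_left_mono power_mono B) auto
    finally show "expectation (\<lambda>\<omega>. cmod (?X n \<omega>) ^ 4) \<le> fact (4 * k) * B ^ 4" .
  qed
qed

text \<open>The sum over permutations is the squared norm of the projection of \<open>F G\<close> onto the chaos of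
  order \<open>p + q\<close>, up to normalization.\<close>

lemma wiener_ito_product_inequality:
  assumes F: "has_wiener_ito_integral M W p f F" and G: "has_wiener_ito_integral M W q g G"
    and FG: "L2 M (\<lambda>\<omega>. F \<omega> * G \<omega>)"
  defines "Q \<equiv> \<Sum>\<pi> | \<pi> permutes {..<p + q}. ip (lborel_pow (p + q)) (\<lambda>x. tens p q f g (x \<circ> \<pi>)) (tens p q f g)"
  shows "(cmod Q)\<^sup>2 \<le> (nrm M (\<lambda>\<omega>. F \<omega> * G \<omega>))\<^sup>2 * Re Q"
proof -
  let ?m = "p + q" let ?\<mu> = "lborel_pow ?m" let ?T = "tens p q f g"
  from has_wiener_ito_integralE[OF F] obtain N A c where
    h: "\<And>n. symmetric_system (N n) (A n)" "\<And>n. hermitian_coeffs p (N n) (c n)"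
    and cf: "L2conv (lborel_pow p) (\<lambda>n. elementary_kernel p (N n) (A n) (c n)) f"
    and cF: "L2conv M (\<lambda>n. elementary_integral W p (N n) (A n) (c n)) F" by blast
  from has_wiener_ito_integralE[OF G] obtain N' A' c' where
    h': "\<And>n. symmetric_system (N' n) (A' n)" "\<And>n. hermitian_coeffs q (N' n) (c' n)"
    and cg: "L2conv (lborel_pow q) (\<lambda>n. elementary_kernel q (N' n) (A' n) (c' n)) g"
    and cG: "L2conv M (\<lambda>n. elementary_integral W q (N' n) (A' n) (c' n)) G" by blast
  let ?X = "\<lambda>n. elementary_integral W p (N n) (A n) (c n)"
  let ?Y = "\<lambda>n. elementary_integral W q (N' n) (A' n) (c' n)"
  let ?f = "\<lambda>n. elementary_kernel p (N n) (A n) (c n)"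
  let ?g = "\<lambda>n. elementary_kernel q (N' n) (A' n) (c' n)"
  let ?FG = "\<lambda>\<omega>. F \<omega> * G \<omega>"
  obtain C1 where C1: "\<And>n. expectation (\<lambda>\<omega>. cmod (?X n \<omega>) ^ 4) \<le> C1"
    using elementary_integral_fourth_bounded[OF h cf] by blast
  obtain C2 where C2: "\<And>n. expectation (\<lambda>\<omega>. cmod (?Y n \<omega>) ^ 4) \<le> C2"
    using elementary_integral_fourth_bounded[OF h' cg] by blast
  define I where "I n = offdiag p (N n) \<times> offdiag q (N' n)" for n
  define e where "e n = (\<lambda>(u, v). c n u * c' n v)" for n
  define D where "D n = (\<lambda>(u, v) b. if b < p then A n (u b) else A' n (v (b - p)))" for n
  define T where "T n = tens p q (?f n) (?g n)" for n
  have T: "T n = skernel ?m (I n) (e n) (D n)" for n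
    unfolding T_def elementary_kernel_skernel tens_skernel I_def e_def D_def ..
  have P: "(\<lambda>\<omega>. ?X n \<omega> * ?Y n \<omega>)
      = sint W ?m (I n) (e n) (D n)" for n
    unfolding elementary_integral_sint sint_mult I_def e_def D_def ..
  have fI: "finite (I n)" for n by (simp add: I_def)
  have fD: "D n i b \<in> fin_borel" if "i \<in> I n" "b < ?m" for n i b
    using that by (auto simp: D_def I_def intro!: symmetric_system_fin[OF h(1)] symmetric_system_fin[OF h'(1)] offdiag_mem)
  have cT: "L2conv ?\<mu> T ?T" unfolding T_def by (rule L2conv_tens[OF cf cg])
  \<comment> \<open>The test variables \<open>X l\<close>: the product of the approximants with
    index l, with every box cut along the grid of level l and the boxes that meet reflected cells
    dropped. Their kernels \<open>H l\<close> still tend to the full tensor product because the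
    dropped region shrinks to a null set.\<close>
  define I' where "I' l = I l \<times> grid_offdiag ?m l" for l
  define D' where "D' l = (\<lambda>(i, w) b. D l i b \<inter> grid_cell l (w b))" for l
  define X where "X l = sint W ?m (I' l) (\<lambda>(i, w). e l i) (D' l)" for l
  define H where "H l = skernel ?m (I' l) (\<lambda>(i, w). e l i) (D' l)" for l
  have H: "H l = (\<lambda>x. T l x * grid_cut ?m l x)" for l
    by (rule ext) (simp add: H_def I'_def D'_def skernel_grid T)
  have cH: "L2conv ?\<mu> H ?T" unfolding H[abs_def] by (rule L2conv_grid_cut[OF cT])
  have fI': "finite (I' l)" for l by (simp add: I'_def fI)
  have fD': "D' l i b \<in> fin_borel" if "i \<in> I' l" "b < ?m" for l i b
    using that by (auto simp: D'_def I'_def intro!: fin_borel_Int fD)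
  have off: "measure lborel (D' l i b \<inter> uminus ` D' l i b') = 0"
    if "i \<in> I' l" "b < ?m" "b' < ?m" "b \<noteq> b'" for l i b b'
  proof -
    obtain j w where i: "i = (j, w)" "w \<in> grid_offdiag ?m l" using \<open>i \<in> I' l\<close> by (auto simp: I'_def)
    then have "grid_cell l (w b) \<inter> uminus ` grid_cell l (w b') = {}"
      using that by (auto simp: grid_offdiag_def)
    then have "D' l i b \<inter> uminus ` D' l i b' = {}" by (auto simp: D'_def i)
    then show ?thesis by simp
  qed
  have X: "allmom M (X l)" for l unfolding X_def by (intro sint_allmom fD')
  \<comment> \<open>Here l is fixed and n tends to infinity. The products of approximants may hit
    the hyper-diagonals, but \<open>sint_ip\<close> asks for their absence only in the test kernel.
    The passage to F G is the weak convergence \<open>ip_product_tendsto\<close>.\<close>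
  have step1: "ip M ?FG (X l) = (\<Sum>\<pi> | \<pi> permutes {..<?m}. ip ?\<mu> (\<lambda>x. ?T (x \<circ> \<pi>)) (H l))" for l
  proof (rule LIMSEQ_unique)
    have F4: "integrable M (\<lambda>\<omega>. cmod (?X n \<omega>) ^ 4)"
      "integrable M (\<lambda>\<omega>. cmod (?Y n \<omega>) ^ 4)" for n
      using elementary_integral_allmom[OF h(1)] elementary_integral_allmom[OF h'(1)]
      by (auto simp: allmom_def)
    have "(\<lambda>n. ip M (\<lambda>\<omega>. ?X n \<omega> * ?Y n \<omega>) (X l))
      \<longlonglongrightarrow> ip M ?FG (X l)"
      by (rule ip_product_tendsto[OF cF cG allmom_L2[OF X] F4(1) _ F4(2) _ FG, of "max C1 C2"])
        (simp_all add: le_max_iff_disj C1 C2)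
    then show "(\<lambda>n. ip M (sint W ?m (I n) (e n) (D n)) (X l)) \<longlonglongrightarrow> ip M ?FG (X l)"
      unfolding P .
    have eq: "ip M (sint W ?m (I n) (e n) (D n)) (X l) = (\<Sum>\<pi> | \<pi> permutes {..<?m}. ip ?\<mu> (\<lambda>x. T n (x \<circ> \<pi>)) (H l))" for n
      unfolding T X_def H_def by (intro sint_ip fI fI' fD fD' off)
    have "L2 ?\<mu> (H l)" using cH by (simp add: L2conv_def)
    then show "(\<lambda>n. ip M (sint W ?m (I n) (e n) (D n)) (X l))
       \<longlonglongrightarrow> (\<Sum>\<pi> | \<pi> permutes {..<?m}. ip ?\<mu> (\<lambda>x. ?T (x \<circ> \<pi>)) (H l))"
      unfolding eq by (intro tendsto_sum L2conv_ip L2conv_permute cT L2conv_const) auto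
  qed
  have step2: "complex_of_real ((nrm M (X l))\<^sup>2) = (\<Sum>\<pi> | \<pi> permutes {..<?m}. ip ?\<mu> (\<lambda>x. H l (x \<circ> \<pi>)) (H l))" for l
    unfolding ip_self[symmetric] X_def H_def by (intro sint_ip fI' fD' off)
  have lim1: "(\<lambda>l. \<Sum>\<pi> | \<pi> permutes {..<?m}. ip ?\<mu> (\<lambda>x. ?T (x \<circ> \<pi>)) (H l)) \<longlonglongrightarrow> Q"
    unfolding Q_def using cT
    by (intro tendsto_sum L2conv_ip L2conv_permute cH L2conv_const) (auto simp: L2conv_def)
  have lim2: "(\<lambda>l. \<Sum>\<pi> | \<pi> permutes {..<?m}. ip ?\<mu> (\<lambda>x. H l (x \<circ> \<pi>)) (H l)) \<longlonglongrightarrow> Q"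
    unfolding Q_def by (intro tendsto_sum L2conv_ip L2conv_permute cH) auto
  have "(\<lambda>l. Re (complex_of_real ((nrm M (X l))\<^sup>2))) \<longlonglongrightarrow> Re Q"
    unfolding step2 by (rule tendsto_Re[OF lim2])
  then have lim2': "(\<lambda>l. (nrm M ?FG)\<^sup>2 * (nrm M (X l))\<^sup>2) \<longlonglongrightarrow> (nrm M ?FG)\<^sup>2 * Re Q"
    by (intro tendsto_mult_left) simp
  have lim1': "(\<lambda>l. (cmod (ip M ?FG (X l)))\<^sup>2) \<longlonglongrightarrow> (cmod Q)\<^sup>2"
    unfolding step1 by (intro tendsto_power tendsto_norm lim1)
  show ?thesis
  \<comment> \<open>For each l this is Cauchy-Schwarz between F G and \<open>X l\<close>. The inner
    products and the squared norms of \<open>X l\<close> have the same limit Q.\<close>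
  proof (rule LIMSEQ_le[OF lim1' lim2'], intro exI allI impI)
    fix l
    have "cmod (ip M ?FG (X l)) \<le> nrm M ?FG * nrm M (X l)"
      by (rule L2_Cauchy_Schwarz[OF FG allmom_L2[OF X]])
    then show "(cmod (ip M ?FG (X l)))\<^sup>2 \<le> (nrm M ?FG)\<^sup>2 * (nrm M (X l))\<^sup>2"
      unfolding power_mult_distrib[symmetric] by (intro power_mono) auto
  qed
qed

end

section \<open>Overlap integrals\<close>

lemma measurable_lborel_on_component:
  "i \<in> I \<Longrightarrow> (\<lambda>x. x i) \<in> borel_measurable (lborel_on I)"
  using measurable_component_singleton[of i I "\<lambda>_. lborel :: real measure"] by simp

lemma measurable_lborel_on_sum:
  "S \<subseteq> I \<Longrightarrow> (\<lambda>x. \<Sum>i\<in>S. x i :: real) \<in> borel_measurable (lborel_on I)"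
  by (intro borel_measurable_sum measurable_lborel_on_component) auto

text \<open>A contraction over the variables in \<open>A\<close>, with the weights of the free
  variables taken out. The numbers \<open>b\<close> and \<open>e\<close> are the sums of the free
  variables that share a block with the contracted ones in the two factors.\<close>

definition overlap :: "(real \<Rightarrow> complex) \<Rightarrow> (real \<Rightarrow> real) \<Rightarrow> 'i set \<Rightarrow> real \<Rightarrow> real \<Rightarrow> complex" where
  "overlap \<phi> \<omega> A b e = (\<integral>v. \<phi> ((\<Sum>i\<in>A. v i) + b) * cnj (\<phi> ((\<Sum>i\<in>A. v i) + e)) * of_real (\<Prod>i\<in>A. \<omega> (v i)) \<partial>lborel_on A)"

text \<open>The contracted variables are dummies, so only their number matters. This identifies the
  contractions over \<open>A\<close> and over \<open>C\<close>, which then occur as a number and its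
  conjugate.\<close>

lemma overlap_reindex:
  fixes A :: "'i set" and C :: "'j set"
  assumes [measurable]: "\<phi> \<in> borel_measurable borel" "\<omega> \<in> borel_measurable borel"
    and fin: "finite A" "finite C" "card A = card C"
  shows "overlap \<phi> \<omega> A b e = overlap \<phi> \<omega> C b e"
proof -
  obtain t where t: "bij_betw t C A"
    using finite_same_card_bij[OF fin(2,1)] fin(3) by metis
  let ?f = "\<lambda>v. \<phi> ((\<Sum>i\<in>C. v i) + b) * cnj (\<phi> ((\<Sum>i\<in>C. v i) + e)) * of_real (\<Prod>i\<in>C. \<omega> (v i))"
  note [measurable] = measurable_lborel_on_sum[OF order_refl, of C]
  have [measurable]: "(\<lambda>v. \<Prod>i\<in>C. \<omega> (v i)) \<in> borel_measurable (lborel_on C)"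
    by (intro borel_measurable_prod measurable_compose[OF measurable_lborel_on_component assms(2)])
  have "overlap \<phi> \<omega> C b e = (\<integral>v. ?f (\<lambda>j\<in>C. v (t j)) \<partial>lborel_on A)"
    unfolding overlap_def by (rule integral_lborel_on_reindex[OF t fin(1), symmetric]) measurable
  also have "\<dots> = overlap \<phi> \<omega> A b e"
  proof -
    have "(\<Sum>i\<in>C. (\<lambda>j\<in>C. v (t j)) i) = (\<Sum>i\<in>A. v i)" for v :: "'i \<Rightarrow> real"
      by (subst sum.reindex_bij_betw[OF t, symmetric]) simp
    moreover have "(\<Prod>i\<in>C. \<omega> ((\<lambda>j\<in>C. v (t j)) i)) = (\<Prod>i\<in>A. \<omega> (v i))" for v :: "'i \<Rightarrow> real"
      by (subst prod.reindex_bij_betw[OF t, symmetric]) simp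
    ultimately show ?thesis unfolding overlap_def by simp
  qed
  finally show ?thesis by simp
qed

lemma integral_product_cnj:
  fixes \<alpha> :: "'b \<Rightarrow> complex" and \<beta> :: "'c \<Rightarrow> complex"
  shows "(\<integral>v. \<integral>w. (k * \<alpha> v) * cnj (\<beta> w) \<partial>N \<partial>M) = k * (integral\<^sup>L M \<alpha> * cnj (integral\<^sup>L N \<beta>))"
proof -
  have "(\<integral>w. (k * \<alpha> v) * cnj (\<beta> w) \<partial>N) = (k * \<alpha> v) * cnj (integral\<^sup>L N \<beta>)" for v
    by simp
  then show ?thesis by (simp only: mult.assoc integral_mult_right_zero integral_mult_left_zero)
qed

text \<open>With \<open>S = A \<union> B\<close> and \<open>P = C \<union> B\<close>, integrating out \<open>A\<close> and \<open>C\<close> turns the inner product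
  of the two rearrangements into the integral of a squared modulus.\<close>

lemma overlap_positive:
  fixes A B C E :: "'i set" and \<phi> :: "real \<Rightarrow> complex" and \<omega> :: "real \<Rightarrow> real"
  assumes m[measurable]: "\<phi> \<in> borel_measurable borel" "\<omega> \<in> borel_measurable borel" and \<omega>: "\<And>x. \<omega> x \<ge> 0"
    and fin: "finite A" "finite B" "finite C" "finite E" and card: "card A = card C"
    and disj: "A \<inter> B = {}" "A \<inter> C = {}" "A \<inter> E = {}" "B \<inter> C = {}" "B \<inter> E = {}" "C \<inter> E = {}"
  defines "u \<equiv> \<lambda>x :: 'i \<Rightarrow> real. \<phi> ((\<Sum>i\<in>A. x i) + (\<Sum>i\<in>B. x i)) * \<phi> ((\<Sum>i\<in>C. x i) + (\<Sum>i\<in>E. x i))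
     * cnj (\<phi> ((\<Sum>i\<in>C. x i) + (\<Sum>i\<in>B. x i)) * \<phi> ((\<Sum>i\<in>A. x i) + (\<Sum>i\<in>E. x i)))
     * of_real (\<Prod>i\<in>(B \<union> E) \<union> (A \<union> C). \<omega> (x i))"
  assumes u: "integrable (lborel_on ((B \<union> E) \<union> (A \<union> C))) u"
  shows "Im (\<integral>x. u x \<partial>lborel_on ((B \<union> E) \<union> (A \<union> C))) = 0"
    and "Re (\<integral>x. u x \<partial>lborel_on ((B \<union> E) \<union> (A \<union> C))) \<ge> 0"
    and "Re (\<integral>x. u x \<partial>lborel_on ((B \<union> E) \<union> (A \<union> C))) = 0 \<Longrightarrow>
      AE y in lborel_on (B \<union> E). (\<Prod>i\<in>B \<union> E. \<omega> (y i)) * (cmod (overlap \<phi> \<omega> A (\<Sum>i\<in>B. y i) (\<Sum>i\<in>E. y i)))\<^sup>2 = 0"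
proof -
  let ?I = "B \<union> E" and ?J = "A \<union> C"
  interpret I: finite_product_sigma_finite "\<lambda>_. lborel :: real measure" ?I by standard (use fin in auto)
  interpret J: finite_product_sigma_finite "\<lambda>_. lborel :: real measure" ?J by standard (use fin in auto)
  interpret P: pair_sigma_finite "lborel_on ?I" "lborel_on ?J" ..
  have dIJ: "?I \<inter> ?J = {}" using disj by auto
  have fIJ: "finite ?I" "finite ?J" using fin by auto
  have int2: "integrable (lborel_on ?I \<Otimes>\<^sub>M lborel_on ?J) (\<lambda>x. u (merge ?I ?J x))"
    by (rule integrable_distr[OF measurable_merge])
      (simp add: lborel_product.distr_merge[OF dIJ fIJ] u)
  define g where "g y = (\<integral>z. u (merge ?I ?J (y, z)) \<partial>lborel_on ?J)" for y
  have g: "integrable (lborel_on ?I) g" unfolding g_def by (rule P.integrable_fst'[OF int2])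
  have gu: "(\<integral>x. u x \<partial>lborel_on (?I \<union> ?J)) = (\<integral>y. g y \<partial>lborel_on ?I)"
    unfolding g_def by (rule lborel_product.product_integral_fold[OF dIJ fIJ u])
  define \<rho> where "\<rho> y = (\<Prod>i\<in>?I. \<omega> (y i)) * (cmod (overlap \<phi> \<omega> A (\<Sum>i\<in>B. y i) (\<Sum>i\<in>E. y i)))\<^sup>2" for y :: "'i \<Rightarrow> real"
  have AEg: "AE y in lborel_on ?I. g y = of_real (\<rho> y)"
    \<comment> \<open>Fubini provides integrable slices only for almost every \<open>y\<close>, and
      the inner integral is split over \<open>A\<close> and \<open>C\<close> on those.\<close>
    using P.AE_integrable_fst'[OF int2]
  proof eventually_elim
    case (elim y)
    let ?b = "\<Sum>i\<in>B. y i" and ?e = "\<Sum>i\<in>E. y i" and ?w = "\<Prod>i\<in>?I. \<omega> (y i)"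
    \<comment> \<open>For frozen \<open>y\<close> the integrand separates into a function of the
      variables in \<open>A\<close> and the conjugate of the same expression in the variables of
      \<open>C\<close>.\<close>
    have eq: "u (merge ?I ?J (y, merge A C (v, w))) = (of_real ?w *
        (\<phi> ((\<Sum>i\<in>A. v i) + ?b) * cnj (\<phi> ((\<Sum>i\<in>A. v i) + ?e)) * of_real (\<Prod>i\<in>A. \<omega> (v i)))) *
        cnj (\<phi> ((\<Sum>i\<in>C. w i) + ?b) * cnj (\<phi> ((\<Sum>i\<in>C. w i) + ?e)) * of_real (\<Prod>i\<in>C. \<omega> (w i)))" for v w
    proof -
      let ?x = "merge ?I ?J (y, merge A C (v, w))"
      have s: "(\<Sum>i\<in>A. ?x i) = (\<Sum>i\<in>A. v i)" "(\<Sum>i\<in>C. ?x i) = (\<Sum>i\<in>C. w i)"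
        "(\<Sum>i\<in>B. ?x i) = ?b" "(\<Sum>i\<in>E. ?x i) = ?e"
        using disj by (auto intro!: sum.cong simp: merge_def)
      have "(\<Prod>i\<in>?I \<union> ?J. \<omega> (?x i)) = (\<Prod>i\<in>?I. \<omega> (?x i)) * ((\<Prod>i\<in>A. \<omega> (?x i)) * (\<Prod>i\<in>C. \<omega> (?x i)))"
        using dIJ fIJ fin disj by (simp add: prod.union_disjoint)
      also have "(\<Prod>i\<in>?I. \<omega> (?x i)) = ?w" by (intro prod.cong) (auto simp: merge_def)
      also have "(\<Prod>i\<in>A. \<omega> (?x i)) = (\<Prod>i\<in>A. \<omega> (v i))"
        using disj by (intro prod.cong) (auto simp: merge_def)
      also have "(\<Prod>i\<in>C. \<omega> (?x i)) = (\<Prod>i\<in>C. \<omega> (w i))"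
        using disj by (intro prod.cong) (auto simp: merge_def)
      finally show ?thesis unfolding u_def s by (simp add: mult_ac)
    qed
    have "g y = (\<integral>v. \<integral>w. u (merge ?I ?J (y, merge A C (v, w))) \<partial>lborel_on C \<partial>lborel_on A)"
      unfolding g_def by (rule lborel_product.product_integral_fold[OF disj(2) fin(1,3) elim])
    also have "\<dots> = of_real ?w * (overlap \<phi> \<omega> A ?b ?e * cnj (overlap \<phi> \<omega> C ?b ?e))"
      unfolding eq overlap_def by (rule integral_product_cnj)
    also have "overlap \<phi> \<omega> C ?b ?e = overlap \<phi> \<omega> A ?b ?e"
      by (rule overlap_reindex[OF m fin(3,1) card[symmetric]])
    also have "of_real ?w * (overlap \<phi> \<omega> A ?b ?e * cnj (overlap \<phi> \<omega> A ?b ?e)) = of_real (\<rho> y)"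
      unfolding \<rho>_def of_real_mult complex_norm_square ..
    finally show ?case .
  qed
  have \<rho>: "\<rho> y \<ge> 0" for y unfolding \<rho>_def by (intro mult_nonneg_nonneg prod_nonneg) (auto simp: \<omega>)
  have "Im (\<integral>y. g y \<partial>lborel_on ?I) = (\<integral>y. Im (g y) \<partial>lborel_on ?I)" by (simp add: integral_Im[OF g])
  also have "\<dots> = 0" using AEg by (intro integral_eq_zero_AE) (auto elim: eventually_mono)
  finally show "Im (\<integral>x. u x \<partial>lborel_on (?I \<union> ?J)) = 0" unfolding gu .
  have Re: "Re (\<integral>y. g y \<partial>lborel_on ?I) = (\<integral>y. Re (g y) \<partial>lborel_on ?I)" by (simp add: integral_Re[OF g])
  have nn: "AE y in lborel_on ?I. 0 \<le> Re (g y)" using AEg by eventually_elim (simp add: \<rho>)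
  then show "Re (\<integral>x. u x \<partial>lborel_on (?I \<union> ?J)) \<ge> 0"
    unfolding gu Re by (rule integral_nonneg_AE)
  assume "Re (\<integral>x. u x \<partial>lborel_on (?I \<union> ?J)) = 0"
  then have "(\<integral>y. Re (g y) \<partial>lborel_on ?I) = 0" unfolding gu Re .
  then have "AE y in lborel_on ?I. Re (g y) = 0"
    using integral_nonneg_eq_0_iff_AE[OF integrable_Re[OF g] nn] by simp
  with AEg have "AE y in lborel_on ?I. \<rho> y = 0" by eventually_elim simp
  then show "AE y in lborel_on ?I. (\<Prod>i\<in>?I. \<omega> (y i)) * (cmod (overlap \<phi> \<omega> A (\<Sum>i\<in>B. y i) (\<Sum>i\<in>E. y i)))\<^sup>2 = 0"
    unfolding \<rho>_def .
qed

section \<open>The contraction over one variable near the origin\<close>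

text \<open>The Fourier transform of the indicator of the unit interval.\<close>

definition phi :: "real \<Rightarrow> complex" where
  "phi y = (exp (\<i> * of_real y) - 1) / (\<i> * of_real y)"

lemma phi_measurable[measurable]: "phi \<in> borel_measurable borel"
proof -
  have [measurable]: "(\<lambda>y::real. exp (\<i> * of_real y)) \<in> borel_measurable borel"
    by (intro borel_measurable_continuous_onI continuous_intros)
  show ?thesis unfolding phi_def[abs_def] by measurable
qed

lemma phi_bounds: "cmod (phi y) \<le> 1" "cmod (phi y) \<le> 2 / \<bar>y\<bar>"
proof -
  have n: "cmod (phi y) = cmod (exp (\<i> * of_real y) - 1) / \<bar>y\<bar>"
    by (simp add: phi_def norm_divide norm_mult)
  have "cmod (exp (\<i> * of_real y) - 1) \<le> \<bar>y\<bar>"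
    using iexp_approx1[of y 0] by simp
  then show "cmod (phi y) \<le> 1" unfolding n by (cases "y = 0") auto
  have "cmod (exp (\<i> * of_real y) - 1) \<le> cmod (exp (\<i> * of_real y)) + cmod 1"
    by (rule norm_triangle_ineq4)
  then show "cmod (phi y) \<le> 2 / \<bar>y\<bar>" unfolding n by (intro divide_right_mono) auto
qed

text \<open>The point 0 is excluded because division by zero gives \<open>phi 0 = 0\<close>, whereas
  \<open>phi\<close> tends to 1 there.\<close>

lemma phi_tendsto:
  assumes a: "a \<noteq> 0" and b: "b \<longlonglongrightarrow> 0"
  shows "(\<lambda>n. phi (a + b n)) \<longlonglongrightarrow> phi a"
proof -
  have "(\<lambda>n. (exp (\<i> * of_real (a + b n)) - 1) / (\<i> * of_real (a + b n))) \<longlonglongrightarrow>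
     (exp (\<i> * of_real (a + 0)) - 1) / (\<i> * of_real (a + 0))"
    using a by (intro tendsto_intros b) auto
  then show ?thesis by (simp add: phi_def)
qed

lemma phi_nonzero:
  assumes "0 < y" "y < 1"
  shows "phi y \<noteq> 0"
proof -
  have "Im (exp (\<i> * of_real y) - 1) = sin y" by (simp add: Im_exp)
  moreover have "sin y > 0" using assms pi_gt3 by (intro sin_gt_zero) auto
  ultimately have "exp (\<i> * of_real y) - 1 \<noteq> 0" by (metis less_irrefl zero_complex.simps(2))
  then show ?thesis using assms by (simp add: phi_def)
qed

text \<open>A common majorant of the integrands of \<open>overlap1\<close> for all shifts of size at
  most 1. The singularity at 0 is integrable since s > -1, and the second term covers the
  tails.\<close>

lemma powr_dominating_integrable:
  fixes s :: real
  assumes "- 1 < s"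
  shows "integrable lborel (\<lambda>x. indicator {-2..2} x * \<bar>x\<bar> powr s + 32 * inverse (1 + x\<^sup>2))"
proof -
  have "set_integrable lebesgue {0<..2} (\<lambda>x::real. x powr s)"
    using assms by (intro nonnegative_absolutely_integrable_1 integrable_on_powr_from_0') auto
  then have "integrable lebesgue (\<lambda>x::real. indicator {0<..2} x * x powr s)"
    by (simp add: set_integrable_def)
  then have i: "integrable lborel (\<lambda>x::real. indicator {0<..2} x * x powr s)"
    by (subst (asm) integrable_completion) auto
  then have "integrable lborel (\<lambda>x::real. indicator {0<..2} (0 + (-1) * x) * (0 + (-1) * x) powr s)"
    by (rule lborel_integrable_real_affine) simp
  with i have "integrable lborel (\<lambda>x::real. indicator {0<..2} x * x powr s + indicator {0<..2} (- x) * (- x) powr s)"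
    by simp
  moreover have "indicator {0<..2} x * x powr s + indicator {0<..2} (- x) * (- x) powr s
      = indicator {-2..2} x * \<bar>x\<bar> powr s" for x :: real
    by (auto simp: indicator_def)
  ultimately have "integrable lborel (\<lambda>x::real. indicator {-2..2} x * \<bar>x\<bar> powr s)" by simp
  moreover have "integrable lborel (\<lambda>x::real. inverse (1 + x\<^sup>2))"
    using integrable_inverse_1_plus_square by (simp add: set_integrable_def)
  ultimately show ?thesis by simp
qed

definition overlap1 :: "real \<Rightarrow> real \<Rightarrow> real \<Rightarrow> complex" where
  "overlap1 s b e = (\<integral>a. phi (a + b) * cnj (phi (a + e)) * of_real (\<bar>a\<bar> powr s) \<partial>lborel)"

lemma overlap1_dominated:
  assumes s: "s \<le> 0" and b: "\<bar>b\<bar> \<le> 1" and e: "\<bar>e\<bar> \<le> 1"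
  shows "norm (phi (a + b) * cnj (phi (a + e)) * of_real (\<bar>a\<bar> powr s))
     \<le> indicator {-2..2} a * \<bar>a\<bar> powr s + 32 * inverse (1 + a\<^sup>2)"
proof -
  have n: "norm (phi (a + b) * cnj (phi (a + e)) * of_real (\<bar>a\<bar> powr s))
    = cmod (phi (a + b)) * cmod (phi (a + e)) * \<bar>a\<bar> powr s" by (simp add: norm_mult)
  show ?thesis
  proof (cases "\<bar>a\<bar> \<le> 2")
    case True
    have "cmod (phi (a + b)) * cmod (phi (a + e)) * \<bar>a\<bar> powr s \<le> 1 * 1 * \<bar>a\<bar> powr s"
      by (intro mult_mono phi_bounds) auto
    moreover have "a \<in> {-2..2}" using True by auto
    then have ind: "indicator {-2..2} a = (1 :: real)" by simp
    moreover have "0 \<le> inverse (1 + a\<^sup>2)" by simp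
    ultimately show ?thesis unfolding n ind by linarith
  next
    case False
    \<comment> \<open>For |a| > 2 a shift of size at most 1 leaves |a + z| at least |a| / 2. Two
      such factors give 16 / a^2, and 1 \<le> a^2 turns this into the constant 32.\<close>
    have p: "cmod (phi (a + z)) \<le> 4 / \<bar>a\<bar>" if "\<bar>z\<bar> \<le> 1" for z
    proof -
      have h: "\<bar>a\<bar> / 2 \<le> \<bar>a + z\<bar>" using that False by linarith
      have "cmod (phi (a + z)) \<le> 2 / \<bar>a + z\<bar>" by (rule phi_bounds)
      also have "\<dots> \<le> 2 / (\<bar>a\<bar> / 2)" 
        using h False by (intro divide_left_mono h mult_pos_pos) linarith+
      finally show ?thesis by simp
    qed
    have one: "\<bar>a\<bar> powr s \<le> 1"
      using powr_mono[OF s, of "\<bar>a\<bar>"] False by (auto split: if_splits)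
    have "cmod (phi (a + b)) * cmod (phi (a + e)) * \<bar>a\<bar> powr s \<le> (4 / \<bar>a\<bar>) * (4 / \<bar>a\<bar>) * 1"
      using b e one by (intro mult_mono p) auto
    also have "\<dots> = 16 / a\<^sup>2" by (simp add: power2_eq_square)
    also have "\<dots> \<le> 32 / (1 + a\<^sup>2)"
    proof -
      have "1 \<le> a\<^sup>2" using False power_mono[of 1 "\<bar>a\<bar>" 2] by simp
      then show ?thesis by (simp add: frac_le_eq divide_le_eq field_simps)
    qed
    finally show ?thesis using False unfolding n by (auto simp: indicator_def divide_inverse)
  qed
qed

text \<open>Dominated convergence. The jump of \<open>phi\<close> concerns only the integration
  point 0, which is null.\<close>

lemma overlap1_tendsto:
  assumes s: "- 1 < s" "s \<le> 0" and b: "b \<longlonglongrightarrow> 0" "\<And>n. \<bar>b n\<bar> \<le> 1" and e: "e \<longlonglongrightarrow> 0" "\<And>n. \<bar>e n\<bar> \<le> 1"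
  shows "(\<lambda>n. overlap1 s (b n) (e n)) \<longlonglongrightarrow> overlap1 s 0 0"
  unfolding overlap1_def
proof (rule integral_dominated_convergence[OF _ _ powr_dominating_integrable[OF s(1)]])
  have "AE a in lborel. a \<noteq> (0::real)" by (rule AE_lborel_singleton)
  then show "AE a in lborel. (\<lambda>n. phi (a + b n) * cnj (phi (a + e n)) * of_real (\<bar>a\<bar> powr s))
     \<longlonglongrightarrow> phi (a + 0) * cnj (phi (a + 0)) * of_real (\<bar>a\<bar> powr s)"
  proof eventually_elim
    case (elim a)
    have "(\<lambda>n. phi (a + b n) * cnj (phi (a + e n)) * of_real (\<bar>a\<bar> powr s))
       \<longlonglongrightarrow> phi a * cnj (phi a) * of_real (\<bar>a\<bar> powr s)"
      by (intro tendsto_mult tendsto_const tendsto_cnj phi_tendsto elim b e)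
    then show ?case by simp
  qed
  show "AE a in lborel. norm (phi (a + b n) * cnj (phi (a + e n)) * of_real (\<bar>a\<bar> powr s))
     \<le> indicator {-2..2} a * \<bar>a\<bar> powr s + 32 * inverse (1 + a\<^sup>2)" for n
    by (intro AE_I2 overlap1_dominated s b e)
qed measurable

text \<open>For zero shifts the integrand is |phi|^2 times the weight, which is nonnegative
  everywhere and positive on (0, 1).\<close>

lemma overlap1_nonzero:
  assumes s: "- 1 < s" "s \<le> 0"
  shows "overlap1 s 0 0 \<noteq> 0"
proof
  have sq: "phi (a + 0) * cnj (phi (a + 0)) * of_real (\<bar>a\<bar> powr s) = of_real ((cmod (phi a))\<^sup>2 * \<bar>a\<bar> powr s)" for a
    by (simp only: add_0_right complex_norm_square of_real_mult)
  have i: "integrable lborel (\<lambda>a. (cmod (phi a))\<^sup>2 * \<bar>a\<bar> powr s)"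
  proof (rule Bochner_Integration.integrable_bound[OF powr_dominating_integrable[OF s(1)]])
    show "AE a in lborel. norm ((cmod (phi a))\<^sup>2 * \<bar>a\<bar> powr s) \<le> norm (indicator {-2..2} a * \<bar>a\<bar> powr s + 32 * inverse (1 + a\<^sup>2))"
    proof (rule AE_I2)
      fix a :: real
      have "norm ((cmod (phi a))\<^sup>2 * \<bar>a\<bar> powr s) \<le> indicator {-2..2} a * \<bar>a\<bar> powr s + 32 * inverse (1 + a\<^sup>2)"
        using overlap1_dominated[OF s(2), of 0 0 a] unfolding sq norm_of_real real_norm_def by simp
      then show "norm ((cmod (phi a))\<^sup>2 * \<bar>a\<bar> powr s) \<le> norm (indicator {-2..2} a * \<bar>a\<bar> powr s + 32 * inverse (1 + a\<^sup>2))"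
        unfolding real_norm_def by linarith
    qed
  qed measurable
  have eq: "overlap1 s 0 0 = of_real (\<integral>a. (cmod (phi a))\<^sup>2 * \<bar>a\<bar> powr s \<partial>lborel)"
    unfolding overlap1_def sq by (rule integral_complex_of_real)
  assume "overlap1 s 0 0 = 0"
  with eq have "(\<integral>a. (cmod (phi a))\<^sup>2 * \<bar>a\<bar> powr s \<partial>lborel) = 0" by simp
  then have "AE a in lborel. (cmod (phi a))\<^sup>2 * \<bar>a\<bar> powr s = 0"
    by (subst (asm) integral_nonneg_eq_0_iff_AE[OF i]) auto
  then have "AE a in lborel. a \<notin> {0<..<1::real}"
    by eventually_elim (use phi_nonzero in auto)
  then have "emeasure lborel {0<..<1::real} = 0"
    by (subst (asm) AE_iff_measurable[where N = "{0<..<1::real}"]) auto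
  then show False by simp
qed

text \<open>Otherwise zeros with both shifts below 1/(n + 1) would exist for all n, and continuity
  would make the value at the origin zero.\<close>

lemma overlap1_nonzero_near:
  assumes s: "- 1 < s" "s \<le> 0"
  obtains \<epsilon> where "\<epsilon> > 0" "\<And>b e. \<bar>b\<bar> < \<epsilon> \<Longrightarrow> \<bar>e\<bar> < \<epsilon> \<Longrightarrow> overlap1 s b e \<noteq> 0"
proof -
  have "\<exists>n. \<forall>b e. \<bar>b\<bar> < 1 / real (Suc n) \<longrightarrow> \<bar>e\<bar> < 1 / real (Suc n) \<longrightarrow> overlap1 s b e \<noteq> 0"
  proof (rule ccontr)
    assume "\<not> ?thesis"
    then have "\<forall>n. \<exists>b e. \<bar>b\<bar> < 1 / real (Suc n) \<and> \<bar>e\<bar> < 1 / real (Suc n) \<and> overlap1 s b e = 0" by blast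
    then obtain b e where be: "\<And>n. \<bar>b n\<bar> < 1 / real (Suc n)" "\<And>n. \<bar>e n\<bar> < 1 / real (Suc n)"
      "\<And>n. overlap1 s (b n) (e n) = 0" by metis
    have lim: "(\<lambda>n. 1 / real (Suc n)) \<longlonglongrightarrow> 0" by (rule lim_1_over_n[THEN LIMSEQ_Suc])
    have le1: "1 / real (Suc n) \<le> 1" for n by simp
    have "b \<longlonglongrightarrow> 0" "e \<longlonglongrightarrow> 0"
      by (rule Lim_null_comparison[OF always_eventually lim], use be in \<open>auto intro: less_imp_le\<close>)+
    moreover have "\<bar>b n\<bar> \<le> 1" "\<bar>e n\<bar> \<le> 1" for n
      by (rule order_trans[OF less_imp_le[OF be(1)] le1], rule order_trans[OF less_imp_le[OF be(2)] le1])
    ultimately have "(\<lambda>n. overlap1 s (b n) (e n)) \<longlonglongrightarrow> overlap1 s 0 0"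
      by (intro overlap1_tendsto s)
    then show False using overlap1_nonzero[OF s] be(3) by (simp add: LIMSEQ_const_iff)
  qed
  then obtain n where "\<forall>b e. \<bar>b\<bar> < 1 / real (Suc n) \<longrightarrow> \<bar>e\<bar> < 1 / real (Suc n) \<longrightarrow> overlap1 s b e \<noteq> 0" by blast
  then show ?thesis by (intro that[of "1 / real (Suc n)"]) auto
qed

lemma overlap_singleton: "overlap phi (\<lambda>x. \<bar>x\<bar> powr s) {i} b e = overlap1 s b e"
proof -
  have "(\<integral>v. phi (v i + b) * cnj (phi (v i + e)) * of_real (\<bar>v i\<bar> powr s) \<partial>lborel_on {i}) = overlap1 s b e"
    unfolding overlap1_def
    by (rule lborel_product.product_integral_singleton[of "\<lambda>a. phi (a + b) * cnj (phi (a + e)) * of_real (\<bar>a\<bar> powr s)" i]) measurable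
  then show ?thesis by (simp add: overlap_def)
qed

section \<open>Hermite processes\<close>

lemma hermite_kernel_phi:
  "hermite_kernel k d 1 x = of_real (hermite_const k d) * phi (\<Sum>i<k. x i) * of_real (\<Prod>i<k. \<bar>x i\<bar> powr (- d))"
  by (simp add: hermite_kernel_def phi_def)

text \<open>The lower bound on d is precisely the positivity of 2k(d - 1/2) + 1, and the factor k(d
  - 1/2) + 1 is then positive too.\<close>

lemma hermite_const_pos:
  assumes "0 < d" "d < 1/2" "k \<ge> 1" "d > 1/2 * (1 - 1 / real k)"
  shows "hermite_const k d > 0"
proof -
  have k: "real k > 0" using assms by simp
  have "real k * (1/2 * (1 - 1 / real k)) < real k * d"
    using assms(4) k by (rule mult_strict_left_mono)
  moreover have "real k * (1/2 * (1 - 1 / real k)) = real k / 2 - 1 / 2"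
    using k by (simp add: field_simps)
  ultimately have h: "real k / 2 - 1 / 2 < real k * d" by simp
  have "0 < real k * (d - 1/2) + 1" "0 < 2 * real k * (d - 1/2) + 1"
    using h by (simp_all add: algebra_simps)
  moreover have "sin (d * pi) > 0"
    using assms pi_gt_zero by (intro sin_gt_zero) (auto simp: mult_less_cancel_right1)
  moreover have "Gamma (1 - 2 * d) > 0"
    using assms by (intro Gamma_real_pos) simp
  ultimately show ?thesis
    unfolding hermite_const_def by (intro real_sqrt_gt_zero divide_pos_pos mult_pos_pos zero_less_power) auto
qed

section \<open>Rearrangements of the tensor product of two Hermite kernels\<close>

lemma hermite_kernel_permute:
  assumes "\<sigma> permutes {..<k}"
  shows "hermite_kernel k d 1 (x \<circ> \<sigma>) = hermite_kernel k d 1 x"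
proof -
  have "(\<Sum>i<k. x (\<sigma> i)) = (\<Sum>i<k. x i)"
    using sum.permute[OF assms, of x] by (simp add: comp_def)
  moreover have "(\<Prod>i<k. \<bar>x (\<sigma> i)\<bar> powr (- d)) = (\<Prod>i<k. \<bar>x i\<bar> powr (- d))"
    using prod.permute[OF assms, of "\<lambda>i. \<bar>x i\<bar> powr (- d)"] by (simp add: comp_def)
  ultimately show ?thesis by (simp add: hermite_kernel_phi)
qed

text \<open>Both Hermite kernels are symmetric, so a rearrangement of their tensor product is
  determined by the set \<open>S\<close> of variables that enter the first factor.\<close>

definition split_kernel :: "nat \<Rightarrow> nat \<Rightarrow> real \<Rightarrow> nat set \<Rightarrow> (nat \<Rightarrow> real) \<Rightarrow> complex" where
  "split_kernel p q d S x = of_real (hermite_const p d * hermite_const q d) *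
     (phi (\<Sum>i\<in>S. x i) * phi (\<Sum>i\<in>{..<p+q} - S. x i)) * of_real (\<Prod>i<p+q. \<bar>x i\<bar> powr (- d))"

lemma tens_hermite_kernel:
  "tens p q (hermite_kernel p d 1) (hermite_kernel q d 1) = split_kernel p q d {..<p}"
proof
  fix x :: "nat \<Rightarrow> real"
  have "(\<Sum>i\<in>{..<p+q} - {..<p}. x i) = (\<Sum>b<q. x (p + b))"
    by (rule sum.reindex_bij_witness[of _ "(+) p" "\<lambda>i. i - p"]) auto
  then show "tens p q (hermite_kernel p d 1) (hermite_kernel q d 1) x = split_kernel p q d {..<p} x"
    by (simp add: tens_def hermite_kernel_phi split_kernel_def prod_lessThan_add)
qed

lemma split_kernel_permute:
  assumes \<pi>: "\<pi> permutes {..<p+q}" and S: "S \<subseteq> {..<p+q}"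
  shows "split_kernel p q d S (x \<circ> \<pi>) = split_kernel p q d (\<pi> ` S) x"
proof -
  have inj: "inj \<pi>" by (rule permutes_inj[OF \<pi>])
  have "(\<Sum>i\<in>S. x (\<pi> i)) = (\<Sum>i\<in>\<pi> ` S. x i)" for S
    using inj by (subst sum.reindex) (auto intro: inj_on_subset)
  moreover have "\<pi> ` ({..<p+q} - S) = {..<p+q} - \<pi> ` S"
    using image_set_diff[OF inj] permutes_image[OF \<pi>] by simp
  moreover have "(\<Prod>i<p+q. \<bar>x (\<pi> i)\<bar> powr (- d)) = (\<Prod>i<p+q. \<bar>x i\<bar> powr (- d))"
    using prod.permute[OF \<pi>, of "\<lambda>i. \<bar>x i\<bar> powr (- d)"] by (simp add: comp_def)
  ultimately show ?thesis by (simp add: split_kernel_def)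
qed

context
  fixes p q :: nat and d :: real and S :: "nat set"
  assumes d: "0 < d" "d < 1/2" and c: "hermite_const p d > 0" "hermite_const q d > 0"
    and S: "S \<subseteq> {..<p+q}" "card S = p"
    and L2S: "L2 (lborel_pow (p + q)) (split_kernel p q d S)"
    and L2P: "L2 (lborel_pow (p + q)) (split_kernel p q d {..<p})"
begin

text \<open>The product of the two kernels is, up to a positive constant, the integrand of
  \<open>overlap_positive\<close> with weight |x|^(-2d), where -2d > -1. When exactly one variable
  changes sides, the contraction is \<open>overlap1\<close>, and its nonvanishing near the origin
  makes the integral strictly positive.\<close>

lemma split_kernel_ip:
  shows "Im (ip (lborel_pow (p + q)) (split_kernel p q d S) (split_kernel p q d {..<p})) = 0"
    and "Re (ip (lborel_pow (p + q)) (split_kernel p q d S) (split_kernel p q d {..<p})) \<ge> 0"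
    and "S - {..<p} = {r} \<Longrightarrow> Re (ip (lborel_pow (p + q)) (split_kernel p q d S) (split_kernel p q d {..<p})) > 0"
proof -
  let ?P = "{..<p}" and ?I = "{..<p+q}" and ?ip = "ip (lborel_pow (p + q)) (split_kernel p q d S) (split_kernel p q d {..<p})"
  \<comment> \<open>Variables in \<open>A\<close> and \<open>C\<close> change blocks, those in
    \<open>B\<close> and \<open>E\<close> keep theirs. \<open>A\<close> and \<open>C\<close> have
    equal size because \<open>S\<close> and \<open>{..<p}\<close> both have p elements.\<close>
  define A where "A = S - ?P"
  define B where "B = S \<inter> ?P"
  define C where "C = ?P - S"
  define E where "E = ?I - (S \<union> ?P)"
  define \<omega> where "\<omega> x = \<bar>x\<bar> powr (- 2 * d)" for x :: real
  define \<kappa> where "\<kappa> = (hermite_const p d * hermite_const q d)\<^sup>2"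
  have \<kappa>: "\<kappa> > 0" using c by (simp add: \<kappa>_def)
  have finS: "finite S" using S(1) by (rule finite_subset) simp
  have fin: "finite A" "finite B" "finite C" "finite E" using finS by (auto simp: A_def B_def C_def E_def)
  have disj: "A \<inter> B = {}" "A \<inter> C = {}" "A \<inter> E = {}" "B \<inter> C = {}" "B \<inter> E = {}" "C \<inter> E = {}"
    by (auto simp: A_def B_def C_def E_def)
  have I: "(B \<union> E) \<union> (A \<union> C) = ?I" using S(1) by (auto simp: A_def B_def C_def E_def)
  have SS: "S = A \<union> B" "?I - S = C \<union> E" "?P = C \<union> B" "?I - ?P = A \<union> E"
    using S(1) by (auto simp: A_def B_def C_def E_def)
  have card: "card A = card C"
  proof -
    have "card S = card A + card B" "card ?P = card C + card B"
      by (subst SS, rule card_Un_disjoint; use fin disj in auto)+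
    then show ?thesis using S(2) by simp
  qed
  have [measurable]: "\<omega> \<in> borel_measurable borel" unfolding \<omega>_def[abs_def] by measurable
  define u where "u x = phi ((\<Sum>i\<in>A. x i) + (\<Sum>i\<in>B. x i)) * phi ((\<Sum>i\<in>C. x i) + (\<Sum>i\<in>E. x i))
     * cnj (phi ((\<Sum>i\<in>C. x i) + (\<Sum>i\<in>B. x i)) * phi ((\<Sum>i\<in>A. x i) + (\<Sum>i\<in>E. x i)))
     * of_real (\<Prod>i\<in>(B \<union> E) \<union> (A \<union> C). \<omega> (x i))" for x :: "nat \<Rightarrow> real"
  have eq: "split_kernel p q d S x * cnj (split_kernel p q d ?P x) = of_real \<kappa> * u x" for x
  proof -
    have s: "(\<Sum>i\<in>S. x i) = (\<Sum>i\<in>A. x i) + (\<Sum>i\<in>B. x i)" "(\<Sum>i\<in>?I - S. x i) = (\<Sum>i\<in>C. x i) + (\<Sum>i\<in>E. x i)"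
      "(\<Sum>i\<in>?P. x i) = (\<Sum>i\<in>C. x i) + (\<Sum>i\<in>B. x i)" "(\<Sum>i\<in>?I - ?P. x i) = (\<Sum>i\<in>A. x i) + (\<Sum>i\<in>E. x i)"
      by (subst SS, rule sum.union_disjoint; use fin disj in auto)+
    have "(\<Prod>i\<in>?I. \<omega> (x i)) = (\<Prod>i\<in>?I. \<bar>x i\<bar> powr (- d)) * (\<Prod>i\<in>?I. \<bar>x i\<bar> powr (- d))"
      unfolding prod.distrib[symmetric] \<omega>_def powr_add[symmetric] by simp
    then show ?thesis
      unfolding split_kernel_def u_def s I \<kappa>_def by (simp add: power2_eq_square mult_ac)
  qed
  have int: "integrable (lborel_on ((B \<union> E) \<union> (A \<union> C))) u"
  proof -
    have "integrable (lborel_on ?I) (\<lambda>x. of_real (1 / \<kappa>) * (of_real \<kappa> * u x))"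
      using L2_prod_integrable(2)[OF L2S L2P] unfolding eq by (rule integrable_mult_right)
    then show ?thesis unfolding I using \<kappa> by simp
  qed
  have ip: "?ip = of_real \<kappa> * (\<integral>x. u x \<partial>lborel_on ((B \<union> E) \<union> (A \<union> C)))"
    unfolding ip_def eq I by simp
  have \<omega>: "\<omega> x \<ge> 0" for x by (simp add: \<omega>_def)
  note pos = overlap_positive[OF phi_measurable \<open>\<omega> \<in> borel_measurable borel\<close> \<omega> fin card disj int[unfolded u_def], folded u_def]
  show "Im ?ip = 0" "Re ?ip \<ge> 0" unfolding ip using pos(1,2) \<kappa> by simp_all
  show "Re ?ip > 0" if r: "S - {..<p} = {r}"
  proof (rule ccontr)
    assume "\<not> Re ?ip > 0"
    then have "Re ?ip = 0" using \<open>Re ?ip \<ge> 0\<close> by linarith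
    then have "Re (\<integral>x. u x \<partial>lborel_on ((B \<union> E) \<union> (A \<union> C))) = 0" unfolding ip using \<kappa> by simp
    from pos(3)[OF this] have AE: "AE y in lborel_on (B \<union> E).
      (\<Prod>i\<in>B \<union> E. \<omega> (y i)) * (cmod (overlap1 (- 2 * d) (\<Sum>i\<in>B. y i) (\<Sum>i\<in>E. y i)))\<^sup>2 = 0"
      using r unfolding A_def \<omega>_def[abs_def] by (simp only: overlap_singleton)
    obtain \<epsilon> where \<epsilon>: "\<epsilon> > 0" "\<And>b e. \<bar>b\<bar> < \<epsilon> \<Longrightarrow> \<bar>e\<bar> < \<epsilon> \<Longrightarrow> overlap1 (- 2 * d) b e \<noteq> 0"
      using overlap1_nonzero_near[of "- 2 * d"] d by auto
    define n where "n = real (card (B \<union> E))"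
    \<comment> \<open>Coordinates below \<delta> keep every partial sum below \<epsilon>. The
      denominator n + 1 also covers n = 0, when no free variable is left and the product space is a
      single point of mass 1.\<close>
    define \<delta> where "\<delta> = \<epsilon> / (n + 1)"
    have n: "n \<ge> 0" by (simp add: n_def)
    have \<delta>: "\<delta> > 0" "n * \<delta> < \<epsilon>"
      using \<epsilon>(1) n by (auto simp: \<delta>_def field_simps)
    \<comment> \<open>The box avoids 0, where the convention \<open>0 powr a = 0\<close> would make
      the weight vanish.\<close>
    define N where "N = Pi\<^sub>E (B \<union> E) (\<lambda>_. {0<..<\<delta>})"
    have NS: "N \<in> sets (lborel_on (B \<union> E))"
      unfolding N_def using fin by (intro sets_PiM_I_finite) auto
    have sums: "\<bar>\<Sum>i\<in>X. y i\<bar> < \<epsilon>" if y: "y \<in> N" and X: "X \<subseteq> B \<union> E" for y :: "nat \<Rightarrow> real" and X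
    proof -
      have "\<bar>\<Sum>i\<in>X. y i\<bar> \<le> (\<Sum>i\<in>X. \<bar>y i\<bar>)" by (rule sum_abs)
      also have "\<dots> \<le> (\<Sum>i\<in>X. \<delta>)"
      proof (rule sum_mono)
        fix i assume "i \<in> X"
        then have "y i \<in> {0<..<\<delta>}" using PiE_mem[OF y[unfolded N_def], of i] X by blast
        then show "\<bar>y i\<bar> \<le> \<delta>" by simp
      qed
      also have "\<dots> = real (card X) * \<delta>" by simp
      also have "\<dots> \<le> n * \<delta>"
        unfolding n_def using \<delta>(1) X fin by (intro mult_right_mono) (auto intro: card_mono)
      finally show ?thesis using \<delta>(2) by linarith
    qed
    have "AE y in lborel_on (B \<union> E). y \<notin> N"
      using AE
    proof eventually_elim
      case (elim y)
      show ?case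
      proof
        assume y: "y \<in> N"
        have "\<omega> (y i) > 0" if "i \<in> B \<union> E" for i
          using PiE_mem[OF y[unfolded N_def] that] by (simp add: \<omega>_def)
        then have "(\<Prod>i\<in>B \<union> E. \<omega> (y i)) > 0" by (intro prod_pos) auto
        moreover have "overlap1 (- 2 * d) (\<Sum>i\<in>B. y i) (\<Sum>i\<in>E. y i) \<noteq> 0"
          by (intro \<epsilon>(2) sums y) auto
        ultimately show False using elim by simp
      qed
    qed
    then have "emeasure (lborel_on (B \<union> E)) N = 0"
      using sets.sets_into_space[OF NS] NS by (subst (asm) AE_iff_measurable[where N = N]) auto
    moreover have "emeasure (lborel_on (B \<union> E)) N = (\<Prod>i\<in>B \<union> E. ennreal \<delta>)"
      unfolding N_def using fin \<delta>(1) by (subst lborel_product.emeasure_PiM) auto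
    ultimately show False using \<delta>(1) fin by (auto simp: prod_constant)
  qed
qed

end

text \<open>Permuting the two blocks separately gives distinct elements of the stabilizer. A lower
  bound suffices because each of its elements contributes the same nonnegative amount.\<close>

lemma card_stabilizer_ge:
  "fact p * fact q \<le> card {\<pi>. \<pi> permutes {..<p+q} \<and> \<pi> ` {..<p} = {..<p :: nat}}"
proof -
  let ?P = "{..<p}" and ?R = "{..<p+q} - {..<p}"
  let ?X = "{\<sigma>. \<sigma> permutes ?P} \<times> {\<tau>. \<tau> permutes ?R}"
  let ?c = "\<lambda>(\<sigma>, \<tau>). \<sigma> \<circ> (\<tau> :: nat \<Rightarrow> nat)"
  have card: "card ?X = fact p * fact q"
  proof -
    have "card ?R = q" by (subst card_Diff_subset) auto
    then have "card {\<tau>. \<tau> permutes ?R} = fact q" by (rule card_permutations) simp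
    moreover have "card {\<sigma>. \<sigma> permutes ?P} = fact p" by (rule card_permutations) simp_all
    ultimately show ?thesis by (simp only: card_cartesian_product)
  qed
  have dis: "\<tau> i = i" if "\<tau> permutes ?R" "i \<in> ?P" for \<tau> i
    using that by (auto simp: permutes_def)
  have dis': "\<sigma> i = i" if "\<sigma> permutes ?P" "i \<notin> ?P" for \<sigma> i
    using that by (auto simp: permutes_def)
  have dis'': "\<tau> i \<notin> ?P" if "\<tau> permutes ?R" "i \<notin> ?P" for \<tau> i
    using that permutes_in_image[OF that(1), of i] by (cases "i \<in> ?R") (auto simp: permutes_def)
  have "inj_on ?c ?X"
  proof (rule inj_onI)
    fix x y assume xy: "x \<in> ?X" "y \<in> ?X" "?c x = ?c y"
    obtain \<sigma> \<tau> \<sigma>' \<tau>' where [simp]: "x = (\<sigma>, \<tau>)" "y = (\<sigma>', \<tau>')" by (cases x; cases y)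
    have h: "\<sigma> permutes ?P" "\<tau> permutes ?R" "\<sigma>' permutes ?P" "\<tau>' permutes ?R" using xy by auto
    have e: "\<sigma> (\<tau> i) = \<sigma>' (\<tau>' i)" for i using xy(3) by (auto simp: fun_eq_iff)
    have "\<sigma> i = \<sigma>' i" for i
      using e[of i] dis[OF h(2)] dis[OF h(4)] dis'[OF h(1)] dis'[OF h(3)] by (cases "i \<in> ?P") auto
    moreover have "\<tau> i = \<tau>' i" for i
      using e[of i] dis[OF h(2)] dis[OF h(4)] dis'[OF h(1) dis''[OF h(2)]] dis'[OF h(3) dis''[OF h(4)]]
      by (cases "i \<in> ?P") auto
    ultimately show "x = y" by auto
  qed
  moreover have "?c ` ?X \<subseteq> {\<pi>. \<pi> permutes {..<p+q} \<and> \<pi> ` ?P = ?P}"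
  proof
    fix \<pi> assume "\<pi> \<in> ?c ` ?X"
    then obtain \<sigma> \<tau> where h: "\<pi> = \<sigma> \<circ> \<tau>" "\<sigma> permutes ?P" "\<tau> permutes ?R" by auto
    have "\<sigma> permutes {..<p+q}" "\<tau> permutes {..<p+q}"
      using h by (auto intro: permutes_subset)
    then have "\<pi> permutes {..<p+q}" unfolding h(1) by (intro permutes_compose)
    moreover have "\<pi> ` ?P = \<sigma> ` ?P"
      unfolding h(1) using dis[OF h(3)] by (intro image_cong) auto
    then have "\<pi> ` ?P = ?P" using permutes_image[OF h(2)] by simp
    ultimately show "\<pi> \<in> {\<pi>. \<pi> permutes {..<p+q} \<and> \<pi> ` ?P = ?P}" by simp
  qed
  ultimately have "card ?X \<le> card {\<pi>. \<pi> permutes {..<p+q} \<and> \<pi> ` ?P = ?P}"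
    by (intro card_inj_on_le[of ?c]) (auto intro: finite_subset[OF _ finite_permutations[of "{..<p+q}"]])
  then show ?thesis by (simp only: card)
qed

section \<open>Second moments and the strict inequality\<close>

lemma (in hermitian_gaussian_random_measure) hermite_nrm:
  assumes "has_wiener_ito_integral M W k (hermite_kernel k d 1) F"
  shows "(nrm M F)\<^sup>2 = fact k * (nrm (lborel_pow k) (hermite_kernel k d 1))\<^sup>2"
proof -
  have "complex_of_real ((nrm M F)\<^sup>2) = (\<Sum>\<sigma> | \<sigma> permutes {..<k}. ip (lborel_pow k) (hermite_kernel k d 1) (hermite_kernel k d 1))"
    unfolding ip_self[symmetric] wiener_ito_second_moment[OF assms]
    by (intro sum.cong refl) (simp add: hermite_kernel_permute)
  also have "\<dots> = of_real (fact k * (nrm (lborel_pow k) (hermite_kernel k d 1))\<^sup>2)"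
    by (simp add: card_permutations[of "{..<k}" k] ip_self)
  finally show ?thesis using of_real_eq_iff by blast
qed

lemma (in hermitian_gaussian_random_measure) hermite_product_gap:
  assumes d: "0 < d" "d < 1/2" and pq: "p \<ge> 1" "q \<ge> 1"
    and c: "hermite_const p d > 0" "hermite_const q d > 0"
    and F: "has_wiener_ito_integral M W p (hermite_kernel p d 1) F"
    and G: "has_wiener_ito_integral M W q (hermite_kernel q d 1) G"
    and FG: "L2 M (\<lambda>\<omega>. F \<omega> * G \<omega>)"
  shows "(nrm M (\<lambda>\<omega>. F \<omega> * G \<omega>))\<^sup>2 > (nrm M F)\<^sup>2 * (nrm M G)\<^sup>2"
proof -
  let ?\<mu> = "lborel_pow (p + q)" and ?P = "{..<p}" and ?I = "{..<p+q}"
  let ?T = "split_kernel p q d"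
  let ?ip = "\<lambda>\<pi>. ip ?\<mu> (?T (\<pi> ` ?P)) (?T ?P)"
  let ?Perm = "{\<pi>. \<pi> permutes ?I}" and ?Stab = "{\<pi>. \<pi> permutes ?I \<and> \<pi> ` ?P = ?P}"
  have L: "L2 (lborel_pow p) (hermite_kernel p d 1)" "L2 (lborel_pow q) (hermite_kernel q d 1)"
    using F G by (auto simp: has_wiener_ito_integral_def hermitian_L2_kernel_def L2_def sqn_def)
  have LP: "L2 ?\<mu> (?T ?P)" unfolding tens_hermite_kernel[symmetric] by (rule L2_tens[OF L])
  have perm: "(\<lambda>x. ?T ?P (x \<circ> \<pi>)) = ?T (\<pi> ` ?P)" if "\<pi> permutes ?I" for \<pi>
    using that by (intro ext split_kernel_permute) auto
  have LS: "L2 ?\<mu> (?T (\<pi> ` ?P))" if "\<pi> permutes ?I" for \<pi>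
    using L2_permute[OF that LP] by (simp only: perm[OF that])
  have sub: "\<pi> ` ?P \<subseteq> ?I" "card (\<pi> ` ?P) = p" if "\<pi> permutes ?I" for \<pi>
    using permutes_image[OF that] card_image[OF inj_on_subset[OF permutes_inj[OF that] subset_UNIV], of ?P]
    by auto
  note ip = split_kernel_ip[OF d c sub LS LP]
  define R where "R = (\<Sum>\<pi>\<in>?Perm. Re (?ip \<pi>))"
  have Q: "(\<Sum>\<pi>\<in>?Perm. ip ?\<mu> (\<lambda>x. ?T ?P (x \<circ> \<pi>)) (?T ?P)) = of_real R"
  proof -
    have "(\<Sum>\<pi>\<in>?Perm. ip ?\<mu> (\<lambda>x. ?T ?P (x \<circ> \<pi>)) (?T ?P)) = (\<Sum>\<pi>\<in>?Perm. of_real (Re (?ip \<pi>)))"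
      by (intro sum.cong refl) (simp add: perm complex_eq_iff ip(1))
    then show ?thesis by (simp add: R_def)
  qed
  have ineq: "R\<^sup>2 \<le> (nrm M (\<lambda>\<omega>. F \<omega> * G \<omega>))\<^sup>2 * R"
    using wiener_ito_product_inequality[OF F G FG] unfolding tens_hermite_kernel Q by simp
  \<comment> \<open>Swapping the first variables of the two blocks moves exactly one variable
    across, so this permutation leads to a contraction over one variable.\<close>
  define \<pi>0 where "\<pi>0 = Transposition.transpose 0 p"
  have \<pi>0: "\<pi>0 permutes ?I" unfolding \<pi>0_def using pq by (intro permutes_swap_id) auto
  have \<pi>0p: "\<pi>0 ` ?P - ?P = {p}"
  proof
    show "{p} \<subseteq> \<pi>0 ` ?P - ?P"
      using pq by (auto simp: \<pi>0_def intro!: image_eqI[of _ _ 0])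
    show "\<pi>0 ` ?P - ?P \<subseteq> {p}"
      by (auto simp: \<pi>0_def Transposition.transpose_def split: if_splits)
  qed
  have gap: "Re (?ip \<pi>0) > 0" by (rule ip(3)[OF \<pi>0 \<pi>0 \<pi>0 \<pi>0p])
  have notin: "\<pi>0 \<notin> ?Stab" using \<pi>0p by auto
  have finPerm: "finite ?Perm" by (rule finite_permutations) simp
  have finStab: "finite ?Stab" by (rule finite_subset[OF _ finPerm]) auto
  have N: "Re (?ip \<pi>) = (nrm ?\<mu> (?T ?P))\<^sup>2" if "\<pi> \<in> ?Stab" for \<pi>
    using that by (simp add: ip_self)
  have "fact p * fact q * (nrm ?\<mu> (?T ?P))\<^sup>2 \<le> real (card ?Stab) * (nrm ?\<mu> (?T ?P))\<^sup>2"
  proof (rule mult_right_mono)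
    have "real (fact p * fact q) \<le> real (card ?Stab)" using card_stabilizer_ge by (rule of_nat_mono)
    then show "fact p * fact q \<le> real (card ?Stab)" by simp
  qed simp
  also have "\<dots> = (\<Sum>\<pi>\<in>?Stab. Re (?ip \<pi>))" using N by simp
  also have "\<dots> < Re (?ip \<pi>0) + (\<Sum>\<pi>\<in>?Stab. Re (?ip \<pi>))" using gap by simp
  also have "\<dots> = (\<Sum>\<pi>\<in>insert \<pi>0 ?Stab. Re (?ip \<pi>))" using finStab notin by simp
  also have "\<dots> \<le> R"
    unfolding R_def using finPerm \<pi>0 ip(2) by (intro sum_mono2) auto
  finally have R: "fact p * fact q * (nrm ?\<mu> (?T ?P))\<^sup>2 < R" .
  then have Rpos: "R > 0" by (rule le_less_trans[rotated]) simp
  \<comment> \<open>The inequality for \<open>R\<^sup>2\<close> can be divided by \<open>R\<close>,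
    whose positivity comes from the strict lower bound just obtained.\<close>
  have "R \<le> (nrm M (\<lambda>\<omega>. F \<omega> * G \<omega>))\<^sup>2"
    using ineq Rpos by (simp add: power2_eq_square)
  moreover have "(nrm M F)\<^sup>2 * (nrm M G)\<^sup>2 = fact p * fact q * (nrm ?\<mu> (?T ?P))\<^sup>2"
    unfolding hermite_nrm[OF F] hermite_nrm[OF G] tens_hermite_kernel[symmetric] nrm_tens[OF L]
    by (simp add: power_mult_distrib)
  ultimately show ?thesis using R by linarith
qed

theorem proposition3p5:
  fixes M :: "'a measure" and W :: "real set \<Rightarrow> 'a \<Rightarrow> complex"
    and J :: nat and k :: "nat \<Rightarrow> nat" and d :: real
    and Z :: "nat \<Rightarrow> real \<Rightarrow> 'a \<Rightarrow> complex"
  assumes "hermitian_gaussian_random_measure M W"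
    and "J \<ge> 2"
    and "\<And>j. j \<in> {1..J} \<Longrightarrow> k j \<ge> 1"
    and "0 < d" and "d < 1/2"
    and "\<And>j. j \<in> {1..J} \<Longrightarrow> d > 1/2 * (1 - 1 / real (k j))"
    and "\<And>j. j \<in> {1..J} \<Longrightarrow> hermite_process M W (k j) d (Z j)"
  shows "\<not> independent_processes M Z {1..J}"
proof
  assume ind: "independent_processes M Z {1..J}"
  interpret hermitian_gaussian_random_measure M W by fact
  have J: "1 \<in> {1..J}" "2 \<in> {1..J}" using assms(2) by auto
  define F where "F = Z 1 1"
  define G where "G = Z 2 1"
  have F: "has_wiener_ito_integral M W (k 1) (hermite_kernel (k 1) d 1) F"
    and G: "has_wiener_ito_integral M W (k 2) (hermite_kernel (k 2) d 1) G"
    using assms(7)[OF J(1)] assms(7)[OF J(2)] by (auto simp: hermite_process_def F_def G_def)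
  have LF: "L2 M F" and LG: "L2 M G"
    using has_wiener_ito_integralE[OF F] has_wiener_ito_integralE[OF G] unfolding L2conv_def by metis+
  note [measurable] = LF[THEN L2_measurable] LG[THEN L2_measurable]
  have "indep_vars (\<lambda>_. Pi\<^sub>M {0<..} (\<lambda>_. borel)) (\<lambda>j \<omega>. \<lambda>t\<in>{0<..}. Z j t \<omega>) {1, 2}"
    using ind unfolding independent_processes_def by (rule indep_vars_subset) (use J in auto)
  \<comment> \<open>Independence of whole paths passes to measurable functionals, here the squared
    modulus at time 1.\<close>
  then have "indep_vars (\<lambda>_. borel) (\<lambda>j \<omega>. ennreal ((cmod ((\<lambda>t\<in>{0<..}. Z j t \<omega>) 1))\<^sup>2)) {1, 2}"
  proof (rule indep_vars_compose2)
    have one: "1 \<in> {0::real<..}" by simp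
    have sq: "(\<lambda>z :: complex. ennreal ((cmod z)\<^sup>2)) \<in> borel \<rightarrow>\<^sub>M borel" by measurable
    show "(\<lambda>x. ennreal ((cmod (x 1))\<^sup>2)) \<in> Pi\<^sub>M {0::real<..} (\<lambda>_. borel) \<rightarrow>\<^sub>M borel"
      by (rule measurable_compose[OF measurable_component_singleton[OF one] sq])
  qed
  then have iv: "indep_vars (\<lambda>_. borel) (\<lambda>j \<omega>. ennreal ((cmod (Z j 1 \<omega>))\<^sup>2)) {1, 2}" by simp
  \<comment> \<open>The factorization is taken for nonnegative integrals, so it proves the square
    integrability of \<open>F G\<close> at the same time as it computes the norm.\<close>
  have "(\<integral>\<^sup>+ \<omega>. (\<Prod>j\<in>{1, 2}. ennreal ((cmod (Z j 1 \<omega>))\<^sup>2)) \<partial>M) = (\<Prod>j\<in>{1, 2}. \<integral>\<^sup>+ \<omega>. ennreal ((cmod (Z j 1 \<omega>))\<^sup>2) \<partial>M)"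
    by (rule indep_vars_nn_integral[OF _ iv]) auto
  then have "sqn M (\<lambda>\<omega>. F \<omega> * G \<omega>) = sqn M F * sqn M G"
    by (simp add: sqn_def F_def G_def norm_mult power_mult_distrib ennreal_mult)
  also have "\<dots> = ennreal ((nrm M F)\<^sup>2 * (nrm M G)\<^sup>2)"
    by (simp add: sqn_eq_nrm LF LG ennreal_mult)
  finally have sq: "sqn M (\<lambda>\<omega>. F \<omega> * G \<omega>) = ennreal ((nrm M F)\<^sup>2 * (nrm M G)\<^sup>2)" .
  have FG: "L2 M (\<lambda>\<omega>. F \<omega> * G \<omega>)"
    unfolding L2_def sq by simp
  have "(nrm M (\<lambda>\<omega>. F \<omega> * G \<omega>))\<^sup>2 = (nrm M F)\<^sup>2 * (nrm M G)\<^sup>2"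
    using sq sqn_eq_nrm[OF FG] by simp
  moreover have "(nrm M (\<lambda>\<omega>. F \<omega> * G \<omega>))\<^sup>2 > (nrm M F)\<^sup>2 * (nrm M G)\<^sup>2"
    using assms(3)[OF J(1)] assms(3)[OF J(2)] assms(6)[OF J(1)] assms(6)[OF J(2)]
    by (intro hermite_product_gap[OF assms(4,5) _ _ _ _ F G FG] hermite_const_pos assms(4,5)) auto
  ultimately show False by simp
qed

end
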